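(* Let $\mathcal T\subset\mathbb R$ be a closed finite interval, $k,r\in\mathbb N$, and $\mathbf H\in\mathbb R^{r\times k}$ a fixed matrix. Consider $k$ independent samples of real-valued stochastic processes on $\mathcal T$, where for each $i\in\{1,\dots,k\}$ the $i$th sample is $x_{i1},\dots,x_{in_i}$, $n=\sum_{i=1}^k n_i$, and put $v_{ij}:=x_{ij}-\eta_i$. Assume that for every $i\in\{1,\dots,k\}$: (i) $x_{i1},\dots,x_{in_i}$ are i.i.d. with mean function $\eta_i$ and covariance function $\gamma_i$ and take values in $\mathcal L_2(\mathcal T)$; (ii) $\eta_i\in\mathcal L_2(\mathcal T)$; (iii) the function $\mathcal T\ni t\mapsto\gamma_i(t,t)\in\mathbb R$ is continuous and positive; (iv) there exists $\tau_i>0$ such that $n_i/n\to\tau_i$ as $n\to\infty$; (v) $\mathrm E\big[\big(\int_{\mathcal T}v_{i1}^2(t)\,\mathrm dt\big)^2\big]<\infty$; (vi) for each $j\in\{1,2\}$, $\mathrm E_{\mathrm{out}}\Big[\sup_{t,s\in\mathcal T,\,|t-s|<\delta}|v_{i1}(t)v_{ij}(t)-v_{i1}(s)v_{ij}(s)|\Big]\to0$ as $\delta\to0$. Let $\mathbf z\sim GP_r(\mathbf 0_r,\mathbf H\boldsymbol\Sigma\mathbf H^\top)$. Then the parametric bootstrap statistic satisfies, as $n\to\infty$, $$T_n^{\mathcal P}(\mathbf H)\xrightarrow{d^*}\int_{\mathcal T}\mathbf z^\top(t)\big(\mathbf H\boldsymbol\Sigma(t,t)\mathbf H^\top\big)^+\mathbf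 z(t)\,\mathrm dt .$$
   Context: $\mathcal L_2(\mathcal T)$ is the Hilbert space of square-integrable real functions on $\mathcal T$. $\mathrm E_{\mathrm{out}}$ is outer expectation. $\mathbf A^+$ is the Moore–Penrose inverse of $\mathbf A$. $GP(0,\gamma)$ denotes a real centered Gaussian process on $\mathcal T$ with covariance function $\gamma$; $GP_r(\mathbf 0_r,\boldsymbol\Gamma)$ denotes an $r$-dimensional centered Gaussian process on $\mathcal T$, viewed as a random element of $\mathcal L_2^r(\mathcal T)$, with covariance function $\boldsymbol\Gamma:\mathcal T^2\to\mathbb R^{r\times r}$. Define $$\boldsymbol\Sigma(t,s):=\mathrm{diag}\Big(\tfrac1{\tau_1}\gamma_1(t,s),\dots,\tfrac1{\tau_k}\gamma_k(t,s)\Big),$$ $\widehat\eta_i(t):=\frac1{n_i}\sum_{j=1}^{n_i}x_{ij}(t)$ and $\widehat\gamma_i(t,s):=\frac1{n_i-1}\sum_{j=1}^{n_i}(x_{ij}(t)-\widehat\eta_i(t))(x_{ij}(s)-\widehat\eta_i(s))$. Parametric bootstrap: conditionally on the data, for each $i$ let $x_{i1}^{\mathcal P},\dots,x_{in_i}^{\mathcal P}\sim GP(0,\widehat\gamma_i)$, all independent (within and across groups). Let $\widehat\eta_i^{\mathcal P}(t):=\frac1{n_i}\sum_{j}x_{ij}^{\mathcal P}(t)$, $\widehat{\boldsymbol\eta}^{\mathcal P}:=(\widehat\eta_1^{\mathcal P},\dots,\widehat\eta_k^{\mathcal P})^\top$, $\widehat\gamma_i^{\mathcal P}(t,s):=\frac1{n_i-1}\sum_j(x_{ij}^{\mathcal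 P}(t)-\widehat\eta_i^{\mathcal P}(t))(x_{ij}^{\mathcal P}(s)-\widehat\eta_i^{\mathcal P}(s))$, $\widehat{\boldsymbol\Sigma}^{\mathcal P}(t,s):=\mathrm{diag}(\frac n{n_1}\widehat\gamma_1^{\mathcal P}(t,s),\dots,\frac n{n_k}\widehat\gamma_k^{\mathcal P}(t,s))$, and $$T_n^{\mathcal P}(\mathbf H):=\int_{\mathcal T}n\,(\mathbf H\widehat{\boldsymbol\eta}^{\mathcal P}(t))^\top\big(\mathbf H\widehat{\boldsymbol\Sigma}^{\mathcal P}(t,t)\mathbf H^\top\big)^+\mathbf H\widehat{\boldsymbol\eta}^{\mathcal P}(t)\,\mathrm dt .$$ $\xrightarrow{d^*}$ denotes conditional convergence in distribution given the data $(x_{i1},x_{i2},\dots)_{i\in\{1,\dots,k\}}$, in probability: every subsequence has a further subsequence along which, for almost every realization of the data, the conditional law given the data converges weakly to the law of the limit (equivalently, the bounded Lipschitz distance between the conditional law and the limit law tends to $0$ in outer probability). *)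

theory Defs
  imports "HOL-Probability.Probability"
begin

subsection \<open>Matrices\<close>

definition is_moore_penrose :: "real ^ 'n ^ 'm \<Rightarrow> real ^ 'm ^ 'n \<Rightarrow> bool" where
  "is_moore_penrose A X \<longleftrightarrow>
     A ** X ** A = A \<and> X ** A ** X = X \<and>
     transpose (A ** X) = A ** X \<and> transpose (X ** A) = X ** A"

text \<open>Every real matrix has exactly one Moore-Penrose inverse, so the description is proper.\<close>

definition pinv :: "real ^ 'n ^ 'm \<Rightarrow> real ^ 'm ^ 'n" where
  "pinv A = (THE X. is_moore_penrose A X)"

definition diag_mat :: "('k \<Rightarrow> real) \<Rightarrow> real ^ 'k ^ 'k" where
  "diag_mat d = (\<chi> i j. if i = j then d i else 0)"


subsection \<open>Stochastic processes on a set of reals\<close>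

text \<open>
  A process is a function of the random element first and of time second, so that
  \<open>X \<omega>\<close> is a sample path. Only the values at times in \<open>T\<close> matter. Processes are taken to be
  jointly measurable, which makes them random elements of the Hilbert space of
  square-integrable functions as soon as their paths are square-integrable.
\<close>

definition measurable_process ::
    "'a measure \<Rightarrow> real set \<Rightarrow> ('a \<Rightarrow> real \<Rightarrow> 'e::topological_space) \<Rightarrow> bool" where
  "measurable_process M T X \<longleftrightarrow>
     (\<lambda>(\<omega>, t). X \<omega> t) \<in> borel_measurable (M \<Otimes>\<^sub>M restrict_space borel T)"

definition square_integrable_on :: "(real \<Rightarrow> real) \<Rightarrow> real set \<Rightarrow> bool"
    (infix \<open>square'_integrable'_on\<close> 50) where
  "f square_integrable_on T \<longleftrightarrow>
     set_borel_measurable lborel T f \<and> set_integrable lborel T (\<lambda>t. (f t)\<^sup>2)"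

text \<open>The path of a process as a random element of the product space over \<open>T\<close>.\<close>

definition path_on :: "real set \<Rightarrow> ('a \<Rightarrow> real \<Rightarrow> real) \<Rightarrow> 'a \<Rightarrow> real \<Rightarrow> real" where
  "path_on T X = (\<lambda>\<omega>. restrict (X \<omega>) T)"

abbreviation path_space :: "real set \<Rightarrow> (real \<Rightarrow> real) measure" where
  "path_space T \<equiv> PiM T (\<lambda>_. borel)"

definition centered_normal :: "real \<Rightarrow> real measure" where
  "centered_normal v =
     (if v = 0 then return borel 0 else density lborel (normal_density 0 (sqrt v)))"

text \<open>
  Every linear combination of values is normal, possibly degenerate. The operator \<open>C t s\<close> is the
  cross-covariance of the values at \<open>t\<close> and \<open>s\<close>. The requirement that the variances are
  nonnegative excludes functions \<open>C\<close> that are not covariance functions, for which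
  \<^const>\<open>centered_normal\<close> has no meaning. When the variance is integrable over \<open>T\<close>, almost every path
  is square-integrable by Tonelli's theorem.
\<close>

definition centered_gaussian_process ::
    "'b measure \<Rightarrow> real set \<Rightarrow> (real \<Rightarrow> real \<Rightarrow> 'e \<Rightarrow> 'e) \<Rightarrow>
     ('b \<Rightarrow> real \<Rightarrow> 'e::euclidean_space) \<Rightarrow> bool" where
  "centered_gaussian_process N T C Z \<longleftrightarrow>
     prob_space N \<and> measurable_process N T Z \<and>
     (\<forall>F c. finite F \<and> F \<subseteq> T \<longrightarrow>
        0 \<le> (\<Sum>t\<in>F. \<Sum>s\<in>F. c t \<bullet> C t s (c s)) \<and>
        distr N borel (\<lambda>\<omega>. \<Sum>t\<in>F. c t \<bullet> Z \<omega> t) =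
          centered_normal (\<Sum>t\<in>F. \<Sum>s\<in>F. c t \<bullet> C t s (c s)))"

definition GP ::
    "'b measure \<Rightarrow> real set \<Rightarrow> (real \<Rightarrow> real \<Rightarrow> real) \<Rightarrow> ('b \<Rightarrow> real \<Rightarrow> real) \<Rightarrow> bool" where
  "GP N T \<gamma> Z \<longleftrightarrow> centered_gaussian_process N T (\<lambda>t s u. \<gamma> t s * u) Z"

definition GP_vec ::
    "'b measure \<Rightarrow> real set \<Rightarrow> (real \<Rightarrow> real \<Rightarrow> real ^ 'r ^ 'r) \<Rightarrow>
     ('b \<Rightarrow> real \<Rightarrow> real ^ 'r) \<Rightarrow> bool" where
  "GP_vec N T \<Gamma> Z \<longleftrightarrow> centered_gaussian_process N T (\<lambda>t s u. \<Gamma> t s *v u) Z"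

text \<open>Outer expectation of a nonnegative, not necessarily measurable function.\<close>

definition outer_expectation :: "'a measure \<Rightarrow> ('a \<Rightarrow> ennreal) \<Rightarrow> ennreal" where
  "outer_expectation M f =
     (INF g \<in> {g \<in> borel_measurable M. \<forall>\<omega>\<in>space M. f \<omega> \<le> g \<omega>}. \<integral>\<^sup>+\<omega>. g \<omega> \<partial>M)"


subsection \<open>Functionals of the samples\<close>

text \<open>
  Observations in a sample are numbered from 1. The degenerate sample sizes, where the
  formulas divide by 0, play no role asymptotically.
\<close>

definition sample_mean :: "nat \<Rightarrow> (nat \<Rightarrow> real \<Rightarrow> real) \<Rightarrow> real \<Rightarrow> real" where
  "sample_mean m y t = 1 / real m * (\<Sum>j=1..m. y j t)"

definition sample_cov :: "nat \<Rightarrow> (nat \<Rightarrow> real \<Rightarrow> real) \<Rightarrow> real \<Rightarrow> real \<Rightarrow> real" where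
  "sample_cov m y t s =
     1 / (real m - 1) *
       (\<Sum>j=1..m. (y j t - sample_mean m y t) * (y j s - sample_mean m y s))"

definition total_size :: "('k::finite \<Rightarrow> nat) \<Rightarrow> nat" where
  "total_size m = (\<Sum>i\<in>UNIV. m i)"

definition mean_vec ::
    "('k::finite \<Rightarrow> nat) \<Rightarrow> ('k \<Rightarrow> nat \<Rightarrow> real \<Rightarrow> real) \<Rightarrow> real \<Rightarrow> real ^ 'k" where
  "mean_vec m y t = (\<chi> i. sample_mean (m i) (y i) t)"

definition Sigma_hat ::
    "('k::finite \<Rightarrow> nat) \<Rightarrow> ('k \<Rightarrow> nat \<Rightarrow> real \<Rightarrow> real) \<Rightarrow> real \<Rightarrow> real \<Rightarrow> real ^ 'k ^ 'k" where
  "Sigma_hat m y t s =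
     diag_mat (\<lambda>i. real (total_size m) / real (m i) * sample_cov (m i) (y i) t s)"

definition Sigma_lim ::
    "('k::finite \<Rightarrow> real) \<Rightarrow> ('k \<Rightarrow> real \<Rightarrow> real \<Rightarrow> real) \<Rightarrow> real \<Rightarrow> real \<Rightarrow> real ^ 'k ^ 'k" where
  "Sigma_lim \<tau> \<gamma> t s = diag_mat (\<lambda>i. 1 / \<tau> i * \<gamma> i t s)"

definition statistic ::
    "real set \<Rightarrow> real ^ 'k ^ 'r \<Rightarrow> ('k::finite \<Rightarrow> nat) \<Rightarrow> ('k \<Rightarrow> nat \<Rightarrow> real \<Rightarrow> real) \<Rightarrow> real" where
  "statistic T H m y =
     (LBINT t:T. real (total_size m) *
        ((H *v mean_vec m y t) \<bullet>
           (pinv (H ** Sigma_hat m y t t ** transpose H) *v (H *v mean_vec m y t))))"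


subsection \<open>Parametric bootstrap and conditional convergence\<close>

text \<open>
  For a fixed realisation \<open>x\<close> of the data and sample sizes \<open>m\<close>, the processes \<open>Y i j\<close> on the
  probability space \<open>N\<close> form a parametric bootstrap sample.
\<close>

definition parametric_bootstrap ::
    "'b measure \<Rightarrow> real set \<Rightarrow> ('k::finite \<Rightarrow> nat) \<Rightarrow> ('k \<Rightarrow> nat \<Rightarrow> real \<Rightarrow> real) \<Rightarrow>
     ('k \<Rightarrow> nat \<Rightarrow> 'b \<Rightarrow> real \<Rightarrow> real) \<Rightarrow> bool" where
  "parametric_bootstrap N T m x Y \<longleftrightarrow>
     prob_space N \<and>
     (\<forall>i. \<forall>j\<in>{1..m i}. GP N T (sample_cov (m i) (x i)) (Y i j)) \<and>
     prob_space.indep_vars N (\<lambda>_. path_space T) (\<lambda>(i, j). path_on T (Y i j))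
       (SIGMA i:UNIV. {1..m i})"

text \<open>
  Here \<open>L n \<omega>\<close> is the conditional law, given the data, of the \<open>n\<close>-th statistic at \<open>\<omega>\<close>.
\<close>

definition cond_conv_in_distr ::
    "'a measure \<Rightarrow> (nat \<Rightarrow> 'a \<Rightarrow> real measure) \<Rightarrow> real measure \<Rightarrow> bool" where
  "cond_conv_in_distr M L \<mu> \<longleftrightarrow>
     (\<forall>f :: nat \<Rightarrow> nat. strict_mono f \<longrightarrow>
        (\<exists>g :: nat \<Rightarrow> nat. strict_mono g \<and>
           (AE \<omega> in M. weak_conv_m (\<lambda>l. L (f (g l)) \<omega>) \<mu>)))"

end

theory Submission
  imports Defs
begin

text \<open>
  The conditional law of the statistic is treated for a fixed realisation of the data, with all
  limits reduced to finitely many times. Conditionally, \<open>sqrt n\<close> times the bootstrap mean is exactly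
  Gaussian, and the quadratic form in the integrand is, after the studentizing matrix has been
  replaced by its limit, a sum of squares of linear functionals of a Gaussian process. Writing
  \<open>exp (- l * x\<^sup>2)\<close> as a mean of characteristic functions over an auxiliary normal variable, the joint
  Laplace transforms of the integrand at finitely many times depend only on the covariances, so they
  converge as soon as the sample covariances converge at almost all pairs of times. By Fubini,
  integrating these transforms over the times gives the moments of the integral of \<open>exp (- l * q t)\<close>
  over \<open>t\<close>, where \<open>q t\<close> denotes the integrand of the statistic. These integrals are bounded, hence they
  converge in law, and \<open>(1 - exp (- l * q t)) / l\<close> approximates \<open>q t\<close> in mean, uniformly in \<open>t\<close> and the
  sample size, as \<open>l\<close> tends to 0, because the second moments of \<open>q t\<close> are uniformly bounded: the form is dominated by a sum of squared t-statistics, whose laws do not depend on \<open>t\<close>. The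
  sample covariances converge in mean at every pair of times by the weak law of large numbers,
  hence along a subsequence for almost every realisation at almost every pair of times.
\<close>

subsection \<open>Moore-Penrose inverses\<close>

text \<open>Two obstacles shape the proof. The Moore-Penrose inverse jumps where the rank changes,
  so it cannot simply be applied to converging studentizing matrices. For positive weights
  \<open>d\<close>, however, the range of \<open>H ** diag_mat d ** transpose H\<close> is the range
  of \<open>H\<close>, whatever the weights, and on vectors \<open>H *v x\<close> the change of the
  quadratic form is controlled by the relative change of \<open>d\<close>. Second, the bootstrap
  variances are close to their limits only at a single time with high probability, and the form may
  be large where a variance happens to be small; no uniform control over the paths is at hand.
  Everything is therefore reduced to expectations at fixed times, where scale invariance of the
  t-statistic takes the place of a uniform lower bound on the variances. Since the pairs of equal
  times form a null set of the square, convergence at almost every pair says nothing about the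
  variances, and the diagonal is carried along as a separate statement.\<close>

lemma matrix_diff_distribs:
  fixes A :: "real ^ 'n ^ 'm"
  shows "(A - B) ** C = A ** C - B ** C" and "D ** (A - B) = D ** A - D ** B"
  by (simp_all add: vec_eq_iff matrix_matrix_mult_def left_diff_distrib right_diff_distrib sum_subtractf)

lemma transpose_minus: "transpose (A - B) = transpose A - transpose (B :: real ^ 'n ^ 'm)"
  by (simp add: vec_eq_iff transpose_def)

lemma transpose_zero: "transpose 0 = (0 :: real ^ 'n ^ 'm)"
  by (simp add: vec_eq_iff transpose_def)

lemma matrix_ginverse_exists:
  fixes A :: "real ^ 'n ^ 'm"
  obtains G where "A ** G ** A = A"
proof -
  obtain g where g: "linear g" "\<forall>v\<in>range ((*v) A). A *v g v = v"
    using linear_exists_right_inverse_on[OF matrix_vector_mul_linear[of A] subspace_UNIV] by auto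
  have "A ** matrix g ** A = A"
    by (rule matrix_eq[THEN iffD2]) (use g in \<open>simp add: matrix_vector_mul_assoc[symmetric] matrix_works\<close>)
  then show ?thesis ..
qed

text \<open>The diagonal of E E^T consists of the squared norms of the rows of E. This is the
  cancellation rule behind the matrix identities below: E vanishes as soon as E A = 0 and E^T has A
  as its left factor.\<close>

lemma matrix_mul_transpose_eq_0:
  fixes E :: "real ^ 'n ^ 'm"
  assumes "E ** transpose E = 0"
  shows "E = 0"
proof -
  have "(\<Sum>k\<in>UNIV. E $ i $ k * E $ i $ k) = 0" for i
    using arg_cong[OF assms, of "\<lambda>B. B $ i $ i"]
    by (simp add: matrix_matrix_mult_def transpose_def)
  then have "E $ i $ k = 0" for i k
    by (subst (asm) sum_nonneg_eq_0_iff) auto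
  then show ?thesis by (simp add: vec_eq_iff)
qed

text \<open>With \<open>G\<close> a generalised inverse of A^2, \<open>P = A ** G ** A\<close> turns
  out to be the orthogonal projection onto the range of \<open>A\<close>, and
  \<open>X = A ** G ** P\<close> satisfies A X = X A = P, from which all four equations are read
  off.\<close>

lemma is_moore_penrose_exists:
  fixes A :: "real ^ 'n ^ 'n"
  assumes A: "transpose A = A"
  obtains X where "is_moore_penrose A X"
proof -
  obtain G where G: "(A ** A) ** G ** (A ** A) = A ** A"
    using matrix_ginverse_exists by blast
  \<comment> \<open>The difference of the two sides is annihilated by A from the right, and its
    transpose begins with a factor A.\<close>
  have 1: "A ** A ** G ** A = A"
  proof -
    define E where "E = A ** A ** G ** A - A"
    have EA: "E ** A = 0"
      using G by (simp add: E_def matrix_diff_distribs matrix_mul_assoc)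
    have "transpose E = A ** (transpose G ** A ** A - mat 1)"
      by (simp add: E_def transpose_minus matrix_transpose_mul A matrix_diff_distribs matrix_mul_assoc)
    then have "E ** transpose E = 0"
      by (simp add: matrix_mul_assoc EA)
    then have "E = 0" by (rule matrix_mul_transpose_eq_0)
    then show ?thesis by (simp add: E_def)
  qed
  have 2: "A ** G ** A ** A = A"
  proof -
    define E where "E = transpose (A ** G ** A ** A - A)"
    have AE: "A ** (A ** G ** A ** A - A) = 0"
      using G by (simp add: matrix_diff_distribs matrix_mul_assoc)
    then have EA: "E ** A = 0"
      unfolding E_def by (metis A matrix_transpose_mul transpose_zero)
    have "transpose E = A ** (G ** A ** A - mat 1)"
      by (simp add: E_def matrix_diff_distribs matrix_mul_assoc)
    then have "E ** transpose E = 0"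
      by (simp add: matrix_mul_assoc EA)
    then have "E = 0" by (rule matrix_mul_transpose_eq_0)
    then show ?thesis by (metis E_def transpose_transpose transpose_zero right_minus_eq)
  qed
  define P where "P = A ** G ** A"
  have PA: "P ** A = A" and AP: "A ** P = A"
    using 1 2 by (simp_all add: P_def matrix_mul_assoc)
  \<comment> \<open>Transposing P A = A gives A P^T = A, so P P^T = A G (A P^T) = P, and the left
    side is symmetric.\<close>
  have PT: "transpose P = P"
  proof -
    have "A ** transpose P = A"
      by (metis A PA matrix_transpose_mul)
    then have "P ** transpose P = P"
      by (metis P_def matrix_mul_assoc)
    then show ?thesis
      by (metis matrix_transpose_mul transpose_transpose)
  qed
  have PP: "P ** P = P"
    by (metis PA P_def matrix_mul_assoc)
  define X where "X = A ** G ** P"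
  have AX: "A ** X = P"
    using 1 by (simp add: X_def P_def matrix_mul_assoc)
  have XA: "X ** A = P"
    using PA by (metis P_def X_def matrix_mul_assoc)
  have PX: "P ** X = X"
    by (metis PA X_def matrix_mul_assoc)
  have "is_moore_penrose A X"
    unfolding is_moore_penrose_def using AX XA PX PA PT by simp
  then show ?thesis ..
qed

lemma is_moore_penrose_unique:
  assumes X: "is_moore_penrose A X" and Y: "is_moore_penrose A Y"
  shows "X = Y"
proof -
  have AXAY: "A ** X = A ** Y"
  proof -
    have "A ** X = transpose (A ** X)" using X by (simp add: is_moore_penrose_def)
    also have "\<dots> = transpose (A ** Y ** A ** X)" using Y by (simp add: is_moore_penrose_def)
    also have "\<dots> = transpose (A ** X) ** transpose (A ** Y)"
      by (metis matrix_transpose_mul matrix_mul_assoc)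
    also have "\<dots> = A ** X ** A ** Y" using X Y by (simp add: is_moore_penrose_def matrix_mul_assoc)
    also have "\<dots> = A ** Y" using X by (simp add: is_moore_penrose_def)
    finally show ?thesis .
  qed
  have XAYA: "X ** A = Y ** A"
  proof -
    have "X ** A = transpose (X ** A)" using X by (simp add: is_moore_penrose_def)
    also have "\<dots> = transpose (X ** (A ** Y ** A))" using Y by (simp add: is_moore_penrose_def)
    also have "\<dots> = transpose (Y ** A) ** transpose (X ** A)"
      by (metis matrix_transpose_mul matrix_mul_assoc)
    also have "\<dots> = Y ** A ** (X ** A)" using X Y by (simp add: is_moore_penrose_def)
    also have "\<dots> = Y ** (A ** X ** A)" by (simp add: matrix_mul_assoc)
    also have "\<dots> = Y ** A" using X by (simp add: is_moore_penrose_def)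
    finally show ?thesis .
  qed
  have "X = X ** A ** X" using X by (simp add: is_moore_penrose_def)
  also have "\<dots> = Y ** A ** Y" by (metis AXAY XAYA matrix_mul_assoc)
  also have "\<dots> = Y" using Y by (simp add: is_moore_penrose_def)
  finally show ?thesis .
qed

lemma is_moore_penrose_pinv:
  fixes A :: "real ^ 'n ^ 'n"
  assumes A: "transpose A = A"
  shows "is_moore_penrose A (pinv A)"
  unfolding pinv_def
  by (metis is_moore_penrose_exists[OF A] is_moore_penrose_unique theI')

text \<open>For symmetric \<open>A\<close> the transpose of \<open>pinv A\<close> solves the same
  four equations, so uniqueness applies.\<close>

lemma pinv_symmetric:
  fixes A :: "real ^ 'n ^ 'n"
  assumes A: "transpose A = A"
  shows "transpose (pinv A) = pinv A"
proof (rule is_moore_penrose_unique[of A])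
  note MP = is_moore_penrose_pinv[OF A, unfolded is_moore_penrose_def]
  have tr: "transpose B ** A = transpose (A ** B)" "A ** transpose B = transpose (B ** A)" for B :: "real ^ 'n ^ 'n"
    by (simp_all add: matrix_transpose_mul A)
  show "is_moore_penrose A (transpose (pinv A))"
    unfolding is_moore_penrose_def tr
    using MP A by (metis matrix_transpose_mul matrix_mul_assoc)
qed (rule is_moore_penrose_pinv[OF A])

lemma pinv_commute:
  fixes A :: "real ^ 'n ^ 'n"
  assumes A: "transpose A = A"
  shows "A ** pinv A = pinv A ** A"
  using is_moore_penrose_pinv[OF A] pinv_symmetric[OF A]
  by (metis A is_moore_penrose_def matrix_transpose_mul)

section \<open>The quadratic form of (H D H^T)^+ and its dependence on the weights D\<close>

lemma diag_mat_mult_vec: "diag_mat d *v x = (\<chi> i. d i * x $ i)"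
  by (simp add: diag_mat_def matrix_vector_mult_def vec_eq_iff if_distrib[of "\<lambda>y. y * _"] cong: if_cong)

lemma transpose_diag_mat: "transpose (diag_mat d) = diag_mat d"
  by (auto simp: diag_mat_def transpose_def vec_eq_iff)

lemma transpose_sandwich:
  "transpose (H ** diag_mat d ** transpose H) = H ** diag_mat d ** transpose (H :: real ^ 'k ^ 'r)"
  by (simp add: matrix_transpose_mul transpose_diag_mat matrix_mul_assoc)

definition pinv_quad :: "real ^ 'k ^ 'r \<Rightarrow> ('k \<Rightarrow> real) \<Rightarrow> real ^ 'r \<Rightarrow> real" where
  "pinv_quad H d y = y \<bullet> (pinv (H ** diag_mat d ** transpose H) *v y)"

text \<open>The vector H^T A^+ y for A = H D H^T, which has one coordinate for each group. In these
  coordinates the form is diagonal with weights \<open>d\<close>, and forms with different weights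
  can be compared term by term.\<close>

definition pinv_coord :: "real ^ 'k ^ 'r \<Rightarrow> ('k \<Rightarrow> real) \<Rightarrow> real ^ 'r \<Rightarrow> 'k \<Rightarrow> real" where
  "pinv_coord H d y i = (transpose H *v (pinv (H ** diag_mat d ** transpose H) *v y)) $ i"

lemma inner_sandwich:
  "y \<bullet> ((H ** diag_mat d ** transpose H) *v y') =
   (\<Sum>i\<in>UNIV. d i * (transpose H *v y) $ i * (transpose H *v y') $ i)"
  for H :: "real ^ 'k ^ 'r"
proof -
  have "y \<bullet> ((H ** diag_mat d ** transpose H) *v y') = (transpose H *v y) \<bullet> (diag_mat d *v (transpose H *v y'))"
    by (simp add: matrix_vector_mul_assoc[symmetric] dot_lmul_matrix)
  then show ?thesis
    by (simp add: diag_mat_mult_vec inner_vec_def mult_ac)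
qed

lemma inner_symmetric_matrix:
  fixes A :: "real ^ 'n ^ 'n"
  assumes "transpose A = A"
  shows "x \<bullet> (A *v y) = (A *v x) \<bullet> y"
  using assms dot_lmul_matrix[of x A y] transpose_matrix_vector[of A x] by simp

text \<open>A^+ = A^+ A A^+ turns the form into that of A at A^+ y, and A = H D H^T is diagonal
  after H^T has been applied.\<close>

lemma pinv_quad_eq_sum:
  fixes H :: "real ^ 'k ^ 'r"
  shows "pinv_quad H d y = (\<Sum>i\<in>UNIV. d i * (pinv_coord H d y i)\<^sup>2)"
proof -
  define A where "A = H ** diag_mat d ** transpose H"
  have A: "transpose A = A" unfolding A_def by (rule transpose_sandwich)
  have "pinv A *v y = pinv A *v (A *v (pinv A *v y))"
    using is_moore_penrose_pinv[OF A] by (simp add: is_moore_penrose_def matrix_vector_mul_assoc matrix_mul_assoc)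
  then have "y \<bullet> (pinv A *v y) = (pinv A *v y) \<bullet> (A *v (pinv A *v y))"
    using inner_symmetric_matrix[OF pinv_symmetric[OF A]] by metis
  then show ?thesis
    unfolding pinv_quad_def A_def[symmetric] unfolding A_def inner_sandwich
    by (simp add: pinv_coord_def power2_eq_square mult_ac del: transpose_matrix_vector)
qed

lemma pinv_quad_eq_inner:
  fixes H :: "real ^ 'k ^ 'r"
  shows "pinv_quad H d (H *v x) = (\<Sum>i\<in>UNIV. x $ i * pinv_coord H d (H *v x) i)"
proof -
  define w where "w = pinv (H ** diag_mat d ** transpose H) *v (H *v x)"
  have "(H *v x) \<bullet> w = x \<bullet> (transpose H *v w)"
    using dot_lmul_matrix[of w H x] by (simp add: inner_commute)
  then show ?thesis
    by (simp add: pinv_quad_def pinv_coord_def w_def inner_vec_def del: transpose_matrix_vector)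
qed

lemma pinv_quad_nonneg:
  fixes H :: "real ^ 'k ^ 'r"
  assumes "\<And>i. 0 \<le> d i"
  shows "0 \<le> pinv_quad H d y"
  by (simp add: pinv_quad_eq_sum sum_nonneg assms)

text \<open>Let Q be the form, u the coordinates \<open>pinv_coord\<close> and R the right side.
  Then Q is both the sum of x_i u_i and the sum of d_i u_i^2, so Young's inequality x_i u_i \<le>
  (x_i^2 / d_i + d_i u_i^2) / 2 gives Q \<le> R / 2 + Q / 2. Weights may vanish, as sample variances
  may; the term is then read as 0 / 0 = 0.\<close>

lemma pinv_quad_le:
  fixes H :: "real ^ 'k ^ 'r"
  assumes d: "\<And>i. 0 \<le> d i" and x: "\<And>i. d i = 0 \<Longrightarrow> x $ i = 0"
  shows "pinv_quad H d (H *v x) \<le> (\<Sum>i\<in>UNIV. (x $ i)\<^sup>2 / d i)"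
proof -
  define u where "u = pinv_coord H d (H *v x)"
  have "x $ i * u i \<le> ((x $ i)\<^sup>2 / d i + d i * (u i)\<^sup>2) / 2" for i
  proof (cases "d i = 0")
    case False
    then have "0 < d i" using d[of i] by simp
    have "0 \<le> (x $ i - d i * u i)\<^sup>2 / d i" using \<open>0 < d i\<close> by simp
    also have "\<dots> = (x $ i)\<^sup>2 / d i - 2 * (x $ i * u i) + d i * (u i)\<^sup>2"
      using \<open>0 < d i\<close> by (simp add: field_simps power2_eq_square)
    finally show ?thesis by simp
  qed (simp add: x)
  then have "(\<Sum>i\<in>UNIV. x $ i * u i) \<le> (\<Sum>i\<in>UNIV. ((x $ i)\<^sup>2 / d i + d i * (u i)\<^sup>2) / 2)"
    by (intro sum_mono) auto
  also have "\<dots> = (\<Sum>i\<in>UNIV. (x $ i)\<^sup>2 / d i) / 2 + (\<Sum>i\<in>UNIV. d i * (u i)\<^sup>2) / 2"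
    by (simp add: sum.distrib add_divide_distrib sum_divide_distrib)
  finally have "pinv_quad H d (H *v x) \<le> (\<Sum>i\<in>UNIV. (x $ i)\<^sup>2 / d i) / 2 + pinv_quad H d (H *v x) / 2"
    using pinv_quad_eq_inner[of H d x] pinv_quad_eq_sum[of H d "H *v x"] by (simp add: u_def)
  then show ?thesis by simp
qed

text \<open>\<open>A ** pinv A\<close> projects onto the range of \<open>A\<close>, which is the
  range of \<open>H\<close> because the weights are positive: with s = D^(1/2) the matrix E = (A A^+
  - 1) H s satisfies E E^T = (A A^+ A - A) (A A^+ - 1)^T = 0, and s can be cancelled.\<close>

lemma pinv_sandwich_absorb:
  fixes H :: "real ^ 'k ^ 'r"
  assumes d: "\<And>i. 0 < d i"
  defines "A \<equiv> H ** diag_mat d ** transpose H"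
  shows "A ** pinv A ** H = H"
proof -
  have A: "transpose A = A" unfolding A_def by (rule transpose_sandwich)
  note MP = is_moore_penrose_pinv[OF A, unfolded is_moore_penrose_def]
  define s where "s = diag_mat (\<lambda>i::'k. sqrt (d i))"
  define E where "E = (A ** pinv A ** H - H) ** s"
  have ss: "s ** transpose s = diag_mat d"
    using d by (auto simp: s_def diag_mat_def vec_eq_iff matrix_matrix_mult_def transpose_def
        if_distrib[of "\<lambda>y. y * _"] less_imp_le cong: if_cong)
  have AA: "A ** pinv A ** A - A = 0" using MP by simp
  have "E ** transpose E = (A ** pinv A ** H - H) ** (s ** transpose s) ** transpose (A ** pinv A ** H - H)"
    by (simp add: E_def matrix_transpose_mul matrix_mul_assoc)
  also have "transpose (A ** pinv A ** H - H) = transpose H ** transpose (A ** pinv A - mat 1)"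
    by (metis matrix_diff_distribs(1) matrix_mul_lid matrix_transpose_mul)
  also have "(A ** pinv A ** H - H) ** (s ** transpose s) ** (transpose H ** transpose (A ** pinv A - mat 1)) =
     (A ** pinv A ** A - A) ** transpose (A ** pinv A - mat 1)"
    by (simp add: ss matrix_diff_distribs A_def matrix_mul_assoc)
  also have "\<dots> = 0" by (simp add: AA)
  finally have "E = 0" by (rule matrix_mul_transpose_eq_0)
  then have "((A ** pinv A ** H - H) $ i $ j) * sqrt (d j) = 0" for i j
    unfolding E_def
    by (auto simp: s_def diag_mat_def vec_eq_iff matrix_matrix_mult_def
        if_distrib[of "\<lambda>y. _ * y"] cong: if_cong)
  then have "(A ** pinv A ** H - H) $ i $ j = 0" for i j
    using d[of j] by (metis mult_eq_0_iff real_sqrt_gt_zero less_irrefl)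
  then show ?thesis by (simp add: vec_eq_iff)
qed

text \<open>An analogue of the resolvent identity. For b = H x both A A^+ b = b and A' A'^+ b = b
  hold, so the difference of the forms is the inner product of A'^+ b with (A - A') A^+ b, and A -
  A' is again H times a diagonal matrix times H^T.\<close>

lemma pinv_quad_diff:
  fixes H :: "real ^ 'k ^ 'r"
  assumes d: "\<And>i. 0 < d i" and d': "\<And>i. 0 < d' i"
  shows "pinv_quad H d' (H *v x) - pinv_quad H d (H *v x) =
     (\<Sum>i\<in>UNIV. (d i - d' i) * pinv_coord H d' (H *v x) i * pinv_coord H d (H *v x) i)"
proof -
  define A where "A = H ** diag_mat d ** transpose H"
  define A' where "A' = H ** diag_mat d' ** transpose H"
  have A: "transpose A = A" and A': "transpose A' = A'"
    unfolding A_def A'_def by (rule transpose_sandwich)+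
  define b where "b = H *v x"
  have 1: "A *v (pinv A *v b) = b"
    using pinv_sandwich_absorb[of d H] d by (simp add: A_def b_def matrix_vector_mul_assoc matrix_mul_assoc)
  have 2: "A' *v (pinv A' *v b) = b"
    using pinv_sandwich_absorb[of d' H] d' by (simp add: A'_def b_def matrix_vector_mul_assoc matrix_mul_assoc)
  have "b \<bullet> (pinv A' *v b) = (pinv A' *v b) \<bullet> (A *v (pinv A *v b))"
    by (simp add: 1 inner_commute)
  moreover have "b \<bullet> (pinv A *v b) = (pinv A' *v b) \<bullet> (A' *v (pinv A *v b))"
    using inner_symmetric_matrix[OF A', of "pinv A' *v b" "pinv A *v b"] by (simp add: 2)
  ultimately show ?thesis
    unfolding pinv_quad_def pinv_coord_def A_def[symmetric] A'_def[symmetric] b_def[symmetric]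
    unfolding A_def A'_def inner_sandwich
    by (simp add: sum_subtractf[symmetric] algebra_simps del: transpose_matrix_vector)
qed

text \<open>\<open>pinv_quad_diff\<close> bounds the change by the sum of \<delta> d_i |u'_i u_i|,
  and \<delta> \<le> 1/2 keeps d_i \<le> 2 d'_i, so that everything can be expressed by the weights
  \<open>d\<close>.\<close>

lemma pinv_quad_perturb:
  fixes H :: "real ^ 'k ^ 'r"
  assumes d: "\<And>i. 0 < d i" and \<delta>: "\<delta> \<le> 1/2" and d': "\<And>i. \<bar>d' i - d i\<bar> \<le> \<delta> * d i"
  shows "\<bar>pinv_quad H d' (H *v x) - pinv_quad H d (H *v x)\<bar> \<le> 3 * \<delta> * (\<Sum>i\<in>UNIV. (x $ i)\<^sup>2 / d i)"
proof -
  define u where "u = pinv_coord H d (H *v x)"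
  define u' where "u' = pinv_coord H d' (H *v x)"
  define R where "R = (\<Sum>i\<in>UNIV. (x $ i)\<^sup>2 / d i)"
  have half: "d i \<le> 2 * d' i" for i
  proof -
    have "\<delta> * d i \<le> 1/2 * d i" using \<delta> d[of i] by (intro mult_right_mono) auto
    then show ?thesis using d'[of i] by linarith
  qed
  have pos': "0 < d' i" for i using half[of i] d[of i] by linarith
  have "0 \<le> \<delta> * d i" for i using d'[of i] by linarith
  \<comment> \<open>Any index will do; index types are not empty.\<close>
  then have \<delta>0: "0 \<le> \<delta>" using d[of undefined] by (metis zero_le_mult_iff not_le)
  have "\<bar>pinv_quad H d' (H *v x) - pinv_quad H d (H *v x)\<bar> \<le> (\<Sum>i\<in>UNIV. \<bar>(d i - d' i) * u' i * u i\<bar>)"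
    unfolding pinv_quad_diff[of d d' H x, OF d pos'] u_def u'_def by (rule sum_abs)
  \<comment> \<open>The factor 2 of \<open>half\<close> is spent on the u' term only; the summands
    then add up to the form with weights d' and half the form with weights d.\<close>
  also have "\<dots> \<le> (\<Sum>i\<in>UNIV. \<delta> * (d' i * (u' i)\<^sup>2 + d i * (u i)\<^sup>2 / 2))"
  proof (rule sum_mono)
    fix i
    have "\<bar>(d i - d' i) * u' i * u i\<bar> \<le> (\<delta> * d i) * (\<bar>u' i\<bar> * \<bar>u i\<bar>)"
      using mult_right_mono[OF d'[of i], of "\<bar>u' i\<bar> * \<bar>u i\<bar>"]
      by (simp add: abs_mult mult.assoc abs_minus_commute)
    also have "\<bar>u' i\<bar> * \<bar>u i\<bar> \<le> ((u' i)\<^sup>2 + (u i)\<^sup>2) / 2"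
      using sum_squares_bound[of "\<bar>u' i\<bar>" "\<bar>u i\<bar>"] by simp
    finally have "\<bar>(d i - d' i) * u' i * u i\<bar> \<le> \<delta> * (d i * (((u' i)\<^sup>2 + (u i)\<^sup>2) / 2))"
      using \<delta>0 d[of i] by (simp add: mult_left_mono mult.assoc)
    also have "d i * (((u' i)\<^sup>2 + (u i)\<^sup>2) / 2) \<le> d' i * (u' i)\<^sup>2 + d i * (u i)\<^sup>2 / 2"
      using mult_right_mono[OF half[of i], of "(u' i)\<^sup>2"] by (simp add: field_simps)
    finally show "\<bar>(d i - d' i) * u' i * u i\<bar> \<le> \<delta> * (d' i * (u' i)\<^sup>2 + d i * (u i)\<^sup>2 / 2)"
      using \<delta>0 by (simp add: mult_left_mono)
  qed
  also have "\<dots> = \<delta> * (pinv_quad H d' (H *v x) + pinv_quad H d (H *v x) / 2)"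
    by (simp add: pinv_quad_eq_sum u_def u'_def sum_distrib_left[symmetric] sum.distrib sum_divide_distrib)
  \<comment> \<open>\<open>pinv_quad_le\<close> with the respective weights bounds the forms by 2 R
    and R; the resulting 5/2 is rounded up to 3.\<close>
  also have "\<dots> \<le> \<delta> * (2 * R + R / 2)"
  proof (intro mult_left_mono add_mono divide_right_mono)
    show "pinv_quad H d (H *v x) \<le> R"
      unfolding R_def using d by (intro pinv_quad_le) (auto simp: less_le)
    have "pinv_quad H d' (H *v x) \<le> (\<Sum>i\<in>UNIV. (x $ i)\<^sup>2 / d' i)"
      using pos' by (intro pinv_quad_le) (auto simp: less_le)
    also have "\<dots> \<le> (\<Sum>i\<in>UNIV. 2 * ((x $ i)\<^sup>2 / d i))"
    proof (rule sum_mono)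
      fix i
      have "(x $ i)\<^sup>2 * d i \<le> (x $ i)\<^sup>2 * (2 * d' i)" by (intro mult_left_mono half) auto
      then show "(x $ i)\<^sup>2 / d' i \<le> 2 * ((x $ i)\<^sup>2 / d i)"
        using d[of i] pos'[of i] by (simp add: field_simps)
    qed
    finally show "pinv_quad H d' (H *v x) \<le> 2 * R" by (simp add: R_def sum_distrib_left)
  qed (use \<delta>0 in auto)
  also have "\<dots> \<le> 3 * \<delta> * R"
    using \<delta>0 d by (simp add: R_def sum_nonneg less_imp_le mult_left_mono)
  finally show ?thesis by (simp add: R_def)
qed

text \<open>Tikhonov regularisation: for symmetric \<open>A\<close> the vector \<open>pinv A *v b\<close> is the limit of the
  solutions of \<open>(A\<^sup>2 + \<epsilon>) x = A b\<close>, to which Cramer's rule gives an explicit formula.\<close>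

definition tikhonov :: "real \<Rightarrow> real ^ 'n ^ 'n \<Rightarrow> real ^ 'n ^ 'n" where
  "tikhonov e A = A ** A + mat e"

lemma tikhonov_mult_vec: "tikhonov e A *v x = A *v (A *v x) + e *\<^sub>R x"
proof -
  have "mat e *v x = e *\<^sub>R x"
    by (simp add: vec_eq_iff mat_def matrix_vector_mult_def if_distrib[of "\<lambda>y. y * _"] cong: if_cong)
  then show ?thesis
    by (simp add: tikhonov_def matrix_vector_mult_add_rdistrib matrix_vector_mul_assoc)
qed

lemma norm_tikhonov_ge:
  fixes A :: "real ^ 'n ^ 'n"
  assumes "transpose A = A" "0 \<le> e"
  shows "e * norm x \<le> norm (tikhonov e A *v x)"
proof (cases "x = 0")
  case False
  have "e * norm x * norm x \<le> x \<bullet> (tikhonov e A *v x)"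
    using inner_symmetric_matrix[OF assms(1), of x "A *v x"]
    by (simp add: tikhonov_mult_vec inner_add_right power2_norm_eq_inner[symmetric] power2_eq_square)
  also have "\<dots> \<le> norm (tikhonov e A *v x) * norm x"
    by (metis norm_cauchy_schwarz mult.commute)
  finally show ?thesis using False by simp
qed simp

lemma det_tikhonov:
  fixes A :: "real ^ 'n ^ 'n"
  assumes "transpose A = A" "0 < e"
  shows "det (tikhonov e A) \<noteq> 0"
proof -
  have "x = 0" if "tikhonov e A *v x = 0" for x
    using norm_tikhonov_ge[OF assms(1), of e x] that assms(2) by (simp add: mult_le_0_iff)
  then show ?thesis
    by (metis invertible_det_nz invertible_left_inverse matrix_left_invertible_ker)
qed

definition tikhonov_solution :: "real \<Rightarrow> real ^ 'n ^ 'n \<Rightarrow> real ^ 'n \<Rightarrow> real ^ 'n" where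
  "tikhonov_solution e A b =
     (\<chi> k. det (\<chi> i j. if j = k then (A *v b) $ i else tikhonov e A $ i $ j) / det (tikhonov e A))"

text \<open>The first order term of the error is explicit: w = A^+ A^+ A^+ b solves A^2 w = A^+ b,
  so r - e w is mapped to - e^2 w. The lower bound of \<open>norm_tikhonov_ge\<close> loses one
  factor e, which leaves an error of order e.\<close>

lemma tikhonov_solution_error:
  fixes A :: "real ^ 'n ^ 'n"
  assumes A: "transpose A = A" and e: "0 < e"
  shows "norm (tikhonov_solution e A b - pinv A *v b) \<le> 2 * e * norm (pinv A *v (pinv A *v (pinv A *v b)))"
proof -
  define x where "x = pinv A *v b"
  define w where "w = pinv A *v (pinv A *v x)"
  define r where "r = x - tikhonov_solution e A b"
  note MP = is_moore_penrose_pinv[OF A, unfolded is_moore_penrose_def]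
  note C = pinv_commute[OF A]
  have sol: "tikhonov e A *v tikhonov_solution e A b = A *v b"
    using cramer[OF det_tikhonov[OF A e], of "tikhonov_solution e A b" "A *v b"]
    by (simp add: tikhonov_solution_def)
  have "A ** A ** pinv A = A"
    using MP C by (metis matrix_mul_assoc)
  then have AAx: "A *v (A *v x) = A *v b"
    by (simp add: x_def matrix_vector_mul_assoc matrix_mul_assoc)
  have "A ** A ** pinv A ** pinv A ** pinv A = pinv A"
    using MP C by (metis matrix_mul_assoc)
  then have AAw: "A *v (A *v w) = x"
    by (simp add: x_def w_def matrix_vector_mul_assoc matrix_mul_assoc)
  have "tikhonov e A *v r = e *\<^sub>R x"
    unfolding r_def matrix_vector_mult_diff_distrib sol by (simp add: tikhonov_mult_vec AAx)
  then have "tikhonov e A *v (r - e *\<^sub>R w) = - (e\<^sup>2 *\<^sub>R w)"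
    by (simp add: matrix_vector_mult_diff_distrib tikhonov_mult_vec[of e A w] matrix_vector_mult_scaleR AAw power2_eq_square scaleR_add_right)
  then have "e * norm (r - e *\<^sub>R w) \<le> e * (e * norm w)"
    using norm_tikhonov_ge[OF A, of e "r - e *\<^sub>R w"] e by (simp add: power2_eq_square)
  then have "norm (r - e *\<^sub>R w) \<le> e * norm w" using e by simp
  then have "norm r \<le> 2 * e * norm w"
    using norm_triangle_sub[of r "e *\<^sub>R w"] e by simp
  then show ?thesis
    unfolding r_def w_def x_def by (simp add: norm_minus_commute)
qed

lemma tikhonov_solution_tendsto:
  fixes A :: "real ^ 'n ^ 'n"
  assumes A: "transpose A = A"
  shows "(\<lambda>n. tikhonov_solution (1 / real (Suc n)) A b) \<longlonglongrightarrow> pinv A *v b"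
proof (rule Lim_null[THEN iffD2], rule Lim_null_comparison)
  show "\<forall>\<^sub>F n in sequentially. norm (tikhonov_solution (1 / real (Suc n)) A b - pinv A *v b)
          \<le> 2 * (1 / real (Suc n)) * norm (pinv A *v (pinv A *v (pinv A *v b)))"
    by (intro always_eventually allI tikhonov_solution_error[OF A]) simp
  show "(\<lambda>n. 2 * (1 / real (Suc n)) * norm (pinv A *v (pinv A *v (pinv A *v b)))) \<longlonglongrightarrow> 0"
    by (intro tendsto_mult_left_zero tendsto_mult_right_zero LIMSEQ_Suc lim_1_over_n)
qed

section \<open>Measurability of the quadratic form\<close>

lemma borel_measurable_vecI:
  fixes f :: "'a \<Rightarrow> real ^ 'n"
  assumes "\<And>i. (\<lambda>x. f x $ i) \<in> borel_measurable M"
  shows "f \<in> borel_measurable M"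
  unfolding borel_measurable_euclidean_space[of f]
  using assms by (auto simp: Basis_vec_def cart_eq_inner_axis[symmetric])

lemma borel_measurable_vec_nth:
  "(\<lambda>x. x $ i) \<in> borel_measurable (borel :: (real ^ 'n) measure)"
  by (intro borel_measurable_continuous_onI continuous_intros)

text \<open>The pseudoinverse is discontinuous where the rank changes. For fixed e > 0, however, the
  regularised solution is a quotient of determinants in the entries of \<open>A x\<close> and
  \<open>b x\<close>, hence measurable, and measurability passes to the pointwise limit.\<close>

lemma borel_measurable_pinv_mult:
  fixes A :: "'a \<Rightarrow> real ^ 'n ^ 'n" and b :: "'a \<Rightarrow> real ^ 'n"
  assumes sym: "\<And>x. transpose (A x) = A x"
    and [measurable]: "\<And>i j. (\<lambda>x. A x $ i $ j) \<in> borel_measurable M" "\<And>i. (\<lambda>x. b x $ i) \<in> borel_measurable M"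
  shows "(\<lambda>x. (pinv (A x) *v b x) $ i) \<in> borel_measurable M"
proof (rule borel_measurable_LIMSEQ_real)
  show "(\<lambda>n. tikhonov_solution (1 / real (Suc n)) (A x) (b x) $ i) \<longlonglongrightarrow> (pinv (A x) *v b x) $ i" for x
    by (intro tendsto_vec_nth tikhonov_solution_tendsto sym)
  fix n
  define e where "e = 1 / real (Suc n)"
  have [measurable]: "(\<lambda>x. tikhonov e (A x) $ i $ j) \<in> borel_measurable M" for i j
    by (simp add: tikhonov_def matrix_matrix_mult_def mat_def)
  have det: "(\<lambda>x. det (B x)) \<in> borel_measurable M"
    if "\<And>i j. (\<lambda>x. B x $ i $ j) \<in> borel_measurable M" for B :: "'a \<Rightarrow> real ^ 'n ^ 'n"
    using that unfolding det_def by measurable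
  have "(\<lambda>x. det (\<chi> i' j. if j = i then (A x *v b x) $ i' else tikhonov e (A x) $ i' $ j)) \<in> borel_measurable M"
  proof (rule det)
    fix i' j
    show "(\<lambda>x. (\<chi> i' j. if j = i then (A x *v b x) $ i' else tikhonov e (A x) $ i' $ j) $ i' $ j) \<in> borel_measurable M"
      by (cases "j = i") (simp_all add: matrix_vector_mult_def)
  qed
  then show "(\<lambda>x. tikhonov_solution (1 / real (Suc n)) (A x) (b x) $ i) \<in> borel_measurable M"
    unfolding e_def[symmetric] by (simp add: tikhonov_solution_def borel_measurable_divide det)
qed

lemma borel_measurable_pinv_quad:
  fixes H :: "real ^ 'k ^ 'r"
  assumes [measurable]: "\<And>i. (\<lambda>x. d x i) \<in> borel_measurable M" "\<And>i. (\<lambda>x. y x $ i) \<in> borel_measurable M"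
  shows "(\<lambda>x. pinv_quad H (d x) (y x)) \<in> borel_measurable M"
proof -
  have [measurable]: "(\<lambda>x. (H ** diag_mat (d x) ** transpose H) $ i $ j) \<in> borel_measurable M" for i j
    by (simp add: matrix_matrix_mult_def diag_mat_def if_distrib[of "\<lambda>y. _ * y"] cong: if_cong)
  have [measurable]: "(\<lambda>x. (pinv (H ** diag_mat (d x) ** transpose H) *v y x) $ i) \<in> borel_measurable M" for i
    by (rule borel_measurable_pinv_mult) (simp_all add: transpose_sandwich)
  show ?thesis
    unfolding pinv_quad_def inner_vec_def by simp
qed

subsection \<open>Centered normal variables\<close>

lemma prob_space_std_normal: "prob_space std_normal_distribution"
  using real_dist_normal_dist by (simp add: real_distribution_def)

text \<open>Writing the law as that of a scaled standard normal variable treats v = 0 along with v >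
  0, so characteristic functions and moments follow without a case distinction.\<close>

lemma centered_normal_eq_distr:
  assumes "0 \<le> v"
  shows "centered_normal v = distr std_normal_distribution borel (\<lambda>x. sqrt v * x)"
proof (cases "v = 0")
  case True
  then show ?thesis
    using prob_space.distr_const[OF prob_space_std_normal, of "0::real" borel]
    by (simp only: centered_normal_def if_True real_sqrt_zero mult_zero_left) simp
next
  case False
  then have v: "0 < v" using assms by simp
  interpret prob_space std_normal_distribution by (rule prob_space_std_normal)
  have "distributed std_normal_distribution lborel (\<lambda>x. x) std_normal_density"
    by (simp add: distributed_def distr_id2)
  from normal_density_affine[OF this, of "sqrt v" 0] v
  have "distributed std_normal_distribution lborel (\<lambda>x. sqrt v * x) (normal_density 0 (sqrt v))"
    by simp
  then have "distr std_normal_distribution lborel (\<lambda>x. sqrt v * x) = density lborel (normal_density 0 (sqrt v))"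
    by (simp add: distributed_def)
  moreover have "distr std_normal_distribution lborel (\<lambda>x. sqrt v * x) = distr std_normal_distribution borel (\<lambda>x. sqrt v * x)"
    by (rule distr_cong) auto
  ultimately show ?thesis using v by (simp add: centered_normal_def)
qed

lemma integral_iexp_centered_normal:
  fixes X :: "'b \<Rightarrow> real"
  assumes "0 \<le> v" and [measurable]: "X \<in> borel_measurable N" and D: "distr N borel X = centered_normal v"
  shows "(\<integral>\<omega>. iexp (X \<omega>) \<partial>N) = complex_of_real (exp (- v / 2))"
proof -
  have "(\<integral>\<omega>. iexp (X \<omega>) \<partial>N) = (\<integral>x. iexp x \<partial>distr N borel X)"
    by (subst integral_distr) auto
  also have "\<dots> = (\<integral>x. iexp (sqrt v * x) \<partial>std_normal_distribution)"
    unfolding D centered_normal_eq_distr[OF assms(1)] by (subst integral_distr) auto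
  also have "\<dots> = char std_normal_distribution (sqrt v)"
    by (simp add: char_def)
  finally show ?thesis
    using assms(1) by (simp add: char_std_normal_distribution)
qed

lemma
  fixes X :: "'b \<Rightarrow> real"
  assumes v: "0 \<le> v" and [measurable]: "X \<in> borel_measurable N" and D: "distr N borel X = centered_normal v"
  shows centered_normal_integrable_power: "integrable N (\<lambda>\<omega>. X \<omega> ^ k)"
    and centered_normal_even_moment: "(\<integral>\<omega>. X \<omega> ^ (2 * k) \<partial>N) = v ^ k * (fact (2 * k) / (2 ^ k * fact k))"
    and centered_normal_mean: "(\<integral>\<omega>. X \<omega> \<partial>N) = 0"
proof -
  have "integrable (distr N borel X) (\<lambda>x. x ^ k)"
    unfolding D centered_normal_eq_distr[OF v]
    by (subst integrable_distr_eq) (auto simp: power_mult_distrib integrable_std_normal_distribution_moment)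
  then show "integrable N (\<lambda>\<omega>. X \<omega> ^ k)"
    by (subst (asm) integrable_distr_eq) auto
  have "(\<integral>\<omega>. X \<omega> ^ (2 * k) \<partial>N) = (\<integral>x. x ^ (2 * k) \<partial>distr N borel X)"
    by (subst integral_distr) auto
  also have "\<dots> = (\<integral>x. (sqrt v * x) ^ (2 * k) \<partial>std_normal_distribution)"
    unfolding D centered_normal_eq_distr[OF v] by (subst integral_distr) auto
  also have "\<dots> = sqrt v ^ (2 * k) * (fact (2 * k) / (2 ^ k * fact k))"
    unfolding power_mult_distrib integral_mult_right_zero std_normal_distribution_even_moments(1) ..
  finally show "(\<integral>\<omega>. X \<omega> ^ (2 * k) \<partial>N) = v ^ k * (fact (2 * k) / (2 ^ k * fact k))"
    using v by (simp add: power_mult)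
  have "(\<integral>\<omega>. X \<omega> \<partial>N) = (\<integral>x. x \<partial>distr N borel X)"
    by (subst integral_distr) auto
  also have "\<dots> = (\<integral>x. sqrt v * x \<partial>std_normal_distribution)"
    unfolding D centered_normal_eq_distr[OF v] by (subst integral_distr) auto
  also have "\<dots> = 0"
    using integral_std_normal_distribution_moment_odd[of 1] by simp
  finally show "(\<integral>\<omega>. X \<omega> \<partial>N) = 0" .
qed

text \<open>The factors 1, 3 and 105 are the standard normal moments (2k)! / (2^k k!) for k = 1, 2,
  4.\<close>

lemma centered_normal_moments:
  fixes X :: "'b \<Rightarrow> real"
  assumes "0 \<le> v" "X \<in> borel_measurable N" "distr N borel X = centered_normal v"
  shows "(\<integral>\<omega>. (X \<omega>)\<^sup>2 \<partial>N) = v" "(\<integral>\<omega>. X \<omega> ^ 4 \<partial>N) = 3 * v\<^sup>2" "(\<integral>\<omega>. X \<omega> ^ 8 \<partial>N) = 105 * v ^ 4"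
  using centered_normal_even_moment[OF assms, of 1] centered_normal_even_moment[OF assms, of 2]
    centered_normal_even_moment[OF assms, of 4]
  by (simp_all add: fact_numeral)

text \<open>The Gaussian linearisation \<open>exp (- l * x\<^sup>2) = E (exp (i * sqrt (2 * l) * x * \<xi>))\<close> with a
  standard normal \<open>\<xi>\<close> reduces the Laplace transform of a sum of squares to characteristic
  functions of linear combinations.\<close>

lemma integral_exp_neg_sum_squares:
  fixes X :: "'i \<Rightarrow> 'b \<Rightarrow> real" and V :: "('i \<Rightarrow> real) \<Rightarrow> real"
  assumes N: "prob_space N" and K: "finite K" and X: "\<And>k. k \<in> K \<Longrightarrow> X k \<in> borel_measurable N"
    and char: "\<And>c. (\<integral>\<omega>. iexp (\<Sum>k\<in>K. c k * X k \<omega>) \<partial>N) = complex_of_real (exp (- V c / 2))"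
    and l: "0 \<le> l"
  shows "(\<integral>\<omega>. exp (- l * (\<Sum>k\<in>K. (X k \<omega>)\<^sup>2)) \<partial>N) =
     (\<integral>\<xi>. exp (- V (\<lambda>k. sqrt (2 * l) * \<xi> k) / 2) \<partial>PiM K (\<lambda>_. std_normal_distribution))"
proof -
  note X[measurable]
  let ?\<nu> = "std_normal_distribution" and ?P = "PiM K (\<lambda>_. std_normal_distribution)"
  let ?s = "sqrt (2 * l)"
  interpret N: prob_space N by fact
  interpret \<nu>: prob_space ?\<nu> by (rule prob_space_std_normal)
  interpret Pfin: product_sigma_finite "\<lambda>_::'i. ?\<nu>" ..
  interpret PiP: prob_space ?P by (intro prob_space_PiM \<nu>.prob_space_axioms)
  interpret pair_prob_space N ?P ..
  have pr[measurable]: "(\<lambda>\<xi>. \<xi> k) \<in> borel_measurable ?P" if "k \<in> K" for k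
    using measurable_component_singleton[OF that, of "\<lambda>_. ?\<nu>"] by simp
  have 1: "complex_of_real (exp (- l * (\<Sum>k\<in>K. (X k \<omega>)\<^sup>2))) = (\<integral>\<xi>. iexp (\<Sum>k\<in>K. ?s * \<xi> k * X k \<omega>) \<partial>?P)" for \<omega>
  proof -
    have "(\<integral>\<xi>. iexp (\<Sum>k\<in>K. ?s * \<xi> k * X k \<omega>) \<partial>?P) = (\<integral>\<xi>. (\<Prod>k\<in>K. iexp (?s * X k \<omega> * \<xi> k)) \<partial>?P)"
      by (intro Bochner_Integration.integral_cong refl)
         (simp add: exp_sum[OF K, symmetric] sum_distrib_left mult_ac)
    also have "\<dots> = (\<Prod>k\<in>K. (\<integral>x. iexp (?s * X k \<omega> * x) \<partial>?\<nu>))"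
      by (rule Pfin.product_integral_prod[OF K]) (simp add: \<nu>.integrable_iexp)
    also have "\<dots> = (\<Prod>k\<in>K. complex_of_real (exp (- l * (X k \<omega>)\<^sup>2)))"
    proof (intro prod.cong refl)
      fix k
      have "(\<integral>x. iexp (?s * X k \<omega> * x) \<partial>?\<nu>) = char ?\<nu> (?s * X k \<omega>)" by (simp add: char_def)
      also have "\<dots> = complex_of_real (exp (- l * (X k \<omega>)\<^sup>2))"
        using l by (simp add: char_std_normal_distribution power_mult_distrib)
      finally show "(\<integral>x. iexp (?s * X k \<omega> * x) \<partial>?\<nu>) = complex_of_real (exp (- l * (X k \<omega>)\<^sup>2))" .
    qed
    also have "\<dots> = complex_of_real (exp (- l * (\<Sum>k\<in>K. (X k \<omega>)\<^sup>2)))"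
      by (simp add: exp_sum[OF K, symmetric] sum_distrib_left of_real_prod[symmetric] sum_negf)
    finally show ?thesis ..
  qed
  have meas: "(\<lambda>x. \<Sum>k\<in>K. ?s * snd x k * X k (fst x)) \<in> borel_measurable (N \<Otimes>\<^sub>M ?P)"
    by measurable
  have "complex_of_real (\<integral>\<omega>. exp (- l * (\<Sum>k\<in>K. (X k \<omega>)\<^sup>2)) \<partial>N) =
      (\<integral>\<omega>. (\<integral>\<xi>. iexp (\<Sum>k\<in>K. ?s * \<xi> k * X k \<omega>) \<partial>?P) \<partial>N)"
    by (simp only: 1[symmetric] integral_complex_of_real)
  also have "\<dots> = (\<integral>\<xi>. (\<integral>\<omega>. iexp (\<Sum>k\<in>K. ?s * \<xi> k * X k \<omega>) \<partial>N) \<partial>?P)"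
  proof (rule Fubini_integral[symmetric])
    show "integrable (N \<Otimes>\<^sub>M ?P) (\<lambda>(\<omega>, \<xi>). iexp (\<Sum>k\<in>K. ?s * \<xi> k * X k \<omega>))"
      unfolding case_prod_beta' by (rule integrable_iexp) (use meas in \<open>auto intro: borel_measurable_of_real\<close>)
  qed
  also have "\<dots> = (\<integral>\<xi>. complex_of_real (exp (- V (\<lambda>k. ?s * \<xi> k) / 2)) \<partial>?P)"
    by (simp only: char)
  also have "\<dots> = complex_of_real (\<integral>\<xi>. exp (- V (\<lambda>k. ?s * \<xi> k) / 2) \<partial>?P)"
    by (rule integral_complex_of_real)
  finally show ?thesis by (simp only: of_real_eq_iff)
qed

subsection \<open>Laws of large numbers\<close>

lemma (in prob_space) indep_vars_rv:
  "indep_vars M' X I \<Longrightarrow> i \<in> I \<Longrightarrow> random_variable (M' i) (X i)"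
  by (simp add: indep_vars_def)

lemma (in prob_space) expectation_abs_le_sqrt:
  fixes X :: "'a \<Rightarrow> real"
  assumes [measurable]: "X \<in> borel_measurable M" and X2: "integrable M (\<lambda>x. (X x)\<^sup>2)"
  shows "integrable M X" "expectation (\<lambda>x. \<bar>X x\<bar>) \<le> sqrt (expectation (\<lambda>x. (X x)\<^sup>2))"
proof -
  show int: "integrable M X" by (rule square_integrable_imp_integrable) (use X2 in auto)
  have "0 \<le> variance (\<lambda>x. \<bar>X x\<bar>)" by (rule variance_positive)
  also have "\<dots> = expectation (\<lambda>x. (X x)\<^sup>2) - (expectation (\<lambda>x. \<bar>X x\<bar>))\<^sup>2"
    using variance_eq[of "\<lambda>x. \<bar>X x\<bar>"] int X2 by simp
  finally show "expectation (\<lambda>x. \<bar>X x\<bar>) \<le> sqrt (expectation (\<lambda>x. (X x)\<^sup>2))"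
    by (intro real_le_rsqrt) simp
qed

lemma (in prob_space) expectation_sum_squared:
  fixes X :: "'i \<Rightarrow> 'a \<Rightarrow> real"
  assumes "finite J" "indep_vars (\<lambda>_. borel) X J"
    and "\<And>j. j \<in> J \<Longrightarrow> integrable M (\<lambda>x. (X j x)\<^sup>2)" and "\<And>j. j \<in> J \<Longrightarrow> expectation (X j) = 0"
  shows "integrable M (\<lambda>x. (\<Sum>j\<in>J. X j x)\<^sup>2) \<and>
    expectation (\<lambda>x. (\<Sum>j\<in>J. X j x)\<^sup>2) = (\<Sum>j\<in>J. expectation (\<lambda>x. (X j x)\<^sup>2))"
  using assms
proof (induction J rule: finite_induct)
  case (insert i J)
  note rv = indep_vars_rv[OF insert.prems(1)]
  have int: "integrable M (X j)" if "j \<in> insert i J" for j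
    using rv[OF that] insert.prems(2)[OF that] by (rule expectation_abs_le_sqrt(1))
  have ind: "indep_vars (\<lambda>_. borel) X J"
    by (rule indep_vars_subset[OF insert.prems(1)]) auto
  have IH: "integrable M (\<lambda>x. (\<Sum>j\<in>J. X j x)\<^sup>2)"
    "expectation (\<lambda>x. (\<Sum>j\<in>J. X j x)\<^sup>2) = (\<Sum>j\<in>J. expectation (\<lambda>x. (X j x)\<^sup>2))"
    using insert.IH[OF ind insert.prems(2,3)] by auto
  have iv: "indep_var borel (X i) borel (\<lambda>x. \<Sum>j\<in>J. X j x)"
    by (rule indep_vars_sum[OF insert.hyps insert.prems(1)])
  have intS: "integrable M (\<lambda>x. \<Sum>j\<in>J. X j x)"
    by (rule Bochner_Integration.integrable_sum) (simp add: int)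
  have intP: "integrable M (\<lambda>x. X i x * (\<Sum>j\<in>J. X j x))"
    using indep_var_integrable[OF iv int[of i] intS] by simp
  have zero: "expectation (\<lambda>x. X i x * (\<Sum>j\<in>J. X j x)) = 0"
    using indep_var_lebesgue_integral[OF iv int[of i] intS] insert.prems(3)[of i] by simp
  have eq: "(\<Sum>j\<in>insert i J. X j x)\<^sup>2 = (X i x)\<^sup>2 + 2 * (X i x * (\<Sum>j\<in>J. X j x)) + (\<Sum>j\<in>J. X j x)\<^sup>2" for x
    using insert.hyps by (simp add: power2_sum)
  show ?case
    unfolding eq using insert.hyps insert.prems(2) IH intP zero by simp
qed simp

lemma (in prob_space) expectation_abs_mean_le:
  fixes X :: "'i \<Rightarrow> 'a \<Rightarrow> real"
  assumes J: "finite J" "J \<noteq> {}" and ind: "indep_vars (\<lambda>_. borel) X J"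
    and int: "\<And>j. j \<in> J \<Longrightarrow> integrable M (\<lambda>x. (X j x)\<^sup>2)"
    and mean: "\<And>j. j \<in> J \<Longrightarrow> expectation (X j) = \<mu>"
    and var: "\<And>j. j \<in> J \<Longrightarrow> expectation (\<lambda>x. (X j x)\<^sup>2) \<le> s"
  shows "expectation (\<lambda>x. \<bar>(\<Sum>j\<in>J. X j x) / card J - \<mu>\<bar>) \<le> sqrt (s / card J)"
proof -
  note rv = indep_vars_rv[OF ind]
  define Y where "Y j x = X j x - \<mu>" for j x
  have c: "0 < real (card J)" using J by (simp add: card_gt_0_iff)
  have intX: "integrable M (X j)" if "j \<in> J" for j
    using rv[OF that] int[OF that] by (rule expectation_abs_le_sqrt(1))
  have indY: "indep_vars (\<lambda>_. borel) Y J"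
    unfolding Y_def by (rule indep_vars_compose2[OF ind, where Y = "\<lambda>j y. y - \<mu>", simplified]) auto
  have eq: "(Y j x)\<^sup>2 = (X j x)\<^sup>2 - 2 * \<mu> * X j x + \<mu>\<^sup>2" for j x
    by (simp add: Y_def power2_diff)
  have intY: "integrable M (\<lambda>x. (Y j x)\<^sup>2)" if "j \<in> J" for j
    unfolding eq using int[OF that] intX[OF that] by auto
  have "expectation (\<lambda>x. (Y j x)\<^sup>2) \<le> s" if "j \<in> J" for j
  proof -
    have "expectation (\<lambda>x. (Y j x)\<^sup>2) = expectation (\<lambda>x. (X j x)\<^sup>2) - 2 * \<mu> * expectation (X j) + \<mu>\<^sup>2"
      unfolding eq using int[OF that] intX[OF that] by (simp add: prob_space)
    also have "\<dots> = expectation (\<lambda>x. (X j x)\<^sup>2) - \<mu>\<^sup>2"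
      using mean[OF that] by (simp add: power2_eq_square)
    finally show ?thesis using var[OF that] zero_le_power2[of \<mu>] by linarith
  qed
  then have le: "(\<Sum>j\<in>J. expectation (\<lambda>x. (Y j x)\<^sup>2)) \<le> card J * s"
    using sum_mono[of J "\<lambda>j. expectation (\<lambda>x. (Y j x)\<^sup>2)" "\<lambda>_. s"] by simp
  have meanY: "expectation (Y j) = 0" if "j \<in> J" for j
    using mean[OF that] intX[OF that] unfolding Y_def by (simp add: prob_space)
  have sq: "integrable M (\<lambda>x. (\<Sum>j\<in>J. Y j x)\<^sup>2)"
    "expectation (\<lambda>x. (\<Sum>j\<in>J. Y j x)\<^sup>2) = (\<Sum>j\<in>J. expectation (\<lambda>x. (Y j x)\<^sup>2))"
    using expectation_sum_squared[OF J(1) indY intY meanY] by auto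
  have eq2: "(\<Sum>j\<in>J. X j x) / card J - \<mu> = (\<Sum>j\<in>J. Y j x) / card J" for x
    using c by (simp add: Y_def sum_subtractf field_simps)
  have "expectation (\<lambda>x. \<bar>(\<Sum>j\<in>J. X j x) / card J - \<mu>\<bar>) \<le> sqrt (expectation (\<lambda>x. ((\<Sum>j\<in>J. Y j x) / card J)\<^sup>2))"
    unfolding eq2
  proof (intro expectation_abs_le_sqrt(2))
    show "(\<lambda>x. (\<Sum>j\<in>J. Y j x) / real (card J)) \<in> borel_measurable M"
      using indep_vars_rv[OF indY] by (intro borel_measurable_divide borel_measurable_sum) auto
    show "integrable M (\<lambda>x. ((\<Sum>j\<in>J. Y j x) / real (card J))\<^sup>2)"
      using sq(1) by (simp add: power_divide)
  qed
  also have "\<dots> \<le> sqrt (s / card J)"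
  proof (rule real_sqrt_le_mono)
    have "expectation (\<lambda>x. ((\<Sum>j\<in>J. Y j x) / card J)\<^sup>2) \<le> card J * s / (card J)\<^sup>2"
      using sq(2) le by (simp add: power_divide divide_right_mono)
    also have "\<dots> = s / card J" using c by (simp add: power2_eq_square)
    finally show "expectation (\<lambda>x. ((\<Sum>j\<in>J. Y j x) / card J)\<^sup>2) \<le> s / card J" .
  qed
  finally show ?thesis .
qed

text \<open>The bound of the weak law for the mean of \<open>m\<close> variables, truncated at \<open>root 4 m\<close>.\<close>

definition wlln_rate :: "real measure \<Rightarrow> nat \<Rightarrow> real" where
  "wlln_rate D m = sqrt (sqrt m / m) + 2 * (\<integral>x. \<bar>x\<bar> * indicator {x. root 4 m < \<bar>x\<bar>} x \<partial>D)"

lemma wlln_rate_tendsto: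
  assumes D: "sets D = sets borel" "integrable D (\<lambda>x. x)"
  shows "wlln_rate D \<longlonglongrightarrow> 0"
proof -
  have [measurable_cong]: "sets D = sets borel" by fact
  have "(\<lambda>m. \<integral>x. \<bar>x\<bar> * indicator {x. root 4 (real m) < \<bar>x\<bar>} x \<partial>D) \<longlonglongrightarrow> (\<integral>x. 0 \<partial>D)"
  proof (rule integral_dominated_convergence[where w = "\<lambda>x. \<bar>x\<bar>"])
    show "AE x in D. (\<lambda>m. \<bar>x\<bar> * indicator {x. root 4 (real m) < \<bar>x\<bar>} x) \<longlonglongrightarrow> 0"
    proof (intro AE_I2 tendsto_eventually)
      fix x :: real
      have "\<forall>\<^sub>F m in sequentially. nat \<lceil>\<bar>x\<bar> ^ 4\<rceil> \<le> m"
        by (rule eventually_ge_at_top)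
      then have "\<forall>\<^sub>F m in sequentially. \<bar>x\<bar> \<le> root 4 (real m)"
      proof eventually_elim
        case (elim m)
        then have "\<bar>x\<bar> ^ 4 \<le> real m" by linarith
        then have "root 4 (\<bar>x\<bar> ^ 4) \<le> root 4 (real m)" by simp
        then show ?case by (simp only: real_root_power_cancel zero_less_numeral abs_ge_zero)
      qed
      then show "\<forall>\<^sub>F m in sequentially. \<bar>x\<bar> * indicator {x. root 4 (real m) < \<bar>x\<bar>} x = 0"
        by eventually_elim (auto simp: indicator_def)
    qed
    show "integrable D (\<lambda>x. \<bar>x\<bar>)" using D(2) by (rule integrable_abs)
    show "AE x in D. norm (\<bar>x\<bar> * indicator {x. root 4 (real m) < \<bar>x\<bar>} x) \<le> \<bar>x\<bar>" for m
      by (intro AE_I2) (simp add: indicator_def)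
  qed measurable
  moreover have "(\<lambda>m. sqrt (sqrt (real m) / real m)) \<longlonglongrightarrow> 0"
  proof -
    have "(\<lambda>m. inverse (sqrt (real m))) \<longlonglongrightarrow> 0"
      by (intro tendsto_inverse_0_at_top filterlim_compose[OF sqrt_at_top filterlim_real_sequentially])
    then have "(\<lambda>m. sqrt (inverse (sqrt (real m)))) \<longlonglongrightarrow> sqrt 0"
      by (rule tendsto_real_sqrt)
    moreover have "inverse (sqrt (real m)) = sqrt (real m) / real m" for m
      by (cases "m = 0") (simp_all add: field_simps)
    ultimately show ?thesis by simp
  qed
  ultimately have "(\<lambda>m. sqrt (sqrt (real m) / real m) + 2 * (\<integral>x. \<bar>x\<bar> * indicator {x. root 4 (real m) < \<bar>x\<bar>} x \<partial>D)) \<longlonglongrightarrow> 0 + 2 * 0"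
    by (intro tendsto_intros) simp_all
  then show ?thesis by (simp add: wlln_rate_def[abs_def])
qed

text \<open>Products of two centred values are only known to have a finite mean, so the second
  moment bound is applied after truncation at K = \<open>root 4 m\<close>: the truncated variables
  have second moment at most K^2 = sqrt m = o(m), and the remainder costs at most twice its absolute
  mean. The bound depends only on the law \<open>D\<close> and the number of variables.\<close>

lemma (in prob_space) weak_law_L1:
  fixes X :: "'i \<Rightarrow> 'a \<Rightarrow> real"
  assumes J: "finite J" "J \<noteq> {}" and ind: "indep_vars (\<lambda>_. borel) X J"
    and D: "\<And>j. j \<in> J \<Longrightarrow> distr M borel (X j) = D" and int: "integrable D (\<lambda>x. x)"
  shows "expectation (\<lambda>x. \<bar>(\<Sum>j\<in>J. X j x) / card J - (\<integral>x. x \<partial>D)\<bar>) \<le> wlln_rate D (card J)"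
proof -
  note rv[measurable] = indep_vars_rv[OF ind]
  define m where "m = card J"
  have m: "0 < m" using J by (simp add: card_gt_0_iff m_def)
  define K where "K = root 4 m"
  have K: "0 \<le> K" "K ^ 4 = m" using m by (simp_all add: K_def)
  then have K2: "K\<^sup>2 = sqrt m" by (intro real_sqrt_unique[symmetric]) (simp_all flip: power_mult)
  obtain j0 where "j0 \<in> J" using J by auto
  have setsD[measurable_cong]: "sets D = sets borel" using D[OF \<open>j0 \<in> J\<close>] by auto
  define t where "t x = x * indicator {x. \<bar>x\<bar> \<le> K} x" for x :: real
  define r where "r x = x * indicator {x. K < \<bar>x\<bar>} x" for x :: real
  have tr: "x = t x + r x" for x by (auto simp: t_def r_def indicator_def)
  have [measurable]: "t \<in> borel_measurable borel" "r \<in> borel_measurable borel"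
    unfolding t_def[abs_def] r_def[abs_def] by measurable
  have eD: "expectation (\<lambda>x. f (X j x)) = (\<integral>x. f x \<partial>D)" if "j \<in> J" "f \<in> borel_measurable borel" for f :: "real \<Rightarrow> real" and j
    using that by (simp add: D[OF that(1), symmetric] integral_distr)
  have iD: "integrable M (\<lambda>x. f (X j x)) \<longleftrightarrow> integrable D f" if "j \<in> J" "f \<in> borel_measurable borel" for f :: "real \<Rightarrow> real" and j
    using that by (simp add: D[OF that(1), symmetric] integrable_distr_eq)
  interpret D: prob_space D unfolding D[OF \<open>j0 \<in> J\<close>, symmetric] using \<open>j0 \<in> J\<close> by (intro prob_space_distr) auto
  have ir: "integrable D r" by (rule Bochner_Integration.integrable_bound[OF int]) (auto simp: r_def indicator_def)
  have it: "integrable D t" by (rule Bochner_Integration.integrable_bound[OF int]) (auto simp: t_def indicator_def)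
  have it2: "integrable D (\<lambda>x. (t x)\<^sup>2)"
    by (rule D.integrable_const_bound[of _ "K\<^sup>2"]) (use K in \<open>auto simp: t_def indicator_def simp flip: abs_le_square_iff\<close>)
  have t2: "(t x)\<^sup>2 \<le> sqrt m" for x
    using K(1) by (auto simp: t_def indicator_def K2[symmetric] simp flip: abs_le_square_iff)
  have A: "expectation (\<lambda>x. \<bar>(\<Sum>j\<in>J. t (X j x)) / card J - (\<integral>x. t x \<partial>D)\<bar>) \<le> sqrt (sqrt m / card J)"
  proof (rule expectation_abs_mean_le[OF J])
    show "indep_vars (\<lambda>_. borel) (\<lambda>j x. t (X j x)) J"
      by (rule indep_vars_compose2[OF ind]) auto
    fix j assume j: "j \<in> J"
    show "integrable M (\<lambda>x. (t (X j x))\<^sup>2)" using iD[OF j, of "\<lambda>x. (t x)\<^sup>2"] it2 by simp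
    show "expectation (\<lambda>x. t (X j x)) = (\<integral>x. t x \<partial>D)" using eD[OF j, of t] by simp
    show "expectation (\<lambda>x. (t (X j x))\<^sup>2) \<le> sqrt m"
      unfolding eD[OF j, of "\<lambda>x. (t x)\<^sup>2", simplified] using it2 t2 by (intro D.integral_le_const) auto
  qed
  have iM: "integrable M (\<lambda>x. r (X j x))" "integrable M (\<lambda>x. t (X j x))" if "j \<in> J" for j
    using iD[OF that] ir it by auto
  have B: "expectation (\<lambda>x. \<bar>(\<Sum>j\<in>J. r (X j x)) / card J - (\<integral>x. r x \<partial>D)\<bar>) \<le> 2 * (\<integral>x. \<bar>r x\<bar> \<partial>D)"
  proof -
    have "expectation (\<lambda>x. \<bar>(\<Sum>j\<in>J. r (X j x)) / card J - (\<integral>x. r x \<partial>D)\<bar>)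
      \<le> expectation (\<lambda>x. (\<Sum>j\<in>J. \<bar>r (X j x)\<bar>) / card J + (\<integral>x. \<bar>r x\<bar> \<partial>D))"
    proof (intro integral_mono)
      fix x
      have "\<bar>(\<Sum>j\<in>J. r (X j x)) / card J\<bar> \<le> (\<Sum>j\<in>J. \<bar>r (X j x)\<bar>) / card J"
        by (simp add: divide_right_mono)
      moreover have "\<bar>\<integral>x. r x \<partial>D\<bar> \<le> (\<integral>x. \<bar>r x\<bar> \<partial>D)" by (rule integral_abs_bound)
      ultimately show "\<bar>(\<Sum>j\<in>J. r (X j x)) / card J - (\<integral>x. r x \<partial>D)\<bar> \<le> (\<Sum>j\<in>J. \<bar>r (X j x)\<bar>) / card J + (\<integral>x. \<bar>r x\<bar> \<partial>D)"
        by linarith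
    qed (use iM in auto)
    also have "\<dots> = (\<Sum>j\<in>J. expectation (\<lambda>x. \<bar>r (X j x)\<bar>)) / card J + (\<integral>x. \<bar>r x\<bar> \<partial>D)"
      using iM by (simp add: prob_space)
    also have "(\<Sum>j\<in>J. expectation (\<lambda>x. \<bar>r (X j x)\<bar>)) = card J * (\<integral>x. \<bar>r x\<bar> \<partial>D)"
      using eD[of _ "\<lambda>x. \<bar>r x\<bar>"] by simp
    finally show ?thesis using m by (simp add: m_def)
  qed
  have "expectation (\<lambda>x. \<bar>(\<Sum>j\<in>J. X j x) / card J - (\<integral>x. x \<partial>D)\<bar>) \<le>
     expectation (\<lambda>x. \<bar>(\<Sum>j\<in>J. t (X j x)) / card J - (\<integral>x. t x \<partial>D)\<bar> + \<bar>(\<Sum>j\<in>J. r (X j x)) / card J - (\<integral>x. r x \<partial>D)\<bar>)"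
  proof (intro integral_mono)
    fix x
    have "(\<Sum>j\<in>J. X j x) = (\<Sum>j\<in>J. t (X j x)) + (\<Sum>j\<in>J. r (X j x))"
      by (simp only: sum.distrib[symmetric] tr[symmetric])
    moreover have "(\<integral>x. x \<partial>D) = (\<integral>x. t x \<partial>D) + (\<integral>x. r x \<partial>D)"
      using Bochner_Integration.integral_add[OF it ir] by (simp only: tr[symmetric])
    ultimately show "\<bar>(\<Sum>j\<in>J. X j x) / card J - (\<integral>x. x \<partial>D)\<bar> \<le> \<bar>(\<Sum>j\<in>J. t (X j x)) / card J - (\<integral>x. t x \<partial>D)\<bar> + \<bar>(\<Sum>j\<in>J. r (X j x)) / card J - (\<integral>x. r x \<partial>D)\<bar>"
      by (simp add: add_divide_distrib)
  next
    have iX: "integrable M (X j)" if "j \<in> J" for j by (rule iD[THEN iffD2, OF that _ int]) simp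
    show "integrable M (\<lambda>x. \<bar>(\<Sum>j\<in>J. X j x) / card J - (\<integral>x. x \<partial>D)\<bar>)"
      by (intro integrable_abs Bochner_Integration.integrable_diff integrable_divide
          Bochner_Integration.integrable_sum iX integrable_const) auto
    show "integrable M (\<lambda>x. \<bar>(\<Sum>j\<in>J. t (X j x)) / card J - (\<integral>x. t x \<partial>D)\<bar> + \<bar>(\<Sum>j\<in>J. r (X j x)) / card J - (\<integral>x. r x \<partial>D)\<bar>)"
      using iM by auto
  qed
  also have "\<dots> = expectation (\<lambda>x. \<bar>(\<Sum>j\<in>J. t (X j x)) / card J - (\<integral>x. t x \<partial>D)\<bar>) + expectation (\<lambda>x. \<bar>(\<Sum>j\<in>J. r (X j x)) / card J - (\<integral>x. r x \<partial>D)\<bar>)"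
    using iM by (intro Bochner_Integration.integral_add) auto
  also have "\<dots> \<le> sqrt (sqrt m / card J) + 2 * (\<integral>x. \<bar>r x\<bar> \<partial>D)"
    using A B by linarith
  also have "(\<lambda>x. \<bar>r x\<bar>) = (\<lambda>x. \<bar>x\<bar> * indicator {x. K < \<bar>x\<bar>} x)"
    by (auto simp: r_def indicator_def)
  finally show ?thesis by (simp add: wlln_rate_def m_def K_def)
qed

subsection \<open>Sample covariances\<close>

text \<open>The parallel axis identity. With a and b the true means, the sums consist of independent
  centred terms. For m = 1 both sides are 0 because 1 / 0 = 0.\<close>

lemma sample_cov_shift:
  assumes "0 < m"
  shows "sample_cov m y t s = 1 / (real m - 1) *
    ((\<Sum>j=1..m. (y j t - a) * (y j s - b)) - m * ((sample_mean m y t - a) * (sample_mean m y s - b)))"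
proof -
  define A where "A j = y j t - a" for j
  define B where "B j = y j s - b" for j
  define p where "p = sample_mean m y t - a"
  define q where "q = sample_mean m y s - b"
  have sA: "(\<Sum>j=1..m. A j) = m * p" and sB: "(\<Sum>j=1..m. B j) = m * q"
    using assms by (simp_all add: A_def B_def p_def q_def sample_mean_def sum_subtractf field_simps)
  have "(\<Sum>j=1..m. (y j t - sample_mean m y t) * (y j s - sample_mean m y s)) =
     (\<Sum>j=1..m. A j * B j - q * A j - p * B j + p * q)"
    by (rule sum.cong) (simp_all add: A_def B_def p_def q_def algebra_simps)
  also have "\<dots> = (\<Sum>j=1..m. A j * B j) - q * (\<Sum>j=1..m. A j) - p * (\<Sum>j=1..m. B j) + m * (p * q)"
    by (simp add: sum.distrib sum_subtractf sum_distrib_left)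
  also have "\<dots> = (\<Sum>j=1..m. A j * B j) - m * (p * q)"
    unfolding sA sB by (simp add: algebra_simps)
  finally show ?thesis by (simp add: sample_cov_def A_def B_def p_def q_def)
qed

lemma sample_cov_nonneg: "0 \<le> sample_cov m y t t"
\<comment> \<open>For m = 0 the prefactor is -1, and it is the empty sum that makes the value
  0.\<close>
proof (cases "m = 0")
  case False
  then show ?thesis
    by (simp add: sample_cov_def sum_nonneg flip: power2_eq_square)
qed (simp add: sample_cov_def)

lemma abs_sample_cov_le:
  "\<bar>sample_cov m y t s\<bar> \<le> (sample_cov m y t t + sample_cov m y s s) / 2"
proof (cases "m = 0")
  case False
  define A where "A j = y j t - sample_mean m y t" for j
  define B where "B j = y j s - sample_mean m y s" for j
  have "\<bar>\<Sum>j=1..m. A j * B j\<bar> \<le> (\<Sum>j=1..m. \<bar>A j * B j\<bar>)" by (rule sum_abs)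
  also have "\<dots> \<le> (\<Sum>j=1..m. (A j * A j + B j * B j) / 2)"
  proof (rule sum_mono)
    fix j show "\<bar>A j * B j\<bar> \<le> (A j * A j + B j * B j) / 2"
      using sum_squares_bound[of "\<bar>A j\<bar>" "\<bar>B j\<bar>"] by (simp add: abs_mult power2_eq_square)
  qed
  also have "\<dots> = ((\<Sum>j=1..m. A j * A j) + (\<Sum>j=1..m. B j * B j)) / 2"
    by (simp add: sum.distrib sum_divide_distrib[symmetric])
  finally have "\<bar>\<Sum>j=1..m. A j * B j\<bar> \<le> ((\<Sum>j=1..m. A j * A j) + (\<Sum>j=1..m. B j * B j)) / 2" .
  moreover have "0 \<le> 1 / (real m - 1)" using False by simp
  ultimately have "1 / (real m - 1) * \<bar>\<Sum>j=1..m. A j * B j\<bar> \<le>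
     1 / (real m - 1) * (((\<Sum>j=1..m. A j * A j) + (\<Sum>j=1..m. B j * B j)) / 2)"
    by (rule mult_left_mono)
  then show ?thesis
    using False by (simp add: sample_cov_def A_def B_def abs_mult algebra_simps add_divide_distrib)
qed (simp add: sample_cov_def)

text \<open>From m = 2 on, 1 / (m - 1) \<le> 2 / m; for m \<le> 1 the left side is 0. The bound thus
  covers all sample sizes at once, as dominated convergence over the times requires.\<close>

lemma sample_cov_diag_le:
  "sample_cov m y t t \<le> 2 / m * (\<Sum>j=1..m. (y j t - a)\<^sup>2)"
proof (cases "m \<le> 1")
  case True
  then consider "m = 0" | "m = 1" by linarith
  then show ?thesis by cases (simp_all add: sample_cov_def)
next
  case False
  have "sample_cov m y t t \<le> 1 / (real m - 1) * (\<Sum>j=1..m. (y j t - a)\<^sup>2)"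
    using False by (subst sample_cov_shift[of m y t t a a]) (auto simp: power2_eq_square divide_right_mono)
  also have "\<dots> \<le> 2 / m * (\<Sum>j=1..m. (y j t - a)\<^sup>2)"
    using False by (intro mult_right_mono sum_nonneg) (auto simp: field_simps)
  finally show ?thesis .
qed

lemma abs_mult_le_half: "\<bar>u * w\<bar> \<le> (u\<^sup>2 + w\<^sup>2) / 2" for u w :: real
  using sum_squares_bound[of "\<bar>u\<bar>" "\<bar>w\<bar>"] by (simp add: abs_mult)

lemma integrable_mult_of_squares:
  fixes f g :: "'a \<Rightarrow> real"
  assumes "f \<in> borel_measurable M" "g \<in> borel_measurable M"
    and "integrable M (\<lambda>x. (f x)\<^sup>2)" "integrable M (\<lambda>x. (g x)\<^sup>2)"
  shows "integrable M (\<lambda>x. f x * g x)"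
proof (rule Bochner_Integration.integrable_bound)
  show "integrable M (\<lambda>x. ((f x)\<^sup>2 + (g x)\<^sup>2) / 2)" using assms by simp
  show "AE x in M. norm (f x * g x) \<le> norm (((f x)\<^sup>2 + (g x)\<^sup>2) / 2)"
    using abs_mult_le_half[of "f _" "g _"] by (intro AE_I2) (simp add: abs_of_nonneg)
qed (use assms in simp)

text \<open>The sample covariance is m / (m - 1) times the mean of the A_j B_j minus S_A S_B / (m (m
  - 1)), with S_A and S_B the sums. The weak law handles the first term, where m / (m - 1) \<le> 2;
  |S_A S_B| \<le> (S_A^2 + S_B^2) / 2 has mean at most m (\<alpha> + \<beta>) / 2; correcting m / (m
  - 1) to 1 costs |c| / (m - 1), with c the mean of \<open>D\<close>.\<close>

lemma (in prob_space)
  fixes X :: "nat \<Rightarrow> 'a \<Rightarrow> real \<Rightarrow> real" and \<eta> :: "real \<Rightarrow> real" and t s :: real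
  defines "A \<equiv> \<lambda>j \<omega>. X j \<omega> t - \<eta> t" and "B \<equiv> \<lambda>j \<omega>. X j \<omega> s - \<eta> s"
  assumes m: "2 \<le> m"
    and indA: "indep_vars (\<lambda>_. borel) A {1..m}" and indB: "indep_vars (\<lambda>_. borel) B {1..m}"
    and indAB: "indep_vars (\<lambda>_. borel) (\<lambda>j \<omega>. A j \<omega> * B j \<omega>) {1..m}"
    and intA: "\<And>j. j \<in> {1..m} \<Longrightarrow> integrable M (\<lambda>\<omega>. (A j \<omega>)\<^sup>2)"
    and intB: "\<And>j. j \<in> {1..m} \<Longrightarrow> integrable M (\<lambda>\<omega>. (B j \<omega>)\<^sup>2)"
    and meanA: "\<And>j. j \<in> {1..m} \<Longrightarrow> expectation (A j) = 0"
    and meanB: "\<And>j. j \<in> {1..m} \<Longrightarrow> expectation (B j) = 0"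
    and varA: "\<And>j. j \<in> {1..m} \<Longrightarrow> expectation (\<lambda>\<omega>. (A j \<omega>)\<^sup>2) = \<alpha>"
    and varB: "\<And>j. j \<in> {1..m} \<Longrightarrow> expectation (\<lambda>\<omega>. (B j \<omega>)\<^sup>2) = \<beta>"
    and D: "\<And>j. j \<in> {1..m} \<Longrightarrow> distr M borel (\<lambda>\<omega>. A j \<omega> * B j \<omega>) = D"
  shows sample_cov_L1_integrable: "integrable M (\<lambda>\<omega>. sample_cov m (\<lambda>j. X j \<omega>) t s)"
    and sample_cov_L1: "expectation (\<lambda>\<omega>. \<bar>sample_cov m (\<lambda>j. X j \<omega>) t s - (\<integral>x. x \<partial>D)\<bar>)
      \<le> 2 * wlln_rate D m + (\<bar>\<integral>x. x \<partial>D\<bar> + (\<alpha> + \<beta>) / 2) / (real m - 1)"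
proof -
  have m0: "0 < m" "1 < real m" using m by auto
  define c where "c = (\<integral>x. x \<partial>D)"
  define SA where "SA \<omega> = (\<Sum>j=1..m. A j \<omega>)" for \<omega>
  define SB where "SB \<omega> = (\<Sum>j=1..m. B j \<omega>)" for \<omega>
  define mAB where "mAB \<omega> = (\<Sum>j=1..m. A j \<omega> * B j \<omega>) / m" for \<omega>
  note [measurable] = indep_vars_rv[OF indA] indep_vars_rv[OF indB]
  have intAB: "integrable M (\<lambda>\<omega>. A j \<omega> * B j \<omega>)" if "j \<in> {1..m}" for j
    by (rule integrable_mult_of_squares[OF _ _ intA[OF that] intB[OF that]]) (use that in measurable)
  have iD: "integrable D (\<lambda>x. x)"
    using intAB[of 1] m by (subst D[of 1, symmetric]) (auto simp: integrable_distr_eq)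
  have SA2: "integrable M (\<lambda>\<omega>. (SA \<omega>)\<^sup>2)" "expectation (\<lambda>\<omega>. (SA \<omega>)\<^sup>2) = m * \<alpha>"
    using expectation_sum_squared[OF _ indA intA meanA] varA by (simp_all add: SA_def)
  have SB2: "integrable M (\<lambda>\<omega>. (SB \<omega>)\<^sup>2)" "expectation (\<lambda>\<omega>. (SB \<omega>)\<^sup>2) = m * \<beta>"
    using expectation_sum_squared[OF _ indB intB meanB] varB by (simp_all add: SB_def)
  have SAB: "integrable M (\<lambda>\<omega>. SA \<omega> * SB \<omega>)"
    by (rule integrable_mult_of_squares[OF _ _ SA2(1) SB2(1)]) (unfold SA_def SB_def, measurable)
  have imAB: "integrable M mAB"
    unfolding mAB_def[abs_def] by (intro integrable_divide Bochner_Integration.integrable_sum intAB) auto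
  have pA: "sample_mean m (\<lambda>j. X j \<omega>) t - \<eta> t = SA \<omega> / m"
    and pB: "sample_mean m (\<lambda>j. X j \<omega>) s - \<eta> s = SB \<omega> / m" for \<omega>
    using m0 by (simp_all add: sample_mean_def SA_def SB_def A_def B_def sum_subtractf field_simps)
  have eq: "sample_cov m (\<lambda>j. X j \<omega>) t s = m / (real m - 1) * mAB \<omega> - SA \<omega> * SB \<omega> / (m * (real m - 1))" for \<omega>
  proof -
    have alg: "1 / (r - 1) * (S - r * ((a / r) * (b / r))) = r / (r - 1) * (S / r) - a * b / (r * (r - 1))"
      if "1 < r" for r S a b :: real
    proof -
      have "r * ((a / r) * (b / r)) = a * b / r" "r / (r - 1) * (S / r) = S / (r - 1)"
        using that by simp_all
      then show ?thesis using that by (simp add: diff_divide_distrib)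
    qed
    show ?thesis
      unfolding sample_cov_shift[OF m0(1), of _ t s "\<eta> t" "\<eta> s"] pA pB mAB_def alg[OF m0(2)]
      by (simp add: A_def B_def)
  qed
  show "integrable M (\<lambda>\<omega>. sample_cov m (\<lambda>j. X j \<omega>) t s)"
    unfolding eq using imAB SAB by simp
  have E: "expectation (\<lambda>\<omega>. \<bar>mAB \<omega> - c\<bar>) \<le> wlln_rate D m"
    using weak_law_L1[OF _ _ indAB D iD] m by (simp add: mAB_def c_def)
  have le: "\<bar>sample_cov m (\<lambda>j. X j \<omega>) t s - c\<bar> \<le> 2 * \<bar>mAB \<omega> - c\<bar> + \<bar>c\<bar> / (real m - 1) + ((SA \<omega>)\<^sup>2 + (SB \<omega>)\<^sup>2) / (2 * m * (real m - 1))" for \<omega>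
  proof -
    have "sample_cov m (\<lambda>j. X j \<omega>) t s - c = m / (real m - 1) * (mAB \<omega> - c) + c / (real m - 1) - SA \<omega> * SB \<omega> / (m * (real m - 1))"
    proof -
      have "m / (real m - 1) * c - c / (real m - 1) = (real m - 1) * c / (real m - 1)"
        by (simp add: left_diff_distrib diff_divide_distrib)
      then have "m / (real m - 1) * c - c / (real m - 1) = c" using m0 by simp
      then show ?thesis unfolding eq right_diff_distrib by linarith
    qed
    moreover have "\<bar>m / (real m - 1) * (mAB \<omega> - c)\<bar> \<le> 2 * \<bar>mAB \<omega> - c\<bar>"
      unfolding abs_mult using m m0 by (intro mult_right_mono) (auto simp: field_simps)
    moreover have "\<bar>c / (real m - 1)\<bar> = \<bar>c\<bar> / (real m - 1)" using m0 by simp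
    moreover have "\<bar>SA \<omega> * SB \<omega> / (m * (real m - 1))\<bar> \<le> ((SA \<omega>)\<^sup>2 + (SB \<omega>)\<^sup>2) / (2 * m * (real m - 1))"
    proof -
      have "\<bar>SA \<omega> * SB \<omega>\<bar> \<le> ((SA \<omega>)\<^sup>2 + (SB \<omega>)\<^sup>2) / 2"
        using sum_squares_bound[of "\<bar>SA \<omega>\<bar>" "\<bar>SB \<omega>\<bar>"] by (simp add: abs_mult)
      then have "\<bar>SA \<omega> * SB \<omega>\<bar> / (m * (real m - 1)) \<le> ((SA \<omega>)\<^sup>2 + (SB \<omega>)\<^sup>2) / 2 / (m * (real m - 1))"
        using m0 by (intro divide_right_mono) auto
      also have "((SA \<omega>)\<^sup>2 + (SB \<omega>)\<^sup>2) / 2 / (m * (real m - 1)) = ((SA \<omega>)\<^sup>2 + (SB \<omega>)\<^sup>2) / (2 * m * (real m - 1))"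
        by (simp add: mult.assoc)
      finally show ?thesis
        using m0 by (simp only: abs_divide abs_of_pos mult_pos_pos of_nat_0_less_iff diff_gt_0_iff_gt)
    qed
    ultimately show ?thesis by linarith
  qed
  have "expectation (\<lambda>\<omega>. \<bar>sample_cov m (\<lambda>j. X j \<omega>) t s - c\<bar>) \<le>
    expectation (\<lambda>\<omega>. 2 * \<bar>mAB \<omega> - c\<bar> + \<bar>c\<bar> / (real m - 1) + ((SA \<omega>)\<^sup>2 + (SB \<omega>)\<^sup>2) / (2 * m * (real m - 1)))"
  proof (rule integral_mono[OF _ _ le])
    show "integrable M (\<lambda>\<omega>. \<bar>sample_cov m (\<lambda>j. X j \<omega>) t s - c\<bar>)"
      unfolding eq using imAB SAB by simp
    show "integrable M (\<lambda>\<omega>. 2 * \<bar>mAB \<omega> - c\<bar> + \<bar>c\<bar> / (real m - 1) + ((SA \<omega>)\<^sup>2 + (SB \<omega>)\<^sup>2) / (2 * m * (real m - 1)))"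
      using imAB SA2 SB2 by simp
  qed
  also have "\<dots> = 2 * expectation (\<lambda>\<omega>. \<bar>mAB \<omega> - c\<bar>) + \<bar>c\<bar> / (real m - 1) + (m * \<alpha> + m * \<beta>) / (2 * m * (real m - 1))"
    using imAB SA2 SB2 by (simp add: prob_space)
  also have "(m * \<alpha> + m * \<beta>) / (2 * m * (real m - 1)) = (\<alpha> + \<beta>) / 2 / (real m - 1)"
    using m0 by (simp add: distrib_left[symmetric])
  also have "2 * expectation (\<lambda>\<omega>. \<bar>mAB \<omega> - c\<bar>) + \<bar>c\<bar> / (real m - 1) + (\<alpha> + \<beta>) / 2 / (real m - 1) \<le>
     2 * wlln_rate D m + (\<bar>c\<bar> + (\<alpha> + \<beta>) / 2) / (real m - 1)"
    using E by (simp add: add_divide_distrib)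
  finally show "expectation (\<lambda>\<omega>. \<bar>sample_cov m (\<lambda>j. X j \<omega>) t s - (\<integral>x. x \<partial>D)\<bar>)
      \<le> 2 * wlln_rate D m + (\<bar>\<integral>x. x \<partial>D\<bar> + (\<alpha> + \<beta>) / 2) / (real m - 1)"
    by (simp add: c_def)
qed

subsection \<open>Second moment of the squared t-statistic\<close>

lemma centered_normal_iff_distributed:
  fixes X :: "'b \<Rightarrow> real"
  assumes "0 < v" "X \<in> borel_measurable N"
  shows "distr N borel X = centered_normal v \<longleftrightarrow> distributed N lborel X (normal_density 0 (sqrt v))"
proof -
  have "distr N lborel X = distr N borel X" by (rule distr_cong) auto
  then show ?thesis using assms by (simp add: distributed_def centered_normal_def)
qed

text \<open>For \<sigma> \<ge> 1 the density is at most 1, so the part on [-1, 1] is at most the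
  integral of |x|^(-1/2), which is 4. Elsewhere |x|^(-1/2) \<le> 1 and the density has mass at most
  1.\<close>

lemma nn_integral_inverse_sqrt_normal:
  assumes "\<sigma> \<ge> 1"
  shows "(\<integral>\<^sup>+x. ennreal (normal_density 0 \<sigma> x * \<bar>x\<bar> powr (-1/2)) \<partial>lborel) \<le> ennreal 5"
proof -
  have h1: "((\<lambda>x::real. \<bar>x\<bar> powr (-1/2)) has_integral 2) {0..1}"
  proof (rule has_integral_eq[rotated])
    show "((\<lambda>x::real. x powr (-1/2)) has_integral 2) {0..1}"
      using has_integral_powr_from_0[of "-1/2" 1] by simp
  qed simp
  have h2: "((\<lambda>x::real. \<bar>x\<bar> powr (-1/2)) has_integral 2) {-1..0}"
    using has_integral_reflect_real[of "\<lambda>x::real. \<bar>x\<bar> powr (-1/2)" 2 1 0] h1 by simp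
  have h: "((\<lambda>x::real. \<bar>x\<bar> powr (-1/2)) has_integral 4) {-1..1}"
    using has_integral_combine[OF _ _ h2 h1] by simp
  have I: "(\<integral>\<^sup>+x. ennreal (indicator {-1..1} x * \<bar>x\<bar> powr (-1/2)) \<partial>lborel) = ennreal 4"
    using nn_integral_has_integral_lebesgue[OF _ h] by simp
  have dens: "normal_density 0 \<sigma> x \<le> 1" for x
  proof -
    have "1 \<le> 2 * pi * \<sigma>\<^sup>2" using pi_gt3 one_le_power[OF assms, of 2]
        mult_mono[of 1 "2 * pi" 1 "\<sigma>\<^sup>2"] by simp
    then have "1 \<le> sqrt (2 * pi * \<sigma>\<^sup>2)" by simp
    then have "1 / sqrt (2 * pi * \<sigma>\<^sup>2) \<le> 1" by simp
    moreover have "exp (- (x - 0)\<^sup>2 / (2 * \<sigma>\<^sup>2)) \<le> 1" by simp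
    ultimately show ?thesis unfolding normal_density_def
      by (intro mult_le_one) auto
  qed
  have "normal_density 0 \<sigma> x * \<bar>x\<bar> powr (-1/2) \<le> indicator {-1..1} x * \<bar>x\<bar> powr (-1/2) + normal_density 0 \<sigma> x" for x
  proof (cases "\<bar>x\<bar> \<le> 1")
    case True
    then show ?thesis
      using mult_right_mono[OF dens[of x], of "\<bar>x\<bar> powr (-1/2)"]
      by (auto simp: indicator_def abs_le_iff intro!: add_increasing2)
  next
    case False
    then have "\<bar>x\<bar> powr (-1/2) \<le> 1 powr (-1/2)" by (intro powr_mono2') auto
    then show ?thesis
      using mult_left_mono[of "\<bar>x\<bar> powr (-1/2)" 1 "normal_density 0 \<sigma> x"] False by (auto simp: indicator_def)
  qed
  then have "(\<integral>\<^sup>+x. ennreal (normal_density 0 \<sigma> x * \<bar>x\<bar> powr (-1/2)) \<partial>lborel) \<le>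
     (\<integral>\<^sup>+x. ennreal (indicator {-1..1} x * \<bar>x\<bar> powr (-1/2)) + ennreal (normal_density 0 \<sigma> x) \<partial>lborel)"
    by (intro nn_integral_mono) (simp flip: ennreal_plus)
  also have "\<dots> = ennreal 4 + (\<integral>\<^sup>+x. ennreal (normal_density 0 \<sigma> x) \<partial>lborel)"
    unfolding I[symmetric] by (intro nn_integral_add) auto
  also have "(\<integral>\<^sup>+x. ennreal (normal_density 0 \<sigma> x) \<partial>lborel) = 1"
    using prob_space.emeasure_space_1[OF prob_space_normal_density[of \<sigma> 0]] assms
    by (simp add: emeasure_density)
  also have "ennreal 4 + 1 = ennreal 5" using ennreal_plus[of 4 1] by simp
  finally show ?thesis .
qed

text \<open>By convexity of exp, x^(-a) is interpolated between x^0 and x^(-1/2) with weights 1 - 2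
  a and 2 a. The leading 1 matters: a product of K such bounds with a of order 1 / K stays
  bounded.\<close>

lemma powr_neg_le_convex_combination:
  fixes x a :: real
  assumes "0 < x" "0 \<le> a" "a \<le> 1/2"
  shows "x powr (- a) \<le> 1 + 2 * a * x powr (-1/2)"
proof -
  define y where "y = - ln x / 2"
  have "exp ((1 - 2 * a) *\<^sub>R 0 + (2 * a) *\<^sub>R y) \<le> (1 - 2 * a) * exp 0 + (2 * a) * exp y"
    using assms by (intro convex_onD[OF exp_convex]) auto
  moreover have "exp ((1 - 2 * a) *\<^sub>R 0 + (2 * a) *\<^sub>R y) = x powr (- a)"
    using assms by (simp add: powr_def y_def)
  moreover have "exp y = x powr (-1/2)" using assms by (simp add: powr_def y_def)
  ultimately show ?thesis using assms by simp
qed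

definition tstat_const :: real where
  "tstat_const = (105 + 256 * exp 80) / 2"

text \<open>The sample variance is bounded from below by the geometric mean of the squared differences of
  disjoint pairs of observations. This makes its inverse fourth power integrable, and the bound
  \<open>256 * exp 80\<close> does not depend on the sample size; 105 is the eighth moment of a standard normal
  variable.\<close>

lemma (in prob_space) tstat_standard_moment:
  fixes g :: "nat \<Rightarrow> 'a \<Rightarrow> real"
  assumes m: "33 \<le> m" and ind: "indep_vars (\<lambda>_. borel) g {1..m}"
    and D: "\<And>j. j \<in> {1..m} \<Longrightarrow> distr M borel (g j) = centered_normal 1"
  defines "mean \<equiv> \<lambda>\<omega>. (\<Sum>j=1..m. g j \<omega>) / m"
  defines "var \<equiv> \<lambda>\<omega>. (\<Sum>j=1..m. (g j \<omega> - mean \<omega>)\<^sup>2) / (real m - 1)"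
  shows "AE \<omega> in M. 0 < var \<omega>"
    and "(\<integral>\<^sup>+\<omega>. ennreal ((m * (mean \<omega>)\<^sup>2 / var \<omega>)\<^sup>2) \<partial>M) \<le> ennreal tstat_const"
proof -
  note rv[measurable] = indep_vars_rv[OF ind]
  have m1: "1 < real m" using m by simp
  have nd: "distributed M lborel (g j) (normal_density 0 1)" if "j \<in> {1..m}" for j
    using D[OF that] centered_normal_iff_distributed[of 1 "g j" M] rv[OF that] by simp
  \<comment> \<open>K disjoint pairs, the last observation being left over if m is odd. The bound 16
    \<le> K makes the exponent 8 / K at most 1/2, as the interpolation below requires.\<close>
  define K where "K = m div 2"
  have K: "16 \<le> K" "2 * K \<le> m" "real m - 1 \<le> 2 * K" using m by (auto simp: K_def)
  define d where "d k \<omega> = g (2 * k - 1) \<omega> - g (2 * k) \<omega>" for k \<omega>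
  have mem: "2 * k - 1 \<in> {1..m}" "2 * k \<in> {1..m}" if "k \<in> {1..K}" for k
    using that K by auto
  have ne: "2 * k - 1 \<noteq> 2 * k" if "k \<in> {1..K}" for k using that by auto
  have [measurable]: "d k \<in> borel_measurable M" if "k \<in> {1..K}" for k
    using mem[OF that] unfolding d_def[abs_def] by measurable
  have ind_d: "indep_vars (\<lambda>_. borel) d {1..K}"
  proof -
    have "indep_vars (\<lambda>k. PiM {2 * k - 1, 2 * k} (\<lambda>_. borel))
        (\<lambda>k \<omega>. restrict (\<lambda>i. g i \<omega>) {2 * k - 1, 2 * k}) {1..K}"
    proof (rule indep_vars_restrict[OF ind])
      show "disjoint_family_on (\<lambda>k. {2 * k - 1, 2 * k}) {1..K}"
        unfolding disjoint_family_on_def by (auto; presburger)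
    qed (use mem in auto)
    then have "indep_vars (\<lambda>_. borel) (\<lambda>k \<omega>. (\<lambda>f. f (2 * k - 1) - f (2 * k)) (restrict (\<lambda>i. g i \<omega>) {2 * k - 1, 2 * k})) {1..K}"
      by (rule indep_vars_compose2) measurable
    then show ?thesis by (simp add: d_def[abs_def])
  qed
  have dist_d: "distributed M lborel (d k) (normal_density 0 (sqrt 2))" if k: "k \<in> {1..K}" for k
  proof -
    have "indep_vars (\<lambda>_. borel) g (insert (2 * k - 1) {2 * k})"
      by (rule indep_vars_subset[OF ind]) (use mem[OF k] in auto)
    from indep_vars_sum[OF _ _ this] ne[OF k]
    have "indep_var borel (g (2 * k - 1)) borel (g (2 * k))" by simp
    from diff_indep_normal[OF this _ _ nd nd] mem[OF k]
    show ?thesis by (simp add: d_def[abs_def])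
  qed
  have "AE \<omega> in M. d k \<omega> \<noteq> 0" if k: "k \<in> {1..K}" for k
  proof -
    have "distr M lborel (d k) = density lborel (normal_density 0 (sqrt 2))"
      using dist_d[OF k] by (simp add: distributed_def)
    moreover have "AE x in density lborel (\<lambda>x. ennreal (normal_density 0 (sqrt 2) x)). x \<noteq> 0"
      using AE_lborel_singleton[of "0::real"] by (subst AE_density) auto
    ultimately have "AE x in distr M lborel (d k). x \<noteq> 0" by (simp only:)
    then show ?thesis using k by (subst (asm) AE_distr_iff) auto
  qed
  then have AE_d: "AE \<omega> in M. \<forall>k\<in>{1..K}. d k \<omega> \<noteq> 0"
    by (intro AE_finite_allI) auto
  \<comment> \<open>The inverse fourth power of the geometric mean of the squares (d_k)^2, whence 8
    = 2 * 4 in the exponent.\<close>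
  define P where "P \<omega> = (\<Prod>k=1..K. \<bar>d k \<omega>\<bar> powr (- (8 / K)))" for \<omega>
  \<comment> \<open>Let p be that geometric mean. It is at most the arithmetic mean of the (d_k)^2;
    comparing the members of each pair with the sample mean costs a factor 2, and m - 1 \<le> 2 K
    another. Hence p \<le> 4 var, and 256 = 4^4.\<close>
  have lower: "0 < var \<omega> \<and> 1 / var \<omega> ^ 4 \<le> 256 * P \<omega>" if nz: "\<forall>k\<in>{1..K}. d k \<omega> \<noteq> 0" for \<omega>
  proof -
    define p where "p = (\<Prod>k=1..K. (d k \<omega>)\<^sup>2) powr (1 / K)"
    have ppos: "0 < p" unfolding p_def using nz by (auto simp: prod_pos)
    have "p \<le> (\<Sum>k=1..K. (d k \<omega>)\<^sup>2 / K)"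
      using arith_geom_mean[of "{1..K}" "\<lambda>k. (d k \<omega>)\<^sup>2"] K by (simp add: p_def)
    also have "\<dots> = (\<Sum>k=1..K. (d k \<omega>)\<^sup>2) / K" by (simp add: sum_divide_distrib)
    also have "(\<Sum>k=1..K. (d k \<omega>)\<^sup>2) \<le> (\<Sum>k=1..K. 2 * ((g (2 * k - 1) \<omega> - mean \<omega>)\<^sup>2 + (g (2 * k) \<omega> - mean \<omega>)\<^sup>2))"
    proof (rule sum_mono)
      fix k
      have "(u - v)\<^sup>2 \<le> 2 * ((u - w)\<^sup>2 + (v - w)\<^sup>2)" for u v w :: real
      proof -
        have "0 \<le> ((u - w) + (v - w))\<^sup>2" by simp
        then show ?thesis by (simp add: power2_eq_square algebra_simps)
      qed
      then show "(d k \<omega>)\<^sup>2 \<le> 2 * ((g (2 * k - 1) \<omega> - mean \<omega>)\<^sup>2 + (g (2 * k) \<omega> - mean \<omega>)\<^sup>2)"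
        by (simp add: d_def)
    qed
    also have "\<dots> = 2 * ((\<Sum>k=1..K. (g (2 * k - 1) \<omega> - mean \<omega>)\<^sup>2) + (\<Sum>k=1..K. (g (2 * k) \<omega> - mean \<omega>)\<^sup>2))"
      by (simp add: sum.distrib sum_distrib_left)
    also have "(\<Sum>k=1..K. (g (2 * k - 1) \<omega> - mean \<omega>)\<^sup>2) = (\<Sum>j\<in>(\<lambda>k. 2 * k - 1) ` {1..K}. (g j \<omega> - mean \<omega>)\<^sup>2)"
      by (subst sum.reindex) (auto simp: inj_on_def)
    also have "(\<Sum>k=1..K. (g (2 * k) \<omega> - mean \<omega>)\<^sup>2) = (\<Sum>j\<in>(\<lambda>k. 2 * k) ` {1..K}. (g j \<omega> - mean \<omega>)\<^sup>2)"
      by (subst sum.reindex) (auto simp: inj_on_def)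
    also have "(\<Sum>j\<in>(\<lambda>k. 2 * k - 1) ` {1..K}. (g j \<omega> - mean \<omega>)\<^sup>2) + (\<Sum>j\<in>(\<lambda>k. 2 * k) ` {1..K}. (g j \<omega> - mean \<omega>)\<^sup>2)
       = (\<Sum>j\<in>(\<lambda>k. 2 * k - 1) ` {1..K} \<union> (\<lambda>k. 2 * k) ` {1..K}. (g j \<omega> - mean \<omega>)\<^sup>2)"
    proof (subst sum.union_disjoint)
      show "(\<lambda>k. 2 * k - 1) ` {1..K} \<inter> (\<lambda>k. 2 * k) ` {1..K} = {}"
      proof (rule ccontr)
        assume "(\<lambda>k. 2 * k - 1) ` {1..K} \<inter> (\<lambda>k. 2 * k) ` {1..K} \<noteq> {}"
        then obtain k k' :: nat where "1 \<le> k" "2 * k - 1 = 2 * k'" by auto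
        then show False by presburger
      qed
    qed auto
    also have "\<dots> \<le> (\<Sum>j=1..m. (g j \<omega> - mean \<omega>)\<^sup>2)"
      using mem by (intro sum_mono2) auto
    also have "\<dots> = var \<omega> * (real m - 1)" using m1 by (simp add: var_def)
    finally have "p \<le> 2 * (var \<omega> * (real m - 1)) / K" using K by (simp add: divide_right_mono)
    then have "p * K \<le> 2 * var \<omega> * (real m - 1)" using K by (simp add: field_simps)
    moreover have v0: "0 \<le> var \<omega>" using m1 by (simp add: var_def sum_nonneg)
    then have "2 * var \<omega> * (real m - 1) \<le> 2 * var \<omega> * (2 * K)"
      using K by (intro mult_left_mono) auto
    ultimately have "p * K \<le> 2 * var \<omega> * (2 * K)" by (rule order_trans)
    then have "p * K \<le> 4 * var \<omega> * K" by simp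
    then have pv: "p \<le> 4 * var \<omega>" using K by simp
    then have vpos: "0 < var \<omega>" using ppos by linarith
    have "p ^ 4 \<le> 256 * var \<omega> ^ 4"
      using power_mono[OF pv, of 4] ppos by (simp add: power_mult_distrib)
    then have "1 / var \<omega> ^ 4 \<le> 256 * (1 / p ^ 4)"
      using vpos ppos by (simp add: field_simps)
    also have "1 / p ^ 4 = P \<omega>"
    proof -
      have "p = (\<Prod>k=1..K. \<bar>d k \<omega>\<bar> powr (2 / K))"
      proof -
        have "((d k \<omega>)\<^sup>2) powr (1 / K) = \<bar>d k \<omega>\<bar> powr (2 / K)" if "k \<in> {1..K}" for k
        proof -
          have "0 < \<bar>d k \<omega>\<bar>" using nz that by simp
          then have "(d k \<omega>)\<^sup>2 = \<bar>d k \<omega>\<bar> powr 2" by (simp add: powr_numeral)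
          then show ?thesis by (simp only: powr_powr) simp
        qed
        then show ?thesis
          unfolding p_def by (subst prod_powr_distrib) (auto intro: prod.cong)
      qed
      then have "1 / p ^ 4 = (\<Prod>k=1..K. 1 / (\<bar>d k \<omega>\<bar> powr (2 / K)) ^ 4)"
        by (simp add: prod_dividef prod_power_distrib)
      also have "\<dots> = P \<omega>"
        unfolding P_def
      proof (intro prod.cong refl)
        fix k assume "k \<in> {1..K}"
        then have "d k \<omega> \<noteq> 0" using nz by auto
        then have "(\<bar>d k \<omega>\<bar> powr (2 / K)) ^ 4 = \<bar>d k \<omega>\<bar> powr (8 / K)"
          by (simp add: powr_power)
        then show "1 / (\<bar>d k \<omega>\<bar> powr (2 / K)) ^ 4 = \<bar>d k \<omega>\<bar> powr (- (8 / K))"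
          by (simp add: powr_minus_divide)
      qed
      finally show ?thesis .
    qed
    finally show ?thesis using vpos by simp
  qed
  show "AE \<omega> in M. 0 < var \<omega>" using AE_d by eventually_elim (use lower in auto)
  \<comment> \<open>By independence the mean factorises. Interpolation with a = 8 / K and the
    constant 5 of \<open>nn_integral_inverse_sqrt_normal\<close> bound each factor by 1 + 80 / K
    \<le> exp (80 / K); K factors give exp 80.\<close>
  have EP: "(\<integral>\<^sup>+\<omega>. ennreal (P \<omega>) \<partial>M) \<le> ennreal (exp 80)"
  proof -
    have "(\<integral>\<^sup>+\<omega>. ennreal (P \<omega>) \<partial>M) = (\<integral>\<^sup>+\<omega>. (\<Prod>k=1..K. ennreal (\<bar>d k \<omega>\<bar> powr (- (8 / K)))) \<partial>M)"
      by (simp add: P_def prod_ennreal)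
    also have "\<dots> = (\<Prod>k=1..K. \<integral>\<^sup>+\<omega>. ennreal (\<bar>d k \<omega>\<bar> powr (- (8 / K))) \<partial>M)"
    proof (rule indep_vars_nn_integral)
      show "indep_vars (\<lambda>_. borel) (\<lambda>k \<omega>. ennreal (\<bar>d k \<omega>\<bar> powr (- (8 / K)))) {1..K}"
        by (rule indep_vars_compose2[OF ind_d]) measurable
    qed auto
    also have "\<dots> \<le> (\<Prod>k=1..K. ennreal (exp (80 / K)))"
    proof (rule prod_mono_ennreal)
      fix k assume k: "k \<in> {1..K}"
      have Eh: "(\<integral>\<^sup>+\<omega>. ennreal (\<bar>d k \<omega>\<bar> powr (-1/2)) \<partial>M) \<le> ennreal 5"
      proof -
        have "(\<integral>\<^sup>+\<omega>. ennreal (\<bar>d k \<omega>\<bar> powr (-1/2)) \<partial>M) = (\<integral>\<^sup>+x. ennreal (\<bar>x\<bar> powr (-1/2)) \<partial>distr M lborel (d k))"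
          using k by (subst nn_integral_distr) auto
        also have "\<dots> = (\<integral>\<^sup>+x. ennreal (normal_density 0 (sqrt 2) x) * ennreal (\<bar>x\<bar> powr (-1/2)) \<partial>lborel)"
          using dist_d[OF k] by (simp add: distributed_def nn_integral_density)
        also have "\<dots> \<le> ennreal 5"
          using nn_integral_inverse_sqrt_normal[of "sqrt 2"] by (simp add: ennreal_mult)
        finally show ?thesis .
      qed
      have "(\<integral>\<^sup>+\<omega>. ennreal (\<bar>d k \<omega>\<bar> powr (- (8 / K))) \<partial>M) \<le>
        (\<integral>\<^sup>+\<omega>. 1 + ennreal (16 / K) * ennreal (\<bar>d k \<omega>\<bar> powr (-1/2)) \<partial>M)"
      proof (rule nn_integral_mono_AE)
        show "AE \<omega> in M. ennreal (\<bar>d k \<omega>\<bar> powr (- (8 / K))) \<le> 1 + ennreal (16 / K) * ennreal (\<bar>d k \<omega>\<bar> powr (-1/2))"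
          using AE_d
        proof eventually_elim
          case (elim \<omega>)
          then have "0 < \<bar>d k \<omega>\<bar>" using k by simp
          then have "\<bar>d k \<omega>\<bar> powr (- (8 / K)) \<le> 1 + 2 * (8 / K) * \<bar>d k \<omega>\<bar> powr (-1/2)"
            using K by (intro powr_neg_le_convex_combination) (auto simp: field_simps)
          then show ?case by (simp flip: ennreal_1 ennreal_mult ennreal_plus)
        qed
      qed
      also have "\<dots> = 1 + ennreal (16 / K) * (\<integral>\<^sup>+\<omega>. ennreal (\<bar>d k \<omega>\<bar> powr (-1/2)) \<partial>M)"
        using k by (subst nn_integral_add) (auto simp: nn_integral_cmult emeasure_space_1)
      also have "\<dots> \<le> 1 + ennreal (16 / K) * ennreal 5"
        by (intro add_left_mono mult_left_mono Eh) auto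
      also have "\<dots> = ennreal (1 + 80 / K)"
        using ennreal_plus[of 1 "80 / K"] ennreal_mult[of "16 / K" 5] by simp
      also have "\<dots> \<le> ennreal (exp (80 / K))"
        by (intro ennreal_leI exp_ge_add_one_self)
      finally show "(\<integral>\<^sup>+\<omega>. ennreal (\<bar>d k \<omega>\<bar> powr (- (8 / K))) \<partial>M) \<le> ennreal (exp (80 / K))" .
    qed
    also have "\<dots> = ennreal (exp 80)"
      using K by (simp add: prod_ennreal exp_of_nat_mult[symmetric] ennreal_power)
    finally show ?thesis .
  qed
  define S where "S \<omega> = (\<Sum>j=1..m. g j \<omega>)" for \<omega>
  have [measurable]: "S \<in> borel_measurable M" unfolding S_def[abs_def] by measurable
  have "distributed M lborel S (normal_density (\<Sum>j=1..m. 0) (sqrt (\<Sum>j=1..m. 1\<^sup>2)))"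
    unfolding S_def[abs_def] using m by (intro sum_indep_normal ind nd) auto
  then have S: "distr M borel S = centered_normal m"
    using m by (subst centered_normal_iff_distributed) auto
  have ES: "(\<integral>\<omega>. S \<omega> ^ 8 \<partial>M) = 105 * real m ^ 4" and iS: "integrable M (\<lambda>\<omega>. S \<omega> ^ 8)"
    using centered_normal_moments(3)[OF _ _ S] centered_normal_integrable_power[OF _ _ S] by auto
  have EU: "(\<integral>\<^sup>+\<omega>. ennreal (S \<omega> ^ 8 / real m ^ 4) \<partial>M) = ennreal 105"
  proof -
    have "(\<integral>\<^sup>+\<omega>. ennreal (S \<omega> ^ 8 / real m ^ 4) \<partial>M) = ennreal (\<integral>\<omega>. S \<omega> ^ 8 / real m ^ 4 \<partial>M)"
      using iS by (intro nn_integral_eq_integral) (auto intro!: AE_I2 divide_nonneg_nonneg zero_le_even_power)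
    also have "(\<integral>\<omega>. S \<omega> ^ 8 / real m ^ 4 \<partial>M) = 105" using m by (simp add: ES)
    finally show ?thesis .
  qed
  have "(\<integral>\<^sup>+\<omega>. ennreal ((m * (mean \<omega>)\<^sup>2 / var \<omega>)\<^sup>2) \<partial>M) \<le>
    (\<integral>\<^sup>+\<omega>. ennreal (1/2) * (ennreal (S \<omega> ^ 8 / real m ^ 4) + ennreal 256 * ennreal (P \<omega>)) \<partial>M)"
  proof (rule nn_integral_mono_AE)
    show "AE \<omega> in M. ennreal ((m * (mean \<omega>)\<^sup>2 / var \<omega>)\<^sup>2) \<le>
       ennreal (1/2) * (ennreal (S \<omega> ^ 8 / real m ^ 4) + ennreal 256 * ennreal (P \<omega>))"
      using AE_d
    proof eventually_elim
      case (elim \<omega>)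
      have l: "0 < var \<omega>" "1 / var \<omega> ^ 4 \<le> 256 * P \<omega>" using lower[OF elim] by auto
      define U where "U = m * (mean \<omega>)\<^sup>2"
      have U: "U ^ 4 = S \<omega> ^ 8 / real m ^ 4"
        using m by (simp add: U_def mean_def S_def power_mult_distrib power_divide field_simps flip: power_mult)
      have P0: "0 \<le> P \<omega>" unfolding P_def by (intro prod_nonneg) auto
      have "(U / var \<omega>)\<^sup>2 = U\<^sup>2 * (1 / (var \<omega>)\<^sup>2)" by (simp add: power_divide)
      \<comment> \<open>Numerator and denominator are separated by 2 a b \<le> a^2 + b^2. This is
        why an eighth moment and an inverse fourth power appear, and why \<open>tstat_const\<close>
        is divided by 2.\<close>
      also have "\<dots> \<le> ((U\<^sup>2)\<^sup>2 + (1 / (var \<omega>)\<^sup>2)\<^sup>2) / 2"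
        using sum_squares_bound[of "U\<^sup>2" "1 / (var \<omega>)\<^sup>2"] by (simp add: mult.commute)
      also have "\<dots> \<le> 1 / 2 * (S \<omega> ^ 8 / real m ^ 4 + 256 * P \<omega>)"
        using l(2) U by (simp add: power_divide flip: power_mult)
      finally have "ennreal ((U / var \<omega>)\<^sup>2) \<le> ennreal (1 / 2 * (S \<omega> ^ 8 / real m ^ 4 + 256 * P \<omega>))"
        by (rule ennreal_leI)
      also have "\<dots> = ennreal (1 / 2) * (ennreal (S \<omega> ^ 8 / real m ^ 4) + ennreal 256 * ennreal (P \<omega>))"
        using P0 by (subst ennreal_mult, simp, simp, subst ennreal_plus, simp, simp, subst ennreal_mult) auto
      finally show ?case unfolding U_def .
    qed
  qed
  also have "\<dots> = ennreal (1/2) * (ennreal 105 + ennreal 256 * (\<integral>\<^sup>+\<omega>. ennreal (P \<omega>) \<partial>M))"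
    unfolding P_def by (simp add: nn_integral_cmult nn_integral_add EU)
  also have "\<dots> \<le> ennreal (1/2) * (ennreal 105 + ennreal 256 * ennreal (exp 80))"
    by (intro mult_left_mono add_left_mono EP) auto
  also have "\<dots> = ennreal tstat_const"
    unfolding tstat_const_def using ennreal_mult[of "1/2" "105 + 256 * exp 80"] ennreal_plus[of 105 "256 * exp 80"]
      ennreal_mult[of 256 "exp 80"] by simp
  finally show "(\<integral>\<^sup>+\<omega>. ennreal ((m * (mean \<omega>)\<^sup>2 / var \<omega>)\<^sup>2) \<partial>M) \<le> ennreal tstat_const" .
qed

lemma sample_mean_scale: "sample_mean m (\<lambda>j u. y j u / r) t = sample_mean m y t / r"
  by (simp add: sample_mean_def sum_divide_distrib mult.commute)

lemma sample_cov_scale: "sample_cov m (\<lambda>j u. y j u / r) t s = sample_cov m y t s / r\<^sup>2"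
  unfolding sample_cov_def sample_mean_scale
  by (simp add: diff_divide_distrib[symmetric] sum_divide_distrib[symmetric] power2_eq_square)

lemma distr_centered_normal_standardize:
  fixes X :: "'b \<Rightarrow> real"
  assumes c: "0 < c" and X: "X \<in> borel_measurable N" and D: "distr N borel X = centered_normal c"
  shows "distr N borel (\<lambda>\<omega>. X \<omega> / sqrt c) = centered_normal 1"
proof -
  have "distr N borel (\<lambda>\<omega>. X \<omega> / sqrt c) = distr (distr N borel X) borel (\<lambda>x. x / sqrt c)"
    using X by (subst distr_distr) (auto simp: comp_def)
  also have "\<dots> = distr std_normal_distribution borel (\<lambda>x. x)"
    using c unfolding D centered_normal_eq_distr[OF less_imp_le[OF c]]
    by (subst distr_distr) (auto simp: comp_def)
  also have "\<dots> = centered_normal 1"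
    by (simp add: centered_normal_eq_distr)
  finally show ?thesis .
qed

text \<open>The t-statistic is invariant under scaling, so division by sqrt c reduces to the
  standard case, with a bound free of c. If c = 0, all observations vanish almost surely and the
  quotient is 0 / 0 = 0; this covers times at which the covariance estimated from the data is
  degenerate.\<close>

lemma (in prob_space)
  fixes X :: "nat \<Rightarrow> 'a \<Rightarrow> real \<Rightarrow> real" and t :: real
  assumes m: "33 \<le> m" and ind: "indep_vars (\<lambda>_. borel) (\<lambda>j \<omega>. X j \<omega> t) {1..m}"
    and c: "0 \<le> c" and D: "\<And>j. j \<in> {1..m} \<Longrightarrow> distr M borel (\<lambda>\<omega>. X j \<omega> t) = centered_normal c"
  shows tstat_denominator: "AE \<omega> in M. sample_cov m (\<lambda>j. X j \<omega>) t t = 0 \<longrightarrow> sample_mean m (\<lambda>j. X j \<omega>) t = 0"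
    and tstat_moment: "(\<integral>\<^sup>+\<omega>. ennreal ((m * (sample_mean m (\<lambda>j. X j \<omega>) t)\<^sup>2 / sample_cov m (\<lambda>j. X j \<omega>) t t)\<^sup>2) \<partial>M)
       \<le> ennreal tstat_const"
proof -
  note rv = indep_vars_rv[OF ind]
  have "(AE \<omega> in M. sample_cov m (\<lambda>j. X j \<omega>) t t = 0 \<longrightarrow> sample_mean m (\<lambda>j. X j \<omega>) t = 0) \<and>
    (\<integral>\<^sup>+\<omega>. ennreal ((m * (sample_mean m (\<lambda>j. X j \<omega>) t)\<^sup>2 / sample_cov m (\<lambda>j. X j \<omega>) t t)\<^sup>2) \<partial>M)
       \<le> ennreal tstat_const"
  proof (cases "c = 0")
    case True
    have "AE \<omega> in M. X j \<omega> t = 0" if "j \<in> {1..m}" for j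
    proof -
      have "AE x in distr M borel (\<lambda>\<omega>. X j \<omega> t). x = 0"
        unfolding D[OF that] True centered_normal_def if_P[OF refl] by (subst AE_return) auto
      then show ?thesis using rv[OF that] by (subst (asm) AE_distr_iff) auto
    qed
    then have "AE \<omega> in M. \<forall>j\<in>{1..m}. X j \<omega> t = 0" by (intro AE_finite_allI) auto
    then have AE0: "AE \<omega> in M. sample_mean m (\<lambda>j. X j \<omega>) t = 0"
      by eventually_elim (simp add: sample_mean_def)
    have "(\<integral>\<^sup>+\<omega>. ennreal ((m * (sample_mean m (\<lambda>j. X j \<omega>) t)\<^sup>2 / sample_cov m (\<lambda>j. X j \<omega>) t t)\<^sup>2) \<partial>M) = (\<integral>\<^sup>+\<omega>. 0 \<partial>M)"
    proof (rule nn_integral_cong_AE)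
      show "AE \<omega> in M. ennreal ((m * (sample_mean m (\<lambda>j. X j \<omega>) t)\<^sup>2 / sample_cov m (\<lambda>j. X j \<omega>) t t)\<^sup>2) = 0"
        using AE0 by eventually_elim simp
    qed
    moreover have "AE \<omega> in M. sample_cov m (\<lambda>j. X j \<omega>) t t = 0 \<longrightarrow> sample_mean m (\<lambda>j. X j \<omega>) t = 0"
      using AE0 by eventually_elim simp
    ultimately show ?thesis by simp
  next
    case False
    then have c0: "0 < c" using c by simp
    define g where "g j \<omega> = X j \<omega> t / sqrt c" for j \<omega>
    have ind_g: "indep_vars (\<lambda>_. borel) g {1..m}"
      unfolding g_def[abs_def] by (rule indep_vars_compose2[OF ind]) measurable
    have D_g: "distr M borel (g j) = centered_normal 1" if "j \<in> {1..m}" for j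
      unfolding g_def[abs_def] using that by (intro distr_centered_normal_standardize c0 rv D)
    define y where "y \<omega> = (\<lambda>j u. X j \<omega> u / sqrt c)" for \<omega>
    have mean: "(\<Sum>j=1..m. g j \<omega>) / m = sample_mean m (y \<omega>) t" for \<omega>
      by (simp add: g_def y_def sample_mean_def)
    have var: "(\<Sum>j=1..m. (g j \<omega> - sample_mean m (y \<omega>) t)\<^sup>2) / (real m - 1) = sample_cov m (y \<omega>) t t" for \<omega>
      by (simp add: g_def y_def sample_cov_def power2_eq_square)
    note T = tstat_standard_moment[OF m ind_g D_g, unfolded mean var]
    have smean: "sample_mean m (y \<omega>) t = sample_mean m (\<lambda>j. X j \<omega>) t / sqrt c" for \<omega>
      unfolding y_def by (rule sample_mean_scale)
    have scov: "sample_cov m (y \<omega>) t t = sample_cov m (\<lambda>j. X j \<omega>) t t / c" for \<omega>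
      unfolding y_def sample_cov_scale using c0 by simp
    have ratio: "m * (sample_mean m (y \<omega>) t)\<^sup>2 / sample_cov m (y \<omega>) t t =
       m * (sample_mean m (\<lambda>j. X j \<omega>) t)\<^sup>2 / sample_cov m (\<lambda>j. X j \<omega>) t t" for \<omega>
      unfolding smean scov using c0 by (simp add: power_divide)
    have "AE \<omega> in M. 0 < sample_cov m (\<lambda>j. X j \<omega>) t t"
      using T(1) c0 unfolding scov by (simp add: zero_less_divide_iff)
    then have "AE \<omega> in M. sample_cov m (\<lambda>j. X j \<omega>) t t = 0 \<longrightarrow> sample_mean m (\<lambda>j. X j \<omega>) t = 0"
      by eventually_elim simp
    then show ?thesis using T(2) unfolding ratio by simp
  qed
  then show "AE \<omega> in M. sample_cov m (\<lambda>j. X j \<omega>) t t = 0 \<longrightarrow> sample_mean m (\<lambda>j. X j \<omega>) t = 0"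
    and "(\<integral>\<^sup>+\<omega>. ennreal ((m * (sample_mean m (\<lambda>j. X j \<omega>) t)\<^sup>2 / sample_cov m (\<lambda>j. X j \<omega>) t t)\<^sup>2) \<partial>M)
       \<le> ennreal tstat_const" by auto
qed

text \<open>The bound of \<open>sample_cov_L1\<close> for standard normal observations at equal
  times: \<open>D\<close> is the chi-square law with one degree of freedom, its mean is 1, and
  \<alpha> = \<beta> = 1.\<close>

definition var_rate :: "nat \<Rightarrow> real" where
  "var_rate m = 2 * wlln_rate (distr std_normal_distribution borel (\<lambda>x. x\<^sup>2)) m + 2 / (real m - 1)"

lemma var_rate_tendsto: "var_rate \<longlonglongrightarrow> 0"
proof -
  have "wlln_rate (distr std_normal_distribution borel (\<lambda>x. x\<^sup>2)) \<longlonglongrightarrow> 0"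
    by (rule wlln_rate_tendsto) (auto simp: integrable_distr_eq integrable_std_normal_distribution_moment)
  moreover have "(\<lambda>m. 2 / (real m - 1)) \<longlonglongrightarrow> 0"
  proof (rule LIMSEQ_imp_Suc)
    show "(\<lambda>n. 2 / (real (Suc n) - 1)) \<longlonglongrightarrow> 0" using lim_const_over_n[of 2] by simp
  qed
  ultimately have "(\<lambda>m. 2 * wlln_rate (distr std_normal_distribution borel (\<lambda>x. x\<^sup>2)) m + 2 / (real m - 1)) \<longlonglongrightarrow> 2 * 0 + 0"
    by (intro tendsto_intros)
  then show ?thesis by (simp add: var_rate_def[abs_def])
qed

text \<open>After standardisation the law of the relative error depends on m only. The same rate
  therefore serves every time, every group and every realisation of the data with positive
  variance.\<close>

lemma (in prob_space)
  fixes X :: "nat \<Rightarrow> 'a \<Rightarrow> real \<Rightarrow> real" and t :: real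
  assumes m: "2 \<le> m" and ind: "indep_vars (\<lambda>_. borel) (\<lambda>j \<omega>. X j \<omega> t) {1..m}"
    and c: "0 < c" and D: "\<And>j. j \<in> {1..m} \<Longrightarrow> distr M borel (\<lambda>\<omega>. X j \<omega> t) = centered_normal c"
  shows gaussian_sample_var_integrable: "integrable M (\<lambda>\<omega>. sample_cov m (\<lambda>j. X j \<omega>) t t)"
    and gaussian_sample_var_L1: "expectation (\<lambda>\<omega>. \<bar>sample_cov m (\<lambda>j. X j \<omega>) t t / c - 1\<bar>) \<le> var_rate m"
proof -
  note rv = indep_vars_rv[OF ind]
  define Y where "Y = (\<lambda>j \<omega> u. X j \<omega> u / sqrt c)"
  have rvY: "(\<lambda>\<omega>. Y j \<omega> t) \<in> borel_measurable M" if "j \<in> {1..m}" for j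
    using rv[OF that] by (simp add: Y_def)
  have ind_Y: "indep_vars (\<lambda>_. borel) (\<lambda>j \<omega>. Y j \<omega> t) {1..m}"
    unfolding Y_def by (rule indep_vars_compose2[OF ind]) measurable
  have D_Y: "distr M borel (\<lambda>\<omega>. Y j \<omega> t) = centered_normal 1" if "j \<in> {1..m}" for j
    unfolding Y_def using that by (intro distr_centered_normal_standardize c rv D)
  have ind_YY: "indep_vars (\<lambda>_. borel) (\<lambda>j \<omega>. Y j \<omega> t * Y j \<omega> t) {1..m}"
    by (rule indep_vars_compose2[OF ind_Y]) measurable
  let ?D = "distr std_normal_distribution borel (\<lambda>x. x\<^sup>2)"
  have D_YY: "distr M borel (\<lambda>\<omega>. Y j \<omega> t * Y j \<omega> t) = ?D" if "j \<in> {1..m}" for j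
  proof -
    have "distr M borel (\<lambda>\<omega>. Y j \<omega> t * Y j \<omega> t) = distr (distr M borel (\<lambda>\<omega>. Y j \<omega> t)) borel (\<lambda>x. x\<^sup>2)"
      using rvY[OF that] by (subst distr_distr) (auto simp: comp_def power2_eq_square)
    also have "\<dots> = ?D"
      unfolding D_Y[OF that] by (simp add: centered_normal_eq_distr distr_distr comp_def)
    finally show ?thesis .
  qed
  have ED: "(\<integral>x. x \<partial>?D) = 1"
    using std_normal_distribution_even_moments(1)[of 1] by (simp add: integral_distr)
  note M = centered_normal_moments[OF zero_le_one rvY D_Y] centered_normal_mean[OF zero_le_one rvY D_Y]
    centered_normal_integrable_power[OF zero_le_one rvY D_Y]
  note ass = m ind_Y ind_Y ind_YY M(5) M(5) M(4) M(4) M(1) M(1) D_YY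
  have scov: "sample_cov m (\<lambda>j. Y j \<omega>) t t = sample_cov m (\<lambda>j. X j \<omega>) t t / c" for \<omega>
    unfolding Y_def sample_cov_scale using c by simp
  have "integrable M (\<lambda>\<omega>. sample_cov m (\<lambda>j. Y j \<omega>) t t)"
    using sample_cov_L1_integrable[of m Y t "\<lambda>_. 0" t, unfolded diff_zero, OF ass] by simp
  then have "integrable M (\<lambda>\<omega>. c * (sample_cov m (\<lambda>j. X j \<omega>) t t / c))"
    unfolding scov by (rule integrable_mult_right)
  then show "integrable M (\<lambda>\<omega>. sample_cov m (\<lambda>j. X j \<omega>) t t)"
    using c by simp
  show "expectation (\<lambda>\<omega>. \<bar>sample_cov m (\<lambda>j. X j \<omega>) t t / c - 1\<bar>) \<le> var_rate m"
    using sample_cov_L1[of m Y t "\<lambda>_. 0" t, unfolded diff_zero, OF ass]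
    unfolding scov ED by (simp add: var_rate_def)
qed

subsection \<open>Weak convergence of integrals over time\<close>

text \<open>The ramp functions that test weak convergence clamp an affine function to [0, 1]. Their
  Lipschitz constant converts a mean error of the time integral into an error of the test.\<close>

lemma abs_cts_step_diff_le:
  assumes "x < y"
  shows "\<bar>cts_step x y u - cts_step x y v\<bar> \<le> \<bar>u - v\<bar> / (y - x)"
proof -
  have "cts_step x y w = max 0 (min 1 ((y - w) / (y - x)))" for w
    using assms by (auto simp: cts_step_def max_def min_def field_simps)
  then have "\<bar>cts_step x y u - cts_step x y v\<bar> \<le> \<bar>(y - u) / (y - x) - (y - v) / (y - x)\<bar>"
    by (simp add: max_def min_def)
  also have "\<dots> = \<bar>u - v\<bar> / (y - x)"
    using assms by (simp add: diff_divide_distrib[symmetric] abs_minus_commute)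
  finally show ?thesis .
qed

lemma (in prob_space) expectation_polynomial_approx:
  fixes h W :: "_ \<Rightarrow> real"
  assumes W[measurable]: "W \<in> borel_measurable M" and b: "\<And>\<omega>. \<omega> \<in> space M \<Longrightarrow> W \<omega> \<in> {0..B}"
    and h[measurable]: "h \<in> borel_measurable borel" and hb: "\<And>x. \<bar>h x\<bar> \<le> 1"
    and approx: "\<And>x. x \<in> {0..B} \<Longrightarrow> \<bar>h x - (\<Sum>i\<le>n. a i * x ^ i)\<bar> < e"
  shows "\<bar>expectation (\<lambda>\<omega>. h (W \<omega>)) - (\<Sum>i\<le>n. a i * expectation (\<lambda>\<omega>. W \<omega> ^ i))\<bar> \<le> e"
proof -
  have pow: "integrable M (\<lambda>\<omega>. W \<omega> ^ p)" for p
    using b by (intro integrable_const_bound[of _ "B ^ p"] AE_I2) (auto intro!: power_mono)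
  have ig: "integrable M (\<lambda>\<omega>. \<Sum>i\<le>n. a i * W \<omega> ^ i)" using pow by simp
  have ih: "integrable M (\<lambda>\<omega>. h (W \<omega>))"
    by (rule integrable_const_bound[of _ 1]) (auto simp: hb)
  have "\<bar>expectation (\<lambda>\<omega>. h (W \<omega>)) - (\<Sum>i\<le>n. a i * expectation (\<lambda>\<omega>. W \<omega> ^ i))\<bar> =
      \<bar>expectation (\<lambda>\<omega>. h (W \<omega>) - (\<Sum>i\<le>n. a i * W \<omega> ^ i))\<bar>"
    using ig ih pow by simp
  also have "\<dots> \<le> expectation (\<lambda>\<omega>. \<bar>h (W \<omega>) - (\<Sum>i\<le>n. a i * W \<omega> ^ i)\<bar>)" by (rule integral_abs_bound)
  also have "\<dots> \<le> e"
    using ig ih approx[OF b] by (intro integral_le_const AE_I2) (auto intro: less_imp_le)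
  finally show ?thesis .
qed

text \<open>On a bounded interval convergence of moments is enough: by Weierstrass a continuous test
  function is uniformly within e / 3 of a polynomial there, and the means of polynomials
  converge.\<close>

lemma polynomial_moments_tendsto:
  fixes h :: "real \<Rightarrow> real" and V :: "nat \<Rightarrow> 'b \<Rightarrow> real" and V0 :: "'c \<Rightarrow> real"
  assumes N: "\<And>l. prob_space (N l)" and N0: "prob_space N0"
    and V: "\<And>l. V l \<in> borel_measurable (N l)" and V0: "V0 \<in> borel_measurable N0"
    and bV: "\<And>l \<omega>. \<omega> \<in> space (N l) \<Longrightarrow> V l \<omega> \<in> {0..B}" and bV0: "\<And>\<omega>. \<omega> \<in> space N0 \<Longrightarrow> V0 \<omega> \<in> {0..B}"
    and mom: "\<And>p. (\<lambda>l. \<integral>\<omega>. V l \<omega> ^ p \<partial>N l) \<longlonglongrightarrow> (\<integral>\<omega>. V0 \<omega> ^ p \<partial>N0)"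
    and h: "continuous_on UNIV h" and hb: "\<And>x. \<bar>h x\<bar> \<le> 1"
  shows "(\<lambda>l. \<integral>\<omega>. h (V l \<omega>) \<partial>N l) \<longlonglongrightarrow> (\<integral>\<omega>. h (V0 \<omega>) \<partial>N0)"
proof (rule LIMSEQ_I)
  fix e :: real assume e: "0 < e"
  obtain g where g: "real_polynomial_function g" "\<And>x. x \<in> {0..B} \<Longrightarrow> \<bar>h x - g x\<bar> < e / 3"
    using Stone_Weierstrass_real_polynomial_function[of "{0..B}" h "e / 3"] e h
    by (metis compact_Icc continuous_on_subset subset_UNIV divide_pos_pos zero_less_numeral)
  then obtain a n where gs: "g = (\<lambda>x. \<Sum>i\<le>n. a i * x ^ i)"
    by (auto simp: real_polynomial_function_iff_sum)
  have [measurable]: "h \<in> borel_measurable borel" by (rule borel_measurable_continuous_onI[OF h])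
  have approx: "\<bar>h x - (\<Sum>i\<le>n. a i * x ^ i)\<bar> < e / 3" if "x \<in> {0..B}" for x
    using g(2)[OF that] by (simp add: gs)
  have "(\<lambda>l. \<Sum>i\<le>n. a i * (\<integral>\<omega>. V l \<omega> ^ i \<partial>N l)) \<longlonglongrightarrow> (\<Sum>i\<le>n. a i * (\<integral>\<omega>. V0 \<omega> ^ i \<partial>N0))"
    by (intro tendsto_intros mom)
  then obtain l0 where l0: "\<And>l. l \<ge> l0 \<Longrightarrow> norm ((\<Sum>i\<le>n. a i * (\<integral>\<omega>. V l \<omega> ^ i \<partial>N l)) - (\<Sum>i\<le>n. a i * (\<integral>\<omega>. V0 \<omega> ^ i \<partial>N0))) < e / 3"
    using LIMSEQ_D[of "\<lambda>l. \<Sum>i\<le>n. a i * (\<integral>\<omega>. V l \<omega> ^ i \<partial>N l)" _ "e / 3"] e by auto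
  show "\<exists>l0. \<forall>l\<ge>l0. norm ((\<integral>\<omega>. h (V l \<omega>) \<partial>N l) - (\<integral>\<omega>. h (V0 \<omega>) \<partial>N0)) < e"
  proof (intro exI allI impI)
    fix l assume "l \<ge> l0"
    have A: "\<bar>(\<integral>\<omega>. h (V l \<omega>) \<partial>N l) - (\<Sum>i\<le>n. a i * (\<integral>\<omega>. V l \<omega> ^ i \<partial>N l))\<bar> \<le> e / 3"
      by (rule prob_space.expectation_polynomial_approx[OF N V bV _ hb approx]) auto
    have B: "\<bar>(\<integral>\<omega>. h (V0 \<omega>) \<partial>N0) - (\<Sum>i\<le>n. a i * (\<integral>\<omega>. V0 \<omega> ^ i \<partial>N0))\<bar> \<le> e / 3"
      by (rule prob_space.expectation_polynomial_approx[OF N0 V0 bV0 _ hb approx]) auto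
    show "norm ((\<integral>\<omega>. h (V l \<omega>) \<partial>N l) - (\<integral>\<omega>. h (V0 \<omega>) \<partial>N0)) < e"
      using A B l0[OF \<open>l \<ge> l0\<close>] unfolding real_norm_def by linarith
  qed
qed

lemma finite_measure_PiM:
  assumes "finite I" "\<And>i. i \<in> I \<Longrightarrow> finite_measure (S i)" "\<And>i. sigma_finite_measure (S i)"
  shows "finite_measure (PiM I S)"
proof (rule finite_measureI)
  interpret product_sigma_finite S using assms(3) by (simp add: product_sigma_finite_def)
  have "emeasure (PiM I S) (space (PiM I S)) = (\<Prod>i\<in>I. emeasure (S i) (space (S i)))"
    unfolding space_PiM by (rule emeasure_PiM) (use assms in auto)
  then show "emeasure (PiM I S) (space (PiM I S)) \<noteq> \<infinity>"
    using assms(1,2) by (simp add: ennreal_prod_eq_top finite_measure.emeasure_finite)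
qed

lemma moment_of_time_integral:
  fixes q :: "'b \<Rightarrow> 's \<Rightarrow> real"
  assumes N: "prob_space N" and S: "finite_measure S"
    and q[measurable]: "(\<lambda>(\<omega>, t). q \<omega> t) \<in> borel_measurable (N \<Otimes>\<^sub>M S)"
    and q0: "\<And>\<omega> t. \<omega> \<in> space N \<Longrightarrow> t \<in> space S \<Longrightarrow> 0 \<le> q \<omega> t" and lam: "0 \<le> lam"
  shows "(\<integral>\<omega>. (\<integral>t. exp (- lam * q \<omega> t) \<partial>S) ^ p \<partial>N) =
    (\<integral>ts. (\<integral>\<omega>. exp (- lam * (\<Sum>j<p. q \<omega> (ts j))) \<partial>N) \<partial>PiM {..<p} (\<lambda>_. S))"
    and "(\<lambda>ts. \<integral>\<omega>. exp (- lam * (\<Sum>j<p. q \<omega> (ts j))) \<partial>N) \<in> borel_measurable (PiM {..<p} (\<lambda>_. S))"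
proof -
  interpret N: prob_space N by fact
  interpret S: finite_measure S by fact
  interpret Pf: product_sigma_finite "\<lambda>_::nat. S" ..
  let ?P = "PiM {..<p} (\<lambda>_. S)"
  interpret P: finite_measure ?P
    by (rule finite_measure_PiM) (auto intro: S.finite_measure_axioms S.sigma_finite_measure_axioms)
  interpret NP: pair_sigma_finite N ?P ..
  interpret NPf: finite_measure "N \<Otimes>\<^sub>M ?P"
    by (rule finite_measure_pair_measure) (rule N.finite_measure_axioms P.finite_measure_axioms)+
  have [measurable]: "(\<lambda>x. q (fst x) (snd x j)) \<in> borel_measurable (N \<Otimes>\<^sub>M ?P)" if "j \<in> {..<p}" for j
  proof -
    have "(\<lambda>x. (fst x, snd x j)) \<in> N \<Otimes>\<^sub>M ?P \<rightarrow>\<^sub>M N \<Otimes>\<^sub>M S"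
      using that by measurable
    from measurable_compose[OF this q] show ?thesis by simp
  qed
  define F where "F x = exp (- lam * (\<Sum>j<p. q (fst x) (snd x j)))" for x
  have F[measurable]: "F \<in> borel_measurable (N \<Otimes>\<^sub>M ?P)"
    unfolding F_def[abs_def] by measurable
  have q0': "0 \<le> (\<Sum>j<p. q \<omega> (ts j))" if "\<omega> \<in> space N" "ts \<in> space ?P" for \<omega> ts
    using that by (intro sum_nonneg q0) (auto simp: space_PiM)
  have intF: "integrable (N \<Otimes>\<^sub>M ?P) F"
  proof (rule NPf.integrable_const_bound[of _ 1])
    show "AE x in N \<Otimes>\<^sub>M ?P. norm (F x) \<le> 1"
      using q0' lam by (intro AE_I2) (auto simp: F_def space_pair_measure)
  qed (rule F)
  have intq: "integrable S (\<lambda>t. exp (- lam * q \<omega> t))" if "\<omega> \<in> space N" for \<omega>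
  proof (rule S.integrable_const_bound[of _ 1])
    show "AE t in S. norm (exp (- lam * q \<omega> t)) \<le> 1"
      using q0[OF that] lam by (intro AE_I2) auto
    show "(\<lambda>t. exp (- lam * q \<omega> t)) \<in> borel_measurable S"
      using measurable_Pair2[OF q that] by simp
  qed
  have "(\<integral>\<omega>. (\<integral>t. exp (- lam * q \<omega> t) \<partial>S) ^ p \<partial>N) = (\<integral>\<omega>. (\<integral>ts. F (\<omega>, ts) \<partial>?P) \<partial>N)"
  proof (rule Bochner_Integration.integral_cong[OF refl])
    fix \<omega> assume \<omega>: "\<omega> \<in> space N"
    have "(\<integral>ts. F (\<omega>, ts) \<partial>?P) = (\<integral>ts. (\<Prod>j<p. exp (- lam * q \<omega> (ts j))) \<partial>?P)"
      by (simp add: F_def exp_sum[symmetric] sum_distrib_left)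
    also have "\<dots> = (\<Prod>j<p. (\<integral>t. exp (- lam * q \<omega> t) \<partial>S))"
      by (rule Pf.product_integral_prod) (use intq[OF \<omega>] in auto)
    finally show "(\<integral>t. exp (- lam * q \<omega> t) \<partial>S) ^ p = (\<integral>ts. F (\<omega>, ts) \<partial>?P)" by simp
  qed
  also have "\<dots> = (\<integral>ts. (\<integral>\<omega>. F (\<omega>, ts) \<partial>N) \<partial>?P)"
    using NP.Fubini_integral[of "\<lambda>\<omega> ts. F (\<omega>, ts)"] intF by simp
  finally show "(\<integral>\<omega>. (\<integral>t. exp (- lam * q \<omega> t) \<partial>S) ^ p \<partial>N) =
    (\<integral>ts. (\<integral>\<omega>. exp (- lam * (\<Sum>j<p. q \<omega> (ts j))) \<partial>N) \<partial>?P)"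
    by (simp add: F_def)
  have "(\<lambda>(ts, \<omega>). F (\<omega>, ts)) \<in> borel_measurable (?P \<Otimes>\<^sub>M N)"
    using measurable_compose[OF measurable_pair_swap' F] by (simp add: case_prod_beta')
  from N.borel_measurable_lebesgue_integral[OF this]
  show "(\<lambda>ts. \<integral>\<omega>. exp (- lam * (\<Sum>j<p. q \<omega> (ts j))) \<partial>N) \<in> borel_measurable ?P"
    by (simp add: F_def)
qed

lemma exp_neg_bounds:
  fixes x lam :: real
  assumes "0 \<le> x" "0 < lam"
  shows "(1 - exp (- lam * x)) / lam \<le> x" and "x - (1 - exp (- lam * x)) / lam \<le> lam / 2 * x\<^sup>2"
proof -
  define y where "y = lam * x"
  have y: "0 \<le> y" using assms by (simp add: y_def)
  have "1 - y \<le> exp (- y)" using exp_ge_add_one_self[of "- y"] by simp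
  then have "1 - exp (- lam * x) \<le> x * lam" by (simp add: y_def mult.commute)
  then show "(1 - exp (- lam * x)) / lam \<le> x" using assms(2) by (simp add: pos_divide_le_eq)
  \<comment> \<open>The product equals 1 + y^4 / 4, so the lower Taylor bound for exp y becomes an
    upper bound for exp (- y).\<close>
  have "1 \<le> (1 - y + y\<^sup>2 / 2) * (1 + y + y\<^sup>2 / 2)"
    using y by (simp add: algebra_simps power2_eq_square)
  also have "\<dots> \<le> (1 - y + y\<^sup>2 / 2) * exp y"
  proof (rule mult_left_mono[OF exp_lower_Taylor_quadratic[OF y]])
    have "0 \<le> (1 - y)\<^sup>2" by simp
    then show "0 \<le> 1 - y + y\<^sup>2 / 2" by (simp add: power2_diff)
  qed
  finally have "exp (- y) \<le> 1 - y + y\<^sup>2 / 2"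
    by (simp add: exp_minus inverse_eq_divide pos_divide_le_eq)
  then have "x * lam - (1 - exp (- lam * x)) \<le> (lam / 2 * x\<^sup>2) * lam"
    by (simp add: y_def power2_eq_square algebra_simps)
  then have "(x * lam - (1 - exp (- lam * x))) / lam \<le> lam / 2 * x\<^sup>2"
    using assms(2) by (simp add: pos_divide_le_eq)
  then show "x - (1 - exp (- lam * x)) / lam \<le> lam / 2 * x\<^sup>2"
    using assms(2) by (simp add: diff_divide_distrib)
qed

text \<open>Replacing q by (1 - exp (- lam q)) / lam lowers the time integral by at most lam / 2
  times the integral of q^2. By Tonelli the mean of the latter is at most C times the measure of the
  time domain, and the Lipschitz constant L carries this over to h.\<close>

lemma laplace_truncation_error:
  fixes q :: "'b \<Rightarrow> 's \<Rightarrow> real" and h :: "real \<Rightarrow> real"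
  assumes N: "prob_space N" and S: "finite_measure S"
    and q[measurable]: "(\<lambda>(\<omega>, t). q \<omega> t) \<in> borel_measurable (N \<Otimes>\<^sub>M S)"
    and q0: "\<And>\<omega> t. \<omega> \<in> space N \<Longrightarrow> t \<in> space S \<Longrightarrow> 0 \<le> q \<omega> t" and lam: "0 < lam"
    and C: "\<And>t. t \<in> space S \<Longrightarrow> (\<integral>\<^sup>+\<omega>. ennreal ((q \<omega> t)\<^sup>2) \<partial>N) \<le> ennreal C" "0 \<le> C"
    and h[measurable]: "h \<in> borel_measurable borel" and hb: "\<And>x. \<bar>h x\<bar> \<le> 1" and L: "\<And>u v. \<bar>h u - h v\<bar> \<le> L * \<bar>u - v\<bar>"
  shows "\<bar>(\<integral>\<omega>. h (\<integral>t. q \<omega> t \<partial>S) \<partial>N) - (\<integral>\<omega>. h ((measure S (space S) - (\<integral>t. exp (- lam * q \<omega> t) \<partial>S)) / lam) \<partial>N)\<bar>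
    \<le> L * (lam / 2 * (C * measure S (space S)))"
proof -
  interpret N: prob_space N by fact
  interpret S: finite_measure S by fact
  interpret NS: pair_sigma_finite N S ..
  define s where "s = measure S (space S)"
  define X where "X \<omega> = (\<integral>t. q \<omega> t \<partial>S)" for \<omega>
  define Xl where "Xl \<omega> = (s - (\<integral>t. exp (- lam * q \<omega> t) \<partial>S)) / lam" for \<omega>
  define Z where "Z \<omega> = (\<integral>t. (q \<omega> t)\<^sup>2 \<partial>S)" for \<omega>
  have L0: "0 \<le> L" using L[of 0 1] by simp
  have qfs[measurable]: "(\<lambda>x. q (fst x) (snd x)) \<in> borel_measurable (N \<Otimes>\<^sub>M S)"
    using q by (simp add: case_prod_beta')
  have [measurable]: "X \<in> borel_measurable N" "Xl \<in> borel_measurable N" "Z \<in> borel_measurable N"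
    unfolding X_def[abs_def] Xl_def[abs_def] Z_def[abs_def] by measurable
  have qt[measurable]: "q \<omega> \<in> borel_measurable S" if "\<omega> \<in> space N" for \<omega>
    using measurable_Pair2[OF q that] by simp
  have "(\<integral>\<^sup>+\<omega>. (\<integral>\<^sup>+t. ennreal ((q \<omega> t)\<^sup>2) \<partial>S) \<partial>N) = (\<integral>\<^sup>+t. (\<integral>\<^sup>+\<omega>. ennreal ((q \<omega> t)\<^sup>2) \<partial>N) \<partial>S)"
    using NS.Fubini'[of "\<lambda>\<omega> t. ennreal ((q \<omega> t)\<^sup>2)"] by simp
  also have "\<dots> \<le> (\<integral>\<^sup>+t. ennreal C \<partial>S)" by (intro nn_integral_mono C)
  also have "\<dots> = ennreal (C * s)"
    using C(2) by (simp add: s_def S.emeasure_eq_measure ennreal_mult)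
  finally have fin: "(\<integral>\<^sup>+\<omega>. (\<integral>\<^sup>+t. ennreal ((q \<omega> t)\<^sup>2) \<partial>S) \<partial>N) \<le> ennreal (C * s)" .
  \<comment> \<open>Single paths of q need not be integrable. By Tonelli they are square-integrable
    outside a null set, which is enough for comparing expectations.\<close>
  have "AE \<omega> in N. (\<integral>\<^sup>+t. ennreal ((q \<omega> t)\<^sup>2) \<partial>S) \<noteq> \<infinity>"
    by (rule nn_integral_noteq_infinite) (use fin in \<open>auto simp: top_unique\<close>)
  then have AEint: "AE \<omega> in N. integrable S (\<lambda>t. (q \<omega> t)\<^sup>2)"
  proof (rule AE_mp, intro AE_I2 impI)
    fix \<omega> assume "\<omega> \<in> space N" and "(\<integral>\<^sup>+t. ennreal ((q \<omega> t)\<^sup>2) \<partial>S) \<noteq> \<infinity>"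
    then show "integrable S (\<lambda>t. (q \<omega> t)\<^sup>2)"
      by (intro integrableI_nonneg) (auto simp: less_top)
  qed
  have "(\<integral>\<^sup>+\<omega>. ennreal (Z \<omega>) \<partial>N) = (\<integral>\<^sup>+\<omega>. (\<integral>\<^sup>+t. ennreal ((q \<omega> t)\<^sup>2) \<partial>S) \<partial>N)"
  proof (rule nn_integral_cong_AE)
    show "AE \<omega> in N. ennreal (Z \<omega>) = (\<integral>\<^sup>+t. ennreal ((q \<omega> t)\<^sup>2) \<partial>S)"
      using AEint by eventually_elim (simp add: Z_def nn_integral_eq_integral)
  qed
  then have Zfin: "(\<integral>\<^sup>+\<omega>. ennreal (Z \<omega>) \<partial>N) \<le> ennreal (C * s)" using fin by simp
  have Z0: "0 \<le> Z \<omega>" for \<omega> by (simp add: Z_def)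
  have iZ: "integrable N Z"
    by (rule integrableI_nonneg) (use Zfin Z0 in \<open>auto intro: le_less_trans\<close>)
  have s0: "0 \<le> s" by (simp add: s_def)
  have "ennreal (\<integral>\<omega>. Z \<omega> \<partial>N) \<le> ennreal (C * s)"
    using Zfin nn_integral_eq_integral[OF iZ] Z0 by simp
  then have EZ: "(\<integral>\<omega>. Z \<omega> \<partial>N) \<le> C * s"
    using C(2) s0 by (subst (asm) ennreal_le_iff) auto
  have "AE \<omega> in N. \<bar>h (X \<omega>) - h (Xl \<omega>)\<bar> \<le> L * (lam / 2 * Z \<omega>)"
    using AEint
  proof (rule AE_mp, intro AE_I2 impI)
    fix \<omega> assume \<omega>: "\<omega> \<in> space N" and i2: "integrable S (\<lambda>t. (q \<omega> t)\<^sup>2)"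
    have i1: "integrable S (q \<omega>)"
      using S.square_integrable_imp_integrable[OF qt[OF \<omega>] i2] .
    have ie: "integrable S (\<lambda>t. exp (- lam * q \<omega> t))"
    proof (rule S.integrable_const_bound[of _ 1])
      show "AE t in S. norm (exp (- lam * q \<omega> t)) \<le> 1"
        using q0[OF \<omega>] lam by (intro AE_I2) auto
    qed (use qt[OF \<omega>] in measurable)
    have "Xl \<omega> = (\<integral>t. (1 - exp (- lam * q \<omega> t)) / lam \<partial>S)"
      using ie by (simp add: Xl_def s_def)
    then have diff: "X \<omega> - Xl \<omega> = (\<integral>t. q \<omega> t - (1 - exp (- lam * q \<omega> t)) / lam \<partial>S)"
      unfolding X_def using i1 ie by simp
    have "0 \<le> X \<omega> - Xl \<omega>"
      unfolding diff using exp_neg_bounds(1)[OF q0[OF \<omega>] lam] by (intro integral_nonneg_AE AE_I2) auto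
    moreover have "X \<omega> - Xl \<omega> \<le> (\<integral>t. lam / 2 * (q \<omega> t)\<^sup>2 \<partial>S)"
      unfolding diff
      by (intro integral_mono exp_neg_bounds(2)[OF q0[OF \<omega>] lam]) (use i1 ie i2 in auto)
    ultimately have "\<bar>X \<omega> - Xl \<omega>\<bar> \<le> lam / 2 * Z \<omega>"
      by (simp add: Z_def)
    then have "L * \<bar>X \<omega> - Xl \<omega>\<bar> \<le> L * (lam / 2 * Z \<omega>)"
      using L0 by (rule mult_left_mono)
    then show "\<bar>h (X \<omega>) - h (Xl \<omega>)\<bar> \<le> L * (lam / 2 * Z \<omega>)"
      using L[of "X \<omega>" "Xl \<omega>"] by linarith
  qed
  then have "(\<integral>\<omega>. \<bar>h (X \<omega>) - h (Xl \<omega>)\<bar> \<partial>N) \<le> (\<integral>\<omega>. L * (lam / 2 * Z \<omega>) \<partial>N)"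
    using iZ by (intro integral_mono_AE')  (auto simp: Z0 L0 less_imp_le[OF lam])
  also have "\<dots> = L * (lam / 2 * (\<integral>\<omega>. Z \<omega> \<partial>N))" by simp
  also have "\<dots> \<le> L * (lam / 2 * (C * s))"
    using EZ L0 lam by (intro mult_left_mono) auto
  finally have "(\<integral>\<omega>. \<bar>h (X \<omega>) - h (Xl \<omega>)\<bar> \<partial>N) \<le> L * (lam / 2 * (C * s))" .
  moreover have ih: "integrable N (\<lambda>\<omega>. h (X \<omega>))" "integrable N (\<lambda>\<omega>. h (Xl \<omega>))"
    by (rule N.integrable_const_bound[of _ 1]; auto simp: hb)+
  have "\<bar>(\<integral>\<omega>. h (X \<omega>) \<partial>N) - (\<integral>\<omega>. h (Xl \<omega>) \<partial>N)\<bar> \<le> (\<integral>\<omega>. \<bar>h (X \<omega>) - h (Xl \<omega>)\<bar> \<partial>N)"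
    using integral_abs_bound[of N "\<lambda>\<omega>. h (X \<omega>) - h (Xl \<omega>)"] ih by simp
  ultimately show ?thesis by (simp add: X_def Xl_def s_def)
qed

lemma time_integral_measurable:
  fixes q :: "'b \<Rightarrow> 's \<Rightarrow> real"
  assumes S: "finite_measure S"
    and q: "(\<lambda>(\<omega>, t). q \<omega> t) \<in> borel_measurable (N \<Otimes>\<^sub>M S)"
  shows "(\<lambda>\<omega>. \<integral>t. q \<omega> t \<partial>S) \<in> borel_measurable N"
proof -
  interpret S: finite_measure S by fact
  show ?thesis by (rule S.borel_measurable_lebesgue_integral[OF q])
qed

text \<open>The order of choices matters: lam is fixed first, making both truncation errors small
  for all large l at once, and only then does l tend to infinity in the exponential moments.
  \<open>C\<close> is an eventual bound because the second moment of a squared t-statistic may be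
  infinite for small samples.\<close>

theorem time_integral_weak_conv:
  fixes q :: "nat \<Rightarrow> 'b \<Rightarrow> 's \<Rightarrow> real" and q0 :: "'c \<Rightarrow> 's \<Rightarrow> real"
  assumes N: "\<And>l. prob_space (N l)" and N0: "prob_space N0" and S: "finite_measure S"
    and q: "\<And>l. (\<lambda>(\<omega>, t). q l \<omega> t) \<in> borel_measurable (N l \<Otimes>\<^sub>M S)"
    and q0: "(\<lambda>(\<omega>, t). q0 \<omega> t) \<in> borel_measurable (N0 \<Otimes>\<^sub>M S)"
    and nonneg: "\<And>l \<omega> t. \<omega> \<in> space (N l) \<Longrightarrow> t \<in> space S \<Longrightarrow> 0 \<le> q l \<omega> t"
    and nonneg0: "\<And>\<omega> t. \<omega> \<in> space N0 \<Longrightarrow> t \<in> space S \<Longrightarrow> 0 \<le> q0 \<omega> t"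
    and C: "\<forall>\<^sub>F l in sequentially. \<forall>t\<in>space S. (\<integral>\<^sup>+\<omega>. ennreal ((q l \<omega> t)\<^sup>2) \<partial>N l) \<le> ennreal C"
    and C0: "\<And>t. t \<in> space S \<Longrightarrow> (\<integral>\<^sup>+\<omega>. ennreal ((q0 \<omega> t)\<^sup>2) \<partial>N0) \<le> ennreal C" and "0 \<le> C"
    and conv: "\<And>lam (p::nat). 0 < lam \<Longrightarrow> AE ts in PiM {..<p} (\<lambda>_. S).
      (\<lambda>l. \<integral>\<omega>. exp (- lam * (\<Sum>j<p. q l \<omega> (ts j))) \<partial>N l) \<longlonglongrightarrow> (\<integral>\<omega>. exp (- lam * (\<Sum>j<p. q0 \<omega> (ts j))) \<partial>N0)"
  shows "weak_conv_m (\<lambda>l. distr (N l) borel (\<lambda>\<omega>. \<integral>t. q l \<omega> t \<partial>S)) (distr N0 borel (\<lambda>\<omega>. \<integral>t. q0 \<omega> t \<partial>S))"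
proof (rule integral_cts_step_conv_imp_weak_conv)
  interpret S: finite_measure S by fact
  interpret N0: prob_space N0 by fact
  interpret N: prob_space "N l" for l by (rule N)
  note X = time_integral_measurable[OF S q] and X0 = time_integral_measurable[OF S q0]
  show "real_distribution (distr (N l) borel (\<lambda>\<omega>. \<integral>t. q l \<omega> t \<partial>S))" for l
    using X by (rule N.real_distribution_distr)
  show "real_distribution (distr N0 borel (\<lambda>\<omega>. \<integral>t. q0 \<omega> t \<partial>S))"
    using X0 by (rule N0.real_distribution_distr)
  fix x y :: real assume xy: "x < y"
  define h where "h = cts_step x y"
  have h01: "0 \<le> h u" "h u \<le> 1" for u using xy by (auto simp: h_def cts_step_def field_simps)
  have hb: "\<bar>h u\<bar> \<le> 1" for u using h01[of u] by simp
  have hcont: "continuous_on UNIV h"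
    unfolding h_def by (intro uniformly_continuous_imp_continuous cts_step_uniformly_continuous xy)
  have [measurable]: "h \<in> borel_measurable borel" by (rule borel_measurable_continuous_onI[OF hcont])
  define L where "L = 1 / (y - x)"
  have L0: "0 < L" using xy by (simp add: L_def)
  have hL: "\<bar>h u - h v\<bar> \<le> L * \<bar>u - v\<bar>" for u v
    using abs_cts_step_diff_le[OF xy, of u v] by (simp add: h_def L_def)
  define s where "s = measure S (space S)"
  have s0: "0 \<le> s" by (simp add: s_def)
  have "(\<lambda>l. \<integral>\<omega>. h (\<integral>t. q l \<omega> t \<partial>S) \<partial>N l) \<longlonglongrightarrow> (\<integral>\<omega>. h (\<integral>t. q0 \<omega> t \<partial>S) \<partial>N0)"
  proof (rule LIMSEQ_I)
    fix e :: real assume e: "0 < e"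
    \<comment> \<open>Chosen so that the truncation error is below e / 3; the summand 1 keeps the
      denominator positive if C or s is 0.\<close>
    define lam where "lam = e / (3 * (L * C * s + 1))"
    have pos: "0 < L * C * s + 1" using L0 \<open>0 \<le> C\<close> s0 by (simp add: add_nonneg_pos)
    have lam: "0 < lam" using e pos by (simp add: lam_def)
    have small: "L * (lam / 2 * (C * s)) < e / 3"
    proof -
      have "L * (lam / 2 * (C * s)) = lam * (L * C * s) / 2" by (simp add: mult_ac)
      also have "\<dots> \<le> lam * (L * C * s)" using lam L0 \<open>0 \<le> C\<close> s0 by simp
      also have "\<dots> < lam * (L * C * s + 1)" using lam by simp
      also have "\<dots> = e / 3"
      proof -
        have "e / (3 * w) * w = e / 3" if "0 < w" for w using that by simp
        from this[OF pos] show ?thesis by (simp only: lam_def)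
      qed
      finally show ?thesis .
    qed
    define V where "V l \<omega> = (\<integral>t. exp (- lam * q l \<omega> t) \<partial>S)" for l \<omega>
    define V0 where "V0 \<omega> = (\<integral>t. exp (- lam * q0 \<omega> t) \<partial>S)" for \<omega>
    have expmeas: "(\<lambda>(\<omega>, t). exp (- lam * r \<omega> t)) \<in> borel_measurable (M \<Otimes>\<^sub>M S)"
      if "(\<lambda>(\<omega>, t). r \<omega> t) \<in> borel_measurable (M \<Otimes>\<^sub>M S)" for r :: "'x \<Rightarrow> 's \<Rightarrow> real" and M
      using that by (simp add: case_prod_beta')
    have Vm[measurable]: "V l \<in> borel_measurable (N l)" for l
      unfolding V_def[abs_def] using q[of l] by (intro time_integral_measurable[OF S]) (simp add: case_prod_beta')
    have V0m[measurable]: "V0 \<in> borel_measurable N0"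
      unfolding V0_def[abs_def] using q0 by (intro time_integral_measurable[OF S]) (simp add: case_prod_beta')
    \<comment> \<open>A Bochner integral that does not exist is 0, which also lies in the interval,
      so the bound holds for every nonnegative \<open>r\<close>.\<close>
    have box: "(\<integral>t. exp (- lam * r t) \<partial>S) \<in> {0..s}" if r: "\<And>t. t \<in> space S \<Longrightarrow> 0 \<le> r t" for r
    proof -
      have "(\<integral>t. exp (- lam * r t) \<partial>S) \<le> s"
      proof (cases "integrable S (\<lambda>t. exp (- lam * r t))")
        case True
        have "(\<integral>t. exp (- lam * r t) \<partial>S) \<le> (\<integral>t. 1 \<partial>S)"
          using True r lam by (intro integral_mono) auto
        then show ?thesis by (simp add: s_def)
      qed (simp add: not_integrable_integral_eq s0)
      then show ?thesis by (simp add: integral_nonneg_AE)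
    qed
    have bV: "V l \<omega> \<in> {0..s}" if "\<omega> \<in> space (N l)" for l \<omega>
      unfolding V_def using nonneg[OF that] by (intro box)
    have bV0: "V0 \<omega> \<in> {0..s}" if "\<omega> \<in> space N0" for \<omega>
      unfolding V0_def using nonneg0[OF that] by (intro box)
    have mom: "(\<lambda>l. \<integral>\<omega>. V l \<omega> ^ p \<partial>N l) \<longlonglongrightarrow> (\<integral>\<omega>. V0 \<omega> ^ p \<partial>N0)" for p
    proof -
      let ?P = "PiM {..<p} (\<lambda>_. S)"
      interpret P: finite_measure ?P
        by (rule finite_measure_PiM) (auto intro: S.finite_measure_axioms S.sigma_finite_measure_axioms)
      note lam0 = less_imp_le[OF lam]
      have m: "(\<integral>\<omega>. V l \<omega> ^ p \<partial>N l) = (\<integral>ts. (\<integral>\<omega>. exp (- lam * (\<Sum>j<p. q l \<omega> (ts j))) \<partial>N l) \<partial>?P)" for l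
        unfolding V_def by (rule moment_of_time_integral(1)[OF N S q nonneg lam0])
      have m0: "(\<integral>\<omega>. V0 \<omega> ^ p \<partial>N0) = (\<integral>ts. (\<integral>\<omega>. exp (- lam * (\<Sum>j<p. q0 \<omega> (ts j))) \<partial>N0) \<partial>?P)"
        unfolding V0_def by (rule moment_of_time_integral(1)[OF N0 S q0 nonneg0 lam0])
      show ?thesis
        unfolding m m0
      proof (rule integral_dominated_convergence[where w = "\<lambda>_. 1"])
        show "AE ts in ?P. norm (\<integral>\<omega>. exp (- lam * (\<Sum>j<p. q l \<omega> (ts j))) \<partial>N l) \<le> 1" for l
        proof (intro AE_I2)
          fix ts assume ts: "ts \<in> space ?P"
          have "(\<integral>\<omega>. exp (- lam * (\<Sum>j<p. q l \<omega> (ts j))) \<partial>N l) \<le> 1"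
          proof (cases "integrable (N l) (\<lambda>\<omega>. exp (- lam * (\<Sum>j<p. q l \<omega> (ts j))))")
            case True
            then show ?thesis
            proof (rule N.integral_le_const, intro AE_I2)
              fix \<omega> assume "\<omega> \<in> space (N l)"
              then have "0 \<le> (\<Sum>j<p. q l \<omega> (ts j))"
                using ts by (intro sum_nonneg nonneg) (auto simp: space_PiM)
              then show "exp (- lam * (\<Sum>j<p. q l \<omega> (ts j))) \<le> 1" using lam by simp
            qed
          qed (simp add: not_integrable_integral_eq)
          then show "norm (\<integral>\<omega>. exp (- lam * (\<Sum>j<p. q l \<omega> (ts j))) \<partial>N l) \<le> 1"
            by (simp add: integral_nonneg_AE)
        qed
        show "AE ts in ?P. (\<lambda>l. \<integral>\<omega>. exp (- lam * (\<Sum>j<p. q l \<omega> (ts j))) \<partial>N l)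
            \<longlonglongrightarrow> (\<integral>\<omega>. exp (- lam * (\<Sum>j<p. q0 \<omega> (ts j))) \<partial>N0)"
          by (rule conv[OF lam])
        show "(\<lambda>ts. \<integral>\<omega>. exp (- lam * (\<Sum>j<p. q l \<omega> (ts j))) \<partial>N l) \<in> borel_measurable ?P" for l
          by (rule moment_of_time_integral(2)[OF N S q nonneg lam0])
        show "(\<lambda>ts. \<integral>\<omega>. exp (- lam * (\<Sum>j<p. q0 \<omega> (ts j))) \<partial>N0) \<in> borel_measurable ?P"
          by (rule moment_of_time_integral(2)[OF N0 S q0 nonneg0 lam0])
      qed simp
    qed
    have "(\<lambda>l. \<integral>\<omega>. h ((s - V l \<omega>) / lam) \<partial>N l) \<longlonglongrightarrow> (\<integral>\<omega>. h ((s - V0 \<omega>) / lam) \<partial>N0)"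
    proof (rule polynomial_moments_tendsto[where h = "\<lambda>v. h ((s - v) / lam)", OF N N0 Vm V0m bV bV0 mom _ hb])
      show "continuous_on UNIV (\<lambda>v. h ((s - v) / lam))"
        using lam by (intro continuous_on_compose2[OF hcont] continuous_intros) auto
    qed
    from tendstoD[OF this, of "e / 3"] e
    have "\<forall>\<^sub>F l in sequentially. \<bar>(\<integral>\<omega>. h ((s - V l \<omega>) / lam) \<partial>N l) - (\<integral>\<omega>. h ((s - V0 \<omega>) / lam) \<partial>N0)\<bar> < e / 3"
      unfolding dist_real_def by (metis divide_pos_pos zero_less_numeral)
    with C have "\<forall>\<^sub>F l in sequentially. norm ((\<integral>\<omega>. h (\<integral>t. q l \<omega> t \<partial>S) \<partial>N l) - (\<integral>\<omega>. h (\<integral>t. q0 \<omega> t \<partial>S) \<partial>N0)) < e"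
    proof eventually_elim
      case (elim l)
      have "\<bar>(\<integral>\<omega>. h (\<integral>t. q l \<omega> t \<partial>S) \<partial>N l) - (\<integral>\<omega>. h ((s - V l \<omega>) / lam) \<partial>N l)\<bar> \<le> L * (lam / 2 * (C * s))"
        unfolding V_def s_def using elim(1)
        by (intro laplace_truncation_error[OF N S q nonneg lam _ \<open>0 \<le> C\<close> _ hb hL]) auto
      moreover have "\<bar>(\<integral>\<omega>. h (\<integral>t. q0 \<omega> t \<partial>S) \<partial>N0) - (\<integral>\<omega>. h ((s - V0 \<omega>) / lam) \<partial>N0)\<bar> \<le> L * (lam / 2 * (C * s))"
        unfolding V0_def s_def
        by (intro laplace_truncation_error[OF N0 S q0 nonneg0 lam C0 \<open>0 \<le> C\<close> _ hb hL]) auto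
      ultimately show ?case using elim(2) small unfolding real_norm_def by linarith
    qed
    then show "\<exists>l0. \<forall>l\<ge>l0. norm ((\<integral>\<omega>. h (\<integral>t. q l \<omega> t \<partial>S) \<partial>N l) - (\<integral>\<omega>. h (\<integral>t. q0 \<omega> t \<partial>S) \<partial>N0)) < e"
      by (simp add: eventually_sequentially)
  qed
  then show "(\<lambda>l. \<integral>u. cts_step x y u \<partial>distr (N l) borel (\<lambda>\<omega>. \<integral>t. q l \<omega> t \<partial>S)) \<longlonglongrightarrow>
     (\<integral>u. cts_step x y u \<partial>distr N0 borel (\<lambda>\<omega>. \<integral>t. q0 \<omega> t \<partial>S))"
    using X X0 by (simp add: integral_distr h_def[symmetric])
qed

subsection \<open>The bootstrap sample\<close>

lemma measurable_process_at:
  assumes "measurable_process N T Z" "t \<in> T"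
  shows "(\<lambda>\<omega>. Z \<omega> t) \<in> borel_measurable N"
  using measurable_Pair1[OF assms(1)[unfolded measurable_process_def], of t] assms(2)
  by (simp add: space_restrict_space)

lemma measurable_process_restrict_lborel:
  assumes "measurable_process N T Z"
  shows "(\<lambda>(\<omega>, t). Z \<omega> t) \<in> borel_measurable (N \<Otimes>\<^sub>M restrict_space lborel T)"
proof -
  have "sets (N \<Otimes>\<^sub>M restrict_space borel T) = sets (N \<Otimes>\<^sub>M restrict_space lborel T)"
    by (intro sets_pair_measure_cong sets_restrict_space_cong) auto
  then show ?thesis
    using assms unfolding measurable_process_def by (simp cong: measurable_cong_sets)
qed

text \<open>The definition of a Gaussian process speaks of sets of times, whereas joint transforms
  use a family \<open>ts\<close> in which times may repeat. Coefficients at equal times are added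
  up, and linearity of \<open>C t s\<close> regroups the variance in the same way.\<close>

lemma gaussian_process_char:
  fixes Z :: "'b \<Rightarrow> real \<Rightarrow> 'e::euclidean_space" and d :: "'a \<Rightarrow> 'e"
  assumes G: "centered_gaussian_process N T C Z" and lin: "\<And>t s. linear (C t s)"
    and A: "finite A" and ts: "\<And>a. a \<in> A \<Longrightarrow> ts a \<in> T"
  defines "v \<equiv> (\<Sum>a\<in>A. \<Sum>b\<in>A. d a \<bullet> C (ts a) (ts b) (d b))"
  shows "0 \<le> v" and "distr N borel (\<lambda>\<omega>. \<Sum>a\<in>A. d a \<bullet> Z \<omega> (ts a)) = centered_normal v"
    and "(\<lambda>\<omega>. \<Sum>a\<in>A. d a \<bullet> Z \<omega> (ts a)) \<in> borel_measurable N"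
    and "(\<integral>\<omega>. iexp (\<Sum>a\<in>A. d a \<bullet> Z \<omega> (ts a)) \<partial>N) = complex_of_real (exp (- v / 2))"
proof -
  define F where "F = ts ` A"
  have F: "finite F" "F \<subseteq> T" using A ts by (auto simp: F_def)
  define c where "c t = (\<Sum>a\<in>{a\<in>A. ts a = t}. d a)" for t
  have grp: "(\<Sum>t\<in>F. \<Sum>a\<in>{a\<in>A. ts a = t}. g a) = (\<Sum>a\<in>A. g a)" for g :: "'a \<Rightarrow> real"
    unfolding F_def by (rule sum.image_gen[OF A, symmetric])
  have eq: "(\<Sum>t\<in>F. c t \<bullet> Z \<omega> t) = (\<Sum>a\<in>A. d a \<bullet> Z \<omega> (ts a))" for \<omega>
  proof -
    have "(\<Sum>t\<in>F. c t \<bullet> Z \<omega> t) = (\<Sum>t\<in>F. \<Sum>a\<in>{a\<in>A. ts a = t}. d a \<bullet> Z \<omega> (ts a))"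
      by (intro sum.cong refl) (simp add: c_def inner_sum_left)
    then show ?thesis by (simp only: grp)
  qed
  have v: "(\<Sum>t\<in>F. \<Sum>s\<in>F. c t \<bullet> C t s (c s)) = v"
  proof -
    have "(\<Sum>t\<in>F. \<Sum>s\<in>F. c t \<bullet> C t s (c s)) =
      (\<Sum>t\<in>F. \<Sum>a\<in>{a\<in>A. ts a = t}. \<Sum>s\<in>F. \<Sum>b\<in>{b\<in>A. ts b = s}. d a \<bullet> C (ts a) (ts b) (d b))"
    proof (intro sum.cong refl)
      fix t
      have "(\<Sum>s\<in>F. c t \<bullet> C t s (c s)) =
        (\<Sum>s\<in>F. \<Sum>a\<in>{a\<in>A. ts a = t}. \<Sum>b\<in>{b\<in>A. ts b = s}. d a \<bullet> C (ts a) (ts b) (d b))"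
      proof (intro sum.cong refl)
        fix s
        show "c t \<bullet> C t s (c s) = (\<Sum>a\<in>{a\<in>A. ts a = t}. \<Sum>b\<in>{b\<in>A. ts b = s}. d a \<bullet> C (ts a) (ts b) (d b))"
          unfolding c_def linear_sum[OF lin] unfolding inner_sum_left unfolding inner_sum_right
          by (intro sum.cong refl) auto
      qed
      also have "\<dots> = (\<Sum>a\<in>{a\<in>A. ts a = t}. \<Sum>s\<in>F. \<Sum>b\<in>{b\<in>A. ts b = s}. d a \<bullet> C (ts a) (ts b) (d b))"
        by (rule sum.swap)
      finally show "(\<Sum>s\<in>F. c t \<bullet> C t s (c s)) = (\<Sum>a\<in>{a\<in>A. ts a = t}. \<Sum>s\<in>F. \<Sum>b\<in>{b\<in>A. ts b = s}. d a \<bullet> C (ts a) (ts b) (d b))" .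
    qed
    also have "\<dots> = v" unfolding grp v_def ..
    finally show ?thesis .
  qed
  have mp: "measurable_process N T Z" using G by (simp add: centered_gaussian_process_def)
  have G': "0 \<le> (\<Sum>t\<in>F. \<Sum>s\<in>F. c t \<bullet> C t s (c s))"
    "distr N borel (\<lambda>\<omega>. \<Sum>t\<in>F. c t \<bullet> Z \<omega> t) = centered_normal (\<Sum>t\<in>F. \<Sum>s\<in>F. c t \<bullet> C t s (c s))"
    using G F unfolding centered_gaussian_process_def by blast+
  show 1: "0 \<le> v" using G'(1) by (simp only: v)
  show 2: "distr N borel (\<lambda>\<omega>. \<Sum>a\<in>A. d a \<bullet> Z \<omega> (ts a)) = centered_normal v"
    using G'(2) by (simp only: v eq)
  show 3: "(\<lambda>\<omega>. \<Sum>a\<in>A. d a \<bullet> Z \<omega> (ts a)) \<in> borel_measurable N"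
    using measurable_process_at[OF mp ts] by (intro borel_measurable_sum borel_measurable_inner) auto
  show "(\<integral>\<omega>. iexp (\<Sum>a\<in>A. d a \<bullet> Z \<omega> (ts a)) \<partial>N) = complex_of_real (exp (- v / 2))"
    by (rule integral_iexp_centered_normal[OF 1 3 2])
qed

lemma GP_char:
  assumes G: "GP N T C Z" and A: "finite A" and ts: "\<And>a. a \<in> A \<Longrightarrow> ts a \<in> T"
  shows "(\<lambda>\<omega>. \<Sum>a\<in>A. d a * Z \<omega> (ts a)) \<in> borel_measurable N"
    and "(\<integral>\<omega>. iexp (\<Sum>a\<in>A. d a * Z \<omega> (ts a)) \<partial>N) =
      complex_of_real (exp (- (\<Sum>a\<in>A. \<Sum>b\<in>A. d a * d b * C (ts a) (ts b)) / 2))"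
proof -
  have lin: "linear ((*) (C t s))" for t s by (simp add: linear_times)
  note * = gaussian_process_char[OF G[unfolded GP_def] lin A ts, where d = d]
  from *(3) show "(\<lambda>\<omega>. \<Sum>a\<in>A. d a * Z \<omega> (ts a)) \<in> borel_measurable N" by simp
  have "(\<Sum>a\<in>A. \<Sum>b\<in>A. d a \<bullet> (C (ts a) (ts b) * d b)) = (\<Sum>a\<in>A. \<Sum>b\<in>A. d a * d b * C (ts a) (ts b))"
    by (intro sum.cong refl) (simp add: mult_ac)
  with *(4) show "(\<integral>\<omega>. iexp (\<Sum>a\<in>A. d a * Z \<omega> (ts a)) \<partial>N) =
      complex_of_real (exp (- (\<Sum>a\<in>A. \<Sum>b\<in>A. d a * d b * C (ts a) (ts b)) / 2))"
    by simp
qed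

lemma GP_at:
  assumes G: "GP N T C Z" and t: "t \<in> T"
  shows "0 \<le> C t t" and "(\<lambda>\<omega>. Z \<omega> t) \<in> borel_measurable N"
    and "distr N borel (\<lambda>\<omega>. Z \<omega> t) = centered_normal (C t t)"
proof -
  have lin: "linear ((*) (C t s))" for t s by (simp add: linear_times)
  note * = gaussian_process_char[OF G[unfolded GP_def] lin, where A = "{t}" and ts = "\<lambda>a. a" and d = "\<lambda>_. 1"]
  show "0 \<le> C t t" and "(\<lambda>\<omega>. Z \<omega> t) \<in> borel_measurable N"
    and "distr N borel (\<lambda>\<omega>. Z \<omega> t) = centered_normal (C t t)"
    using * t by simp_all
qed

locale bootstrap_sample =
  fixes N :: "'b measure" and T :: "real set" and m :: "'k::finite \<Rightarrow> nat"
    and x :: "'k \<Rightarrow> nat \<Rightarrow> real \<Rightarrow> real" and Y :: "'k \<Rightarrow> nat \<Rightarrow> 'b \<Rightarrow> real \<Rightarrow> real"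
    and H :: "real ^ 'k ^ 'r"
  assumes bootstrap: "parametric_bootstrap N T m x Y"
begin

sublocale prob_space N
  using bootstrap by (simp add: parametric_bootstrap_def)

abbreviation "n \<equiv> real (total_size m)"
abbreviation "cov i \<equiv> sample_cov (m i) (x i)"
abbreviation "mean \<omega> i t \<equiv> sample_mean (m i) (\<lambda>j. Y i j \<omega>) t"
abbreviation "var \<omega> i t \<equiv> sample_cov (m i) (\<lambda>j. Y i j \<omega>) t t"

lemma GP_Y: "j \<in> {1..m i} \<Longrightarrow> GP N T (cov i) (Y i j)"
  using bootstrap by (simp add: parametric_bootstrap_def)

lemma indep_functional:
  assumes f: "\<And>i j. j \<in> {1..m i} \<Longrightarrow> f i j \<in> borel_measurable (path_space T)"
  shows "indep_vars (\<lambda>_. borel) (\<lambda>(i, j) \<omega>. f i j (path_on T (Y i j) \<omega>)) (SIGMA i:UNIV. {1..m i})"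
proof -
  have "indep_vars (\<lambda>_. path_space T) (\<lambda>(i, j). path_on T (Y i j)) (SIGMA i:UNIV. {1..m i})"
    using bootstrap by (simp add: parametric_bootstrap_def)
  then have "indep_vars (\<lambda>_. borel) (\<lambda>ij \<omega>. (case ij of (i, j) \<Rightarrow> f i j) ((case ij of (i, j) \<Rightarrow> path_on T (Y i j)) \<omega>)) (SIGMA i:UNIV. {1..m i})"
    by (rule indep_vars_compose2) (use f in auto)
  then show ?thesis by (simp add: case_prod_beta')
qed

text \<open>Independence over all pairs (i, j) is passed on to a fixed group i through the singleton
  blocks {(i, j)}, indexed by j alone.\<close>

lemma indep_at:
  assumes "t \<in> T"
  shows "indep_vars (\<lambda>_. borel) (\<lambda>j \<omega>. Y i j \<omega> t) {1..m i}"
proof -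
  let ?g = "\<lambda>ij \<omega>. (case ij of (i, j) \<Rightarrow> path_on T (Y i j)) \<omega> t"
  have "indep_vars (\<lambda>_. path_space T) (\<lambda>(i, j). path_on T (Y i j)) (SIGMA i:UNIV. {1..m i})"
    using bootstrap by (simp add: parametric_bootstrap_def)
  then have "indep_vars (\<lambda>_. borel) ?g (SIGMA i:UNIV. {1..m i})"
    by (rule indep_vars_compose2) (rule measurable_component_singleton[OF assms])
  then have "indep_vars (\<lambda>j. PiM {(i, j)} (\<lambda>_. borel)) (\<lambda>j \<omega>. restrict (\<lambda>ij. ?g ij \<omega>) {(i, j)}) {1..m i}"
    by (rule indep_vars_restrict) (auto simp: disjoint_family_on_def)
  then have "indep_vars (\<lambda>_. borel) (\<lambda>j \<omega>. (\<lambda>f. f (i, j)) (restrict (\<lambda>ij. ?g ij \<omega>) {(i, j)})) {1..m i}"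
    by (rule indep_vars_compose2) (rule measurable_component_singleton, simp)
  then show ?thesis using assms by (simp add: path_on_def)
qed

lemma mean_measurable: "t \<in> T \<Longrightarrow> (\<lambda>\<omega>. mean \<omega> i t) \<in> borel_measurable N"
  unfolding sample_mean_def using GP_at(2)[OF GP_Y]
  by (intro borel_measurable_times borel_measurable_sum) auto

lemma var_measurable: "t \<in> T \<Longrightarrow> (\<lambda>\<omega>. var \<omega> i t) \<in> borel_measurable N"
  unfolding sample_cov_def using GP_at(2)[OF GP_Y] mean_measurable
  by (intro borel_measurable_times borel_measurable_sum borel_measurable_diff) auto

lemma cov_nonneg: "t \<in> T \<Longrightarrow> 1 \<le> m i \<Longrightarrow> 0 \<le> cov i t t"
  by (rule GP_at(1)[OF GP_Y[of 1]]) auto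

text \<open>The exponent is a sum of independent Gaussian terms, one for each observation. A term of
  group i has variance proportional to n / m_i^2, and there are m_i of them, whence n / m_i. The
  coefficients \<open>e\<close> absorb the argument of the characteristic functions, which are
  evaluated at 1.\<close>

lemma mean_char:
  fixes p :: nat
  assumes ts: "\<And>j. j < p \<Longrightarrow> ts j \<in> T"
  shows "(\<integral>\<omega>. iexp (\<Sum>j<p. \<Sum>i\<in>UNIV. e i j * (sqrt n * mean \<omega> i (ts j))) \<partial>N) =
    complex_of_real (exp (- (\<Sum>i\<in>UNIV. n / m i * (\<Sum>j<p. \<Sum>j'<p. e i j * e i j' * cov i (ts j) (ts j'))) / 2))"
proof -
  define I where "I = (SIGMA i:UNIV. {1..m i})"
  define f where "f i a y = (\<Sum>j<p. (e i j * sqrt n / m i) * y (ts j))" for i and a :: nat and y :: "real \<Rightarrow> real"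
  have fm: "f i a \<in> borel_measurable (path_space T)" for i a
    unfolding f_def[abs_def] using ts
    by (intro borel_measurable_sum borel_measurable_times borel_measurable_const measurable_component_singleton) auto
  have fin: "finite I" by (auto simp: I_def)
  define s where "s = (\<lambda>(i, a) \<omega>. f i a (path_on T (Y i a) \<omega>))"
  have ind: "indep_vars (\<lambda>_. borel) s I"
    unfolding s_def I_def by (rule indep_functional[OF fm])
  have s: "s (i, a) \<omega> = (\<Sum>j\<in>{..<p}. (e i j * sqrt n / m i) * Y i a \<omega> (ts j))" for i a \<omega>
    unfolding s_def f_def using ts by (auto simp: path_on_def intro: sum.cong)
  have sm: "s ia \<in> borel_measurable N" if "ia \<in> I" for ia
    using indep_vars_rv[OF ind that] .
  have char_s: "char (distr N borel (s (i, a))) 1 =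
      complex_of_real (exp (- (n / (m i)\<^sup>2 * (\<Sum>j<p. \<Sum>j'<p. e i j * e i j' * cov i (ts j) (ts j'))) / 2))"
    if ia: "(i, a) \<in> I" for i a
  proof -
    have "char (distr N borel (s (i, a))) 1 = (\<integral>\<omega>. iexp (s (i, a) \<omega>) \<partial>N)"
      using sm[OF ia] by (simp add: char_def integral_distr)
    also have "\<dots> = complex_of_real (exp (- (\<Sum>j<p. \<Sum>j'<p. (e i j * sqrt n / m i) * (e i j' * sqrt n / m i) * cov i (ts j) (ts j')) / 2))"
      unfolding s using ia ts by (intro GP_char(2)[OF GP_Y]) (auto simp: I_def)
    also have "(\<Sum>j<p. \<Sum>j'<p. (e i j * sqrt n / m i) * (e i j' * sqrt n / m i) * cov i (ts j) (ts j')) =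
        n / (m i)\<^sup>2 * (\<Sum>j<p. \<Sum>j'<p. e i j * e i j' * cov i (ts j) (ts j'))"
      unfolding sum_distrib_left
      by (intro sum.cong refl) (simp add: power2_eq_square)
    finally show ?thesis .
  qed
  have sums: "(\<Sum>j<p. \<Sum>i\<in>UNIV. e i j * (sqrt n * mean \<omega> i (ts j))) = (\<Sum>ia\<in>I. s ia \<omega>)" for \<omega>
  proof -
    have "(\<Sum>ia\<in>I. s ia \<omega>) = (\<Sum>i\<in>UNIV. \<Sum>a\<in>{1..m i}. s (i, a) \<omega>)"
      unfolding I_def by (subst sum.Sigma) auto
    also have "\<dots> = (\<Sum>i\<in>UNIV. \<Sum>j<p. e i j * (sqrt n * mean \<omega> i (ts j)))"
    proof (rule sum.cong[OF refl])
      fix i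
      have "(\<Sum>a\<in>{1..m i}. s (i, a) \<omega>) = (\<Sum>j<p. \<Sum>a\<in>{1..m i}. (e i j * sqrt n / m i) * Y i a \<omega> (ts j))"
        unfolding s by (rule sum.swap)
      also have "\<dots> = (\<Sum>j<p. e i j * (sqrt n * mean \<omega> i (ts j)))"
        by (intro sum.cong refl) (simp add: sample_mean_def sum_distrib_left sum_divide_distrib mult_ac)
      finally show "(\<Sum>a\<in>{1..m i}. s (i, a) \<omega>) = (\<Sum>j<p. e i j * (sqrt n * mean \<omega> i (ts j)))" .
    qed
    finally show ?thesis by (simp only: sum.swap[of _ "{..<p}"])
  qed
  have "(\<integral>\<omega>. iexp (\<Sum>j<p. \<Sum>i\<in>UNIV. e i j * (sqrt n * mean \<omega> i (ts j))) \<partial>N) =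
      char (distr N borel (\<lambda>\<omega>. \<Sum>ia\<in>I. s ia \<omega>)) 1"
    unfolding sums using sm by (simp add: char_def integral_distr)
  also have "\<dots> = (\<Prod>ia\<in>I. char (distr N borel (s ia)) 1)"
    by (rule char_distr_sum[OF ind])
  also have "\<dots> = (\<Prod>i\<in>UNIV. \<Prod>a\<in>{1..m i}. char (distr N borel (s (i, a))) 1)"
    unfolding I_def by (subst prod.Sigma) auto
  also have "\<dots> = (\<Prod>i\<in>UNIV. complex_of_real (exp (- (n / m i * (\<Sum>j<p. \<Sum>j'<p. e i j * e i j' * cov i (ts j) (ts j'))) / 2)))"
  proof (rule prod.cong[OF refl])
    fix i
    define W where "W = (\<Sum>j<p. \<Sum>j'<p. e i j * e i j' * cov i (ts j) (ts j'))"
    have "(\<Prod>a\<in>{1..m i}. char (distr N borel (s (i, a))) 1) = (\<Prod>a\<in>{1..m i}. complex_of_real (exp (- (n / (m i)\<^sup>2 * W) / 2)))"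
      unfolding W_def by (intro prod.cong refl char_s) (auto simp: I_def)
    also have "\<dots> = complex_of_real (exp (m i * (- (n / (m i)\<^sup>2 * W) / 2)))"
      by (simp only: prod_constant card_atLeastAtMost exp_of_nat_mult of_real_power diff_Suc_1)
    also have "m i * (- (n / (m i)\<^sup>2 * W) / 2) = - (n / m i * W) / 2"
      by (simp add: power2_eq_square)
    finally show "(\<Prod>a\<in>{1..m i}. char (distr N borel (s (i, a))) 1) =
      complex_of_real (exp (- (n / m i * (\<Sum>j<p. \<Sum>j'<p. e i j * e i j' * cov i (ts j) (ts j'))) / 2))"
      unfolding W_def .
  qed
  also have "\<dots> = complex_of_real (exp (- (\<Sum>i\<in>UNIV. n / m i * (\<Sum>j<p. \<Sum>j'<p. e i j * e i j' * cov i (ts j) (ts j'))) / 2))"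
    by (simp only: of_real_prod[symmetric] exp_sum[symmetric, OF finite] sum_divide_distrib[symmetric] sum_negf)
  finally show ?thesis .
qed

lemma mean_second_moment:
  assumes t: "t \<in> T" and m: "1 \<le> m i"
  shows "integrable N (\<lambda>\<omega>. (mean \<omega> i t)\<^sup>2)" and "expectation (\<lambda>\<omega>. (mean \<omega> i t)\<^sup>2) = cov i t t / m i"
proof -
  note G = GP_at[OF GP_Y t]
  note mo = centered_normal_moments(1)[OF G] centered_normal_mean[OF G]
    centered_normal_integrable_power[OF G, where k = 2]
  have *: "integrable N (\<lambda>\<omega>. (\<Sum>j\<in>{1..m i}. Y i j \<omega> t)\<^sup>2) \<and>
    expectation (\<lambda>\<omega>. (\<Sum>j\<in>{1..m i}. Y i j \<omega> t)\<^sup>2) = (\<Sum>j\<in>{1..m i}. expectation (\<lambda>\<omega>. (Y i j \<omega> t)\<^sup>2))"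
    by (rule expectation_sum_squared[OF _ indep_at[OF t]]) (use mo in auto)
  then have "expectation (\<lambda>\<omega>. (\<Sum>j\<in>{1..m i}. Y i j \<omega> t)\<^sup>2) = m i * cov i t t"
    using mo(1) by simp
  with * show "integrable N (\<lambda>\<omega>. (mean \<omega> i t)\<^sup>2)" and "expectation (\<lambda>\<omega>. (mean \<omega> i t)\<^sup>2) = cov i t t / m i"
    using m by (simp_all add: sample_mean_def power_divide power2_eq_square)
qed
end

section \<open>Factoring the quadratic form and its joint Laplace transforms\<close>

definition pinv_root :: "real ^ 'k ^ 'r \<Rightarrow> ('k \<Rightarrow> real) \<Rightarrow> 'k \<Rightarrow> real ^ 'r" where
  "pinv_root H d k = sqrt (d k) *\<^sub>R (pinv (H ** diag_mat d ** transpose H) *v (H *v axis k 1))"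

text \<open>The vectors \<open>pinv_root H d k\<close> are the columns of A^+ H D^(1/2) with A = H D
  H^T, so A^+ = A^+ A A^+ is the sum of their outer squares. For deterministic weights the form of a
  Gaussian vector is thus a sum of squares of jointly normal variables.\<close>

lemma pinv_quad_eq_sum_root:
  fixes H :: "real ^ 'k ^ 'r"
  assumes d: "\<And>i. 0 \<le> d i"
  shows "pinv_quad H d y = (\<Sum>k\<in>UNIV. (pinv_root H d k \<bullet> y)\<^sup>2)"
proof -
  define X where "X = pinv (H ** diag_mat d ** transpose H)"
  have X: "transpose X = X" unfolding X_def by (rule pinv_symmetric[OF transpose_sandwich])
  have "pinv_coord H d y k = (X *v (H *v axis k 1)) \<bullet> y" for k
  proof -
    have "pinv_coord H d y k = (transpose H *v (X *v y)) \<bullet> axis k 1"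
      by (simp add: pinv_coord_def X_def inner_axis del: transpose_matrix_vector)
    also have "\<dots> = (X *v y) \<bullet> (H *v axis k 1)"
      by (simp add: dot_lmul_matrix)
    also have "\<dots> = (X *v (H *v axis k 1)) \<bullet> y"
      using inner_symmetric_matrix[OF X, of "H *v axis k 1" y] by (simp add: inner_commute)
    finally show ?thesis .
  qed
  then show ?thesis
    using d by (simp add: pinv_quad_eq_sum pinv_root_def X_def[symmetric] power_mult_distrib)
qed

text \<open>The left side is d_k times the form at \<open>H *v axis k 1\<close>, which
  \<open>pinv_quad_le\<close> bounds by 1 / d_k. If y has covariance H D H^T, each square in the
  decomposition therefore comes from a variable of variance at most 1, whatever the weights.\<close>

lemma pinv_root_variance:
  fixes H :: "real ^ 'k ^ 'r"
  assumes d: "\<And>i. 0 < d i"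
  shows "pinv_root H d k \<bullet> ((H ** diag_mat d ** transpose H) *v pinv_root H d k) \<le> 1"
proof -
  define A where "A = H ** diag_mat d ** transpose H"
  define e where "e = H *v axis k (1::real)"
  have "A *v (pinv A *v e) = e"
    using pinv_sandwich_absorb[of d H] d by (simp add: A_def e_def matrix_vector_mul_assoc matrix_mul_assoc)
  then have "pinv_root H d k \<bullet> (A *v pinv_root H d k) = d k * pinv_quad H d e"
    using d[of k] by (simp add: pinv_root_def A_def[symmetric] e_def[symmetric] matrix_vector_mult_scaleR
        pinv_quad_def inner_commute flip: mult.assoc)
  also have "pinv_quad H d e \<le> (\<Sum>i\<in>UNIV. (axis k (1::real) $ i)\<^sup>2 / d i)"
    unfolding e_def using d by (intro pinv_quad_le) (auto simp: less_le)
  also have "\<dots> = 1 / d k"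
    by (simp add: axis_def if_distrib[of "\<lambda>y. y\<^sup>2"] if_distrib[of "\<lambda>y. y / _"] cong: if_cong)
  finally show ?thesis
    using d[of k] by (simp add: A_def mult_left_mono)
qed

text \<open>The variance of the sum of the inner products of u_j with H W_j, where the coordinates
  of W are independent and coordinate i has covariances \<open>\<kappa> i\<close>. Bootstrap and
  limit share this formula, so only \<kappa> has to converge.\<close>

definition cov_form :: "real ^ 'k ^ 'r \<Rightarrow> nat \<Rightarrow> ('k \<Rightarrow> nat \<Rightarrow> nat \<Rightarrow> real) \<Rightarrow> (nat \<Rightarrow> real ^ 'r) \<Rightarrow> real" where
  "cov_form H p \<kappa> u = (\<Sum>i\<in>UNIV. \<Sum>j<p. \<Sum>j'<p. (transpose H *v u j) $ i * (transpose H *v u j') $ i * \<kappa> i j j')"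

lemma laplace_transform_quadratic:
  fixes H :: "real ^ 'k ^ 'r" and y :: "nat \<Rightarrow> 'b \<Rightarrow> real ^ 'r" and d :: "nat \<Rightarrow> 'k \<Rightarrow> real"
  defines "U \<equiv> \<lambda>c j. \<Sum>k\<in>UNIV. c (j, k) *\<^sub>R pinv_root H (d j) k"
  assumes N: "prob_space N" and y: "\<And>j. j < p \<Longrightarrow> y j \<in> borel_measurable N"
    and char: "\<And>u. (\<integral>\<omega>. iexp (\<Sum>j<p. u j \<bullet> y j \<omega>) \<partial>N) = complex_of_real (exp (- cov_form H p \<kappa> u / 2))"
    and d: "\<And>j i. j < p \<Longrightarrow> 0 \<le> d j i" and l: "0 \<le> l"
  shows "(\<integral>\<omega>. exp (- l * (\<Sum>j<p. pinv_quad H (d j) (y j \<omega>))) \<partial>N) =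
     (\<integral>\<xi>. exp (- cov_form H p \<kappa> (U (\<lambda>jk. sqrt (2 * l) * \<xi> jk)) / 2) \<partial>PiM ({..<p} \<times> UNIV) (\<lambda>_. std_normal_distribution))"
proof -
  define X where "X jk \<omega> = pinv_root H (d (fst jk)) (snd jk) \<bullet> y (fst jk) \<omega>" for jk \<omega>
  have "(\<Sum>j<p. pinv_quad H (d j) (y j \<omega>)) = (\<Sum>jk\<in>{..<p} \<times> UNIV. (X jk \<omega>)\<^sup>2)" for \<omega>
    unfolding sum.cartesian_product[symmetric, of "\<lambda>j k. (X (j, k) \<omega>)\<^sup>2", simplified]
    by (rule sum.cong[OF refl]) (simp add: X_def pinv_quad_eq_sum_root[OF d])
  moreover have "(\<integral>\<omega>. exp (- l * (\<Sum>jk\<in>{..<p} \<times> UNIV. (X jk \<omega>)\<^sup>2)) \<partial>N) =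
     (\<integral>\<xi>. exp (- cov_form H p \<kappa> (U (\<lambda>jk. sqrt (2 * l) * \<xi> jk)) / 2) \<partial>PiM ({..<p} \<times> UNIV) (\<lambda>_. std_normal_distribution))"
  proof (rule integral_exp_neg_sum_squares[OF N _ _ _ l, where V = "\<lambda>c. cov_form H p \<kappa> (U c)"])
    show "X jk \<in> borel_measurable N" if "jk \<in> {..<p} \<times> UNIV" for jk
      unfolding X_def[abs_def] using y[of "fst jk"] that by (intro borel_measurable_inner) auto
    fix c :: "nat \<times> 'k \<Rightarrow> real"
    have "(\<Sum>jk\<in>{..<p} \<times> UNIV. c jk * X jk \<omega>) = (\<Sum>j<p. U c j \<bullet> y j \<omega>)" for \<omega>
      unfolding sum.cartesian_product[symmetric, of "\<lambda>j k. c (j, k) * X (j, k) \<omega>", simplified]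
      by (simp add: X_def U_def inner_sum_left)
    then show "(\<integral>\<omega>. iexp (\<Sum>jk\<in>{..<p} \<times> UNIV. c jk * X jk \<omega>) \<partial>N) = complex_of_real (exp (- cov_form H p \<kappa> (U c) / 2))"
      using char[of "U c"] by simp
  qed auto
  ultimately show ?thesis by simp
qed

lemma laplace_transform_quadratic_tendsto:
  fixes H :: "real ^ 'k ^ 'r" and y :: "nat \<Rightarrow> nat \<Rightarrow> 'b \<Rightarrow> real ^ 'r" and y0 :: "nat \<Rightarrow> 'c \<Rightarrow> real ^ 'r"
  assumes N: "\<And>l. prob_space (N l)" and N0: "prob_space N0"
    and y: "\<And>l j. j < p \<Longrightarrow> y l j \<in> borel_measurable (N l)" and y0: "\<And>j. j < p \<Longrightarrow> y0 j \<in> borel_measurable N0"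
    and char: "\<And>l u. (\<integral>\<omega>. iexp (\<Sum>j<p. u j \<bullet> y l j \<omega>) \<partial>N l) = complex_of_real (exp (- cov_form H p (\<kappa> l) u / 2))"
    and char0: "\<And>u. (\<integral>\<omega>. iexp (\<Sum>j<p. u j \<bullet> y0 j \<omega>) \<partial>N0) = complex_of_real (exp (- cov_form H p \<kappa>0 u / 2))"
    and \<kappa>: "\<And>i j j'. j < p \<Longrightarrow> j' < p \<Longrightarrow> (\<lambda>l. \<kappa> l i j j') \<longlonglongrightarrow> \<kappa>0 i j j'"
    and d: "\<And>j i. j < p \<Longrightarrow> 0 \<le> d j i" and lam: "0 \<le> lam"
  shows "(\<lambda>l. \<integral>\<omega>. exp (- lam * (\<Sum>j<p. pinv_quad H (d j) (y l j \<omega>))) \<partial>N l) \<longlonglongrightarrow>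
     (\<integral>\<omega>. exp (- lam * (\<Sum>j<p. pinv_quad H (d j) (y0 j \<omega>))) \<partial>N0)"
proof -
  let ?P = "PiM ({..<p} \<times> (UNIV :: 'k set)) (\<lambda>_. std_normal_distribution)"
  interpret P: prob_space ?P by (intro prob_space_PiM prob_space_std_normal)
  define u where "u \<xi> j = (\<Sum>k\<in>UNIV. (sqrt (2 * lam) * \<xi> (j, k)) *\<^sub>R pinv_root H (d j) k)" for \<xi> j
  have u: "(\<lambda>\<xi>. (transpose H *v u \<xi> j) $ i) \<in> borel_measurable ?P" if "j < p" for i j
  proof -
    have "(\<lambda>\<xi>. \<xi> (j, k)) \<in> borel_measurable ?P" for k
      using measurable_component_singleton[of "(j, k)" "{..<p} \<times> (UNIV :: 'k set)" "\<lambda>_. std_normal_distribution"] that by simp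
    then show ?thesis
      by (simp add: u_def matrix_vector_mult_def del: transpose_matrix_vector)
  qed
  have cf: "(\<lambda>\<xi>. cov_form H p \<kappa>' (u \<xi>)) \<in> borel_measurable ?P" for \<kappa>'
    unfolding cov_form_def using u by (intro borel_measurable_sum borel_measurable_times) auto
  \<comment> \<open>Nonnegativity of the covariance form is extracted from \<open>char\<close>: the
    exponential is the value of a characteristic function, hence at most 1. This provides the
    dominating constant.\<close>
  have le1: "exp (- cov_form H p (\<kappa> l) w / 2) \<le> 1" for l w
  proof -
    interpret N: prob_space "N l" by (rule N)
    have "exp (- cov_form H p (\<kappa> l) w / 2) = norm (\<integral>\<omega>. iexp (\<Sum>j<p. w j \<bullet> y l j \<omega>) \<partial>N l)"
      by (simp only: char norm_of_real abs_exp_cancel)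
    also have "\<dots> \<le> (\<integral>\<omega>. norm (iexp (\<Sum>j<p. w j \<bullet> y l j \<omega>)) \<partial>N l)" by (rule integral_norm_bound)
    also have "\<dots> = 1" by (simp add: N.prob_space)
    finally show ?thesis .
  qed
  have m: "(\<integral>\<omega>. exp (- lam * (\<Sum>j<p. pinv_quad H (d j) (y l j \<omega>))) \<partial>N l) = (\<integral>\<xi>. exp (- cov_form H p (\<kappa> l) (u \<xi>) / 2) \<partial>?P)" for l
    unfolding u_def[abs_def] by (rule laplace_transform_quadratic[OF N y char d lam])
  have m0: "(\<integral>\<omega>. exp (- lam * (\<Sum>j<p. pinv_quad H (d j) (y0 j \<omega>))) \<partial>N0) = (\<integral>\<xi>. exp (- cov_form H p \<kappa>0 (u \<xi>) / 2) \<partial>?P)"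
    unfolding u_def[abs_def] by (rule laplace_transform_quadratic[OF N0 y0 char0 d lam])
  show ?thesis
    unfolding m m0
  proof (rule integral_dominated_convergence[where w = "\<lambda>_. 1"])
    show "AE \<xi> in ?P. (\<lambda>l. exp (- cov_form H p (\<kappa> l) (u \<xi>) / 2)) \<longlonglongrightarrow> exp (- cov_form H p \<kappa>0 (u \<xi>) / 2)"
      unfolding cov_form_def using \<kappa> by (intro AE_I2 tendsto_intros) auto
    show "AE \<xi> in ?P. norm (exp (- cov_form H p (\<kappa> l) (u \<xi>) / 2)) \<le> 1" for l
      using le1 by (intro AE_I2) simp
  qed (use cf in \<open>auto intro!: borel_measurable_exp borel_measurable_divide\<close>)
qed

lemma pinv_quad_scaleR: "pinv_quad H d (r *\<^sub>R y) = r\<^sup>2 * pinv_quad H d y"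
  by (simp add: pinv_quad_def matrix_vector_mult_scaleR power2_eq_square)

section \<open>The bootstrap quadratic form at a fixed time\<close>

context bootstrap_sample
begin

definition scaled_mean :: "'b \<Rightarrow> real \<Rightarrow> real ^ 'k" where
  "scaled_mean \<omega> t = sqrt n *\<^sub>R mean_vec m (\<lambda>i j. Y i j \<omega>) t"

definition var_hat :: "'b \<Rightarrow> real \<Rightarrow> 'k \<Rightarrow> real" where
  "var_hat \<omega> t i = n / m i * var \<omega> i t"

lemma scaled_mean_nth: "scaled_mean \<omega> t $ i = sqrt n * mean \<omega> i t"
  by (simp add: scaled_mean_def mean_vec_def)

lemma var_hat_nonneg: "0 \<le> var_hat \<omega> t i"
  by (simp add: var_hat_def sample_cov_nonneg)

text \<open>The factor n of the integrand is absorbed as sqrt n into both arguments of the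
  form.\<close>

lemma statistic_eq:
  "statistic T H m (\<lambda>i j. Y i j \<omega>) = (LBINT t:T. pinv_quad H (var_hat \<omega> t) (H *v scaled_mean \<omega> t))"
proof -
  have "n * ((H *v v) \<bullet> (pinv (H ** Sigma_hat m (\<lambda>i j. Y i j \<omega>) t t ** transpose H) *v (H *v v))) =
      pinv_quad H (var_hat \<omega> t) (H *v (sqrt n *\<^sub>R v))" for t v
    by (simp add: matrix_vector_mult_scaleR pinv_quad_scaleR)
       (simp add: pinv_quad_def Sigma_hat_def var_hat_def[abs_def])
  then show ?thesis by (simp add: statistic_def scaled_mean_def)
qed

lemma scaled_mean_char:
  fixes p :: nat
  assumes ts: "\<And>j. j < p \<Longrightarrow> ts j \<in> T"
  shows "(\<integral>\<omega>. iexp (\<Sum>j<p. u j \<bullet> (H *v scaled_mean \<omega> (ts j))) \<partial>N) =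
    complex_of_real (exp (- cov_form H p (\<lambda>i j j'. n / m i * cov i (ts j) (ts j')) u / 2))"
proof -
  define e where "e i j = (transpose H *v u j) $ i" for i j
  have "(\<Sum>j<p. u j \<bullet> (H *v scaled_mean \<omega> (ts j))) = (\<Sum>j<p. \<Sum>i\<in>UNIV. e i j * (sqrt n * mean \<omega> i (ts j)))" for \<omega>
  proof (intro sum.cong[OF refl])
    fix j
    have "u j \<bullet> (H *v scaled_mean \<omega> (ts j)) = (transpose H *v u j) \<bullet> scaled_mean \<omega> (ts j)"
      by (simp add: dot_lmul_matrix)
    then show "u j \<bullet> (H *v scaled_mean \<omega> (ts j)) = (\<Sum>i\<in>UNIV. e i j * (sqrt n * mean \<omega> i (ts j)))"
      by (simp add: inner_vec_def e_def scaled_mean_nth del: transpose_matrix_vector)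
  qed
  moreover have "cov_form H p (\<lambda>i j j'. n / m i * cov i (ts j) (ts j')) u =
      (\<Sum>i\<in>UNIV. n / m i * (\<Sum>j<p. \<Sum>j'<p. e i j * e i j' * cov i (ts j) (ts j')))"
    unfolding cov_form_def e_def sum_distrib_left by (simp add: mult_ac)
  ultimately show ?thesis
    using mean_char[OF ts, where e = e] by simp
qed

lemma scaled_mean_measurable:
  assumes "t \<in> T" shows "(\<lambda>\<omega>. H *v scaled_mean \<omega> t) \<in> borel_measurable N"
proof (rule borel_measurable_vecI)
  show "(\<lambda>\<omega>. (H *v scaled_mean \<omega> t) $ i) \<in> borel_measurable N" for i
    using mean_measurable[OF assms] by (simp add: matrix_vector_mult_def scaled_mean_nth)
qed

lemma var_hat_measurable: "t \<in> T \<Longrightarrow> (\<lambda>\<omega>. var_hat \<omega> t i) \<in> borel_measurable N"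
  using var_measurable by (simp add: var_hat_def)

lemma quad_measurable:
  assumes t: "t \<in> T"
  shows "(\<lambda>\<omega>. pinv_quad H (var_hat \<omega> t) (H *v scaled_mean \<omega> t)) \<in> borel_measurable N"
    and "(\<lambda>\<omega>. pinv_quad H d (H *v scaled_mean \<omega> t)) \<in> borel_measurable N"
proof -
  have "(\<lambda>\<omega>. (H *v scaled_mean \<omega> t) $ i) \<in> borel_measurable N" for i
    using measurable_compose[OF scaled_mean_measurable[OF t] borel_measurable_vec_nth] .
  then show "(\<lambda>\<omega>. pinv_quad H (var_hat \<omega> t) (H *v scaled_mean \<omega> t)) \<in> borel_measurable N"
    and "(\<lambda>\<omega>. pinv_quad H d (H *v scaled_mean \<omega> t)) \<in> borel_measurable N"
    using var_hat_measurable[OF t] by (auto intro!: borel_measurable_pinv_quad)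
qed

text \<open>The cases are split by whether all estimated weights are within relative error \<delta>
  of \<open>d\<close>. If so, \<open>pinv_quad_perturb\<close> and the Lipschitz constant lam of exp
  (- lam q) give 3 lam \<delta> R, and the mean of R is explicit. If not, the difference is at most
  1 and hence at most \<open>B\<close>, as in Markov's inequality. For fixed \<delta> the first sum
  will tend to 0, after which \<delta> may be taken small.\<close>

lemma studentization_error:
  assumes t: "t \<in> T" and m: "\<And>i. 2 \<le> m i" and c: "\<And>i. 0 < cov i t t" and d: "\<And>i. 0 < d i"
    and \<delta>: "0 < \<delta>" "\<delta> \<le> 1/2" and lam: "0 < lam"
  shows "expectation (\<lambda>\<omega>. \<bar>exp (- lam * pinv_quad H (var_hat \<omega> t) (H *v scaled_mean \<omega> t)) -
      exp (- lam * pinv_quad H d (H *v scaled_mean \<omega> t))\<bar>) \<le>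
    (\<Sum>i\<in>UNIV. (n / m i * cov i t t * var_rate (m i) + \<bar>n / m i * cov i t t - d i\<bar>) / (\<delta> * d i)) +
    3 * lam * \<delta> * (\<Sum>i\<in>UNIV. n / m i * cov i t t / d i)"
proof -
  define q where "q \<omega> = pinv_quad H (var_hat \<omega> t) (H *v scaled_mean \<omega> t)" for \<omega>
  define q' where "q' \<omega> = pinv_quad H d (H *v scaled_mean \<omega> t)" for \<omega>
  define B where "B \<omega> = (\<Sum>i\<in>UNIV. \<bar>var_hat \<omega> t i - d i\<bar> / (\<delta> * d i))" for \<omega>
  define R where "R \<omega> = (\<Sum>i\<in>UNIV. (scaled_mean \<omega> t $ i)\<^sup>2 / d i)" for \<omega>
  have q0: "0 \<le> q \<omega>" "0 \<le> q' \<omega>" for \<omega>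
    unfolding q_def q'_def using var_hat_nonneg d by (auto intro!: pinv_quad_nonneg simp: less_imp_le)
  have B0: "0 \<le> B \<omega>" and R0: "0 \<le> R \<omega>" for \<omega>
    unfolding B_def R_def using d \<delta> by (auto intro!: sum_nonneg divide_nonneg_pos simp: less_imp_le)
  have [measurable]: "q \<in> borel_measurable N" "q' \<in> borel_measurable N"
    unfolding q_def[abs_def] q'_def[abs_def] by (rule quad_measurable[OF t])+
  have pointwise: "\<bar>exp (- lam * q \<omega>) - exp (- lam * q' \<omega>)\<bar> \<le> B \<omega> + 3 * lam * \<delta> * R \<omega>" for \<omega>
  proof (cases "\<forall>i. \<bar>var_hat \<omega> t i - d i\<bar> \<le> \<delta> * d i")
    case True
    have *: "exp (- lam * u) - exp (- lam * v) \<le> lam * \<bar>u - v\<bar>" if "0 \<le> u" "0 \<le> v" for u v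
    proof (cases "u \<le> v")
      case True
      have "exp (- lam * u) - exp (- lam * v) = exp (- lam * u) * (1 - exp (- (lam * (v - u))))"
        by (simp add: right_diff_distrib exp_add[symmetric] algebra_simps)
      also have "\<dots> \<le> 1 * (lam * (v - u))"
      proof (intro mult_mono)
        show "exp (- lam * u) \<le> 1" using that lam by simp
        show "1 - exp (- (lam * (v - u))) \<le> lam * (v - u)"
          using exp_ge_add_one_self[of "- (lam * (v - u))"] by simp
        show "0 \<le> 1 - exp (- (lam * (v - u)))" using True lam by simp
      qed simp
      finally show ?thesis using True by simp
    next
      case False
      then have "exp (- lam * u) \<le> exp (- lam * v)" using lam by simp
      moreover have "0 \<le> lam * \<bar>u - v\<bar>" using lam by simp
      ultimately show ?thesis by linarith
    qed
    have "\<bar>exp (- lam * q \<omega>) - exp (- lam * q' \<omega>)\<bar> \<le> lam * \<bar>q \<omega> - q' \<omega>\<bar>"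
      using *[OF q0(1) q0(2), of \<omega> \<omega>] *[OF q0(2) q0(1), of \<omega> \<omega>] by (simp add: abs_le_iff abs_minus_commute)
    also have "\<dots> \<le> lam * (3 * \<delta> * R \<omega>)"
      unfolding q_def q'_def R_def using True lam
      by (intro mult_left_mono pinv_quad_perturb d \<delta>) auto
    also have "\<dots> \<le> B \<omega> + 3 * lam * \<delta> * R \<omega>" using B0 by (simp add: mult_ac)
    finally show ?thesis .
  next
    case False
    then obtain i where i: "\<delta> * d i < \<bar>var_hat \<omega> t i - d i\<bar>" by (auto simp: not_le)
    have "\<bar>exp (- lam * q \<omega>) - exp (- lam * q' \<omega>)\<bar> \<le> 1"
    proof -
      have "exp (- lam * q \<omega>) \<le> 1" "exp (- lam * q' \<omega>) \<le> 1" using q0 lam by simp_all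
      moreover have "0 < exp (- lam * q \<omega>)" "0 < exp (- lam * q' \<omega>)" by simp_all
      ultimately show ?thesis by linarith
    qed
    also have "1 \<le> \<bar>var_hat \<omega> t i - d i\<bar> / (\<delta> * d i)"
      using i d[of i] \<delta> by (simp add: pos_le_divide_eq)
    also have "\<dots> \<le> B \<omega>"
      unfolding B_def using d \<delta> by (intro member_le_sum) (auto simp: less_imp_le)
    also have "\<dots> \<le> B \<omega> + 3 * lam * \<delta> * R \<omega>" using R0 lam \<delta> by simp
    finally show ?thesis .
  qed
  have var: "integrable N (\<lambda>\<omega>. var \<omega> i t)" "expectation (\<lambda>\<omega>. \<bar>var \<omega> i t / cov i t t - 1\<bar>) \<le> var_rate (m i)" for i
    using gaussian_sample_var_integrable[where X = "Y i" and t = t, OF m indep_at[OF t] c GP_at(3)[OF GP_Y t]]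
      gaussian_sample_var_L1[where X = "Y i" and t = t, OF m indep_at[OF t] c GP_at(3)[OF GP_Y t]] by auto
  have iv: "integrable N (\<lambda>\<omega>. var_hat \<omega> t i)" for i
    unfolding var_hat_def using var by simp
  have Ev: "expectation (\<lambda>\<omega>. \<bar>var_hat \<omega> t i - d i\<bar>) \<le> n / m i * cov i t t * var_rate (m i) + \<bar>n / m i * cov i t t - d i\<bar>" for i
  proof -
    define r where "r = n / m i * cov i t t"
    have r0: "0 \<le> r" unfolding r_def using c[of i] by simp
    have "expectation (\<lambda>\<omega>. \<bar>var_hat \<omega> t i - d i\<bar>) \<le> expectation (\<lambda>\<omega>. r * \<bar>var \<omega> i t / cov i t t - 1\<bar> + \<bar>r - d i\<bar>)"
    proof (intro integral_mono)
      fix \<omega>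
      have "var_hat \<omega> t i - d i = r * (var \<omega> i t / cov i t t - 1) + (r - d i)"
        using c[of i] by (simp add: var_hat_def r_def right_diff_distrib)
      then have "\<bar>var_hat \<omega> t i - d i\<bar> \<le> \<bar>r * (var \<omega> i t / cov i t t - 1)\<bar> + \<bar>r - d i\<bar>"
        by (simp only: abs_triangle_ineq)
      then show "\<bar>var_hat \<omega> t i - d i\<bar> \<le> r * \<bar>var \<omega> i t / cov i t t - 1\<bar> + \<bar>r - d i\<bar>"
        using r0 by (simp only: abs_mult abs_of_nonneg)
    qed (use iv var(1) in auto)
    also have "\<dots> = r * expectation (\<lambda>\<omega>. \<bar>var \<omega> i t / cov i t t - 1\<bar>) + \<bar>r - d i\<bar>"
      using var(1) by (simp add: prob_space)
    also have "\<dots> \<le> r * var_rate (m i) + \<bar>r - d i\<bar>"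
      using var(2) r0 by (simp add: mult_left_mono)
    finally show ?thesis by (simp add: r_def)
  qed
  have m1: "1 \<le> m i" for i using m[of i] by simp
  have im: "integrable N (\<lambda>\<omega>. (scaled_mean \<omega> t $ i)\<^sup>2)"
    and Em: "expectation (\<lambda>\<omega>. (scaled_mean \<omega> t $ i)\<^sup>2) = n / m i * cov i t t" for i
    using mean_second_moment[OF t m1] by (simp_all add: scaled_mean_nth power_mult_distrib)
  have iB: "integrable N B" and iR: "integrable N R"
    unfolding B_def[abs_def] R_def[abs_def] using iv im by auto
  have "expectation (\<lambda>\<omega>. \<bar>exp (- lam * q \<omega>) - exp (- lam * q' \<omega>)\<bar>) \<le> expectation (\<lambda>\<omega>. B \<omega> + 3 * lam * \<delta> * R \<omega>)"
  proof (rule integral_mono[OF _ _ pointwise])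
    show "integrable N (\<lambda>\<omega>. \<bar>exp (- lam * q \<omega>) - exp (- lam * q' \<omega>)\<bar>)"
    proof (rule integrable_const_bound[of _ 1], intro AE_I2)
      fix \<omega>
      have "exp (- lam * q \<omega>) \<le> 1" "exp (- lam * q' \<omega>) \<le> 1" using q0 lam by simp_all
      moreover have "0 < exp (- lam * q \<omega>)" "0 < exp (- lam * q' \<omega>)" by simp_all
      ultimately show "norm \<bar>exp (- lam * q \<omega>) - exp (- lam * q' \<omega>)\<bar> \<le> 1" unfolding real_norm_def by linarith
    qed measurable
    show "integrable N (\<lambda>\<omega>. B \<omega> + 3 * lam * \<delta> * R \<omega>)" using iB iR by simp
  qed
  also have "\<dots> = expectation B + 3 * lam * \<delta> * expectation R" using iB iR by simp
  also have "expectation R = (\<Sum>i\<in>UNIV. n / m i * cov i t t / d i)"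
    unfolding R_def[abs_def] using im by (simp add: Em)
  also have "expectation B = (\<Sum>i\<in>UNIV. expectation (\<lambda>\<omega>. \<bar>var_hat \<omega> t i - d i\<bar>) / (\<delta> * d i))"
    unfolding B_def[abs_def] using iv by simp
  also have "\<dots> \<le> (\<Sum>i\<in>UNIV. (n / m i * cov i t t * var_rate (m i) + \<bar>n / m i * cov i t t - d i\<bar>) / (\<delta> * d i))"
    using d \<delta> by (intro sum_mono divide_right_mono Ev) (auto simp: less_imp_le)
  finally show ?thesis unfolding q_def q'_def by simp
qed

text \<open>The factor n cancels between the squared means and the estimated weights, which leaves
  the squared t-statistic \<open>F i\<close> of each group. Cauchy-Schwarz for the sum over groups
  gives one factor \<open>CARD('k)\<close>, adding up the moment bounds the other.\<close>

lemma quad_second_moment: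
  assumes t: "t \<in> T" and m: "\<And>i. 33 \<le> m i"
  shows "(\<integral>\<^sup>+\<omega>. ennreal ((pinv_quad H (var_hat \<omega> t) (H *v scaled_mean \<omega> t))\<^sup>2) \<partial>N) \<le>
    ennreal ((real CARD('k))\<^sup>2 * tstat_const)"
proof -
  define F where "F i \<omega> = m i * (mean \<omega> i t)\<^sup>2 / var \<omega> i t" for i \<omega>
  have m1: "1 \<le> m i" "0 < m i" for i using m[of i] by auto
  have "0 < total_size m"
    unfolding total_size_def using m1 by (intro sum_pos) auto
  then have n0: "0 < n" by simp
  note T = indep_at[OF t] cov_nonneg[OF t m1(1)] GP_at(3)[OF GP_Y t]
  have [measurable]: "F i \<in> borel_measurable N" for i
    unfolding F_def[abs_def] using mean_measurable[OF t] var_measurable[OF t] by simp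
  have AE0: "AE \<omega> in N. \<forall>i. var \<omega> i t = 0 \<longrightarrow> mean \<omega> i t = 0"
    unfolding AE_all_countable
    using tstat_denominator[where X = "Y i" and t = t for i, OF m T] by simp
  have "(\<integral>\<^sup>+\<omega>. ennreal ((pinv_quad H (var_hat \<omega> t) (H *v scaled_mean \<omega> t))\<^sup>2) \<partial>N) \<le>
    (\<integral>\<^sup>+\<omega>. ennreal (real CARD('k)) * (\<Sum>i\<in>UNIV. ennreal ((F i \<omega>)\<^sup>2)) \<partial>N)"
  proof (rule nn_integral_mono_AE)
    show "AE \<omega> in N. ennreal ((pinv_quad H (var_hat \<omega> t) (H *v scaled_mean \<omega> t))\<^sup>2) \<le>
      ennreal (real CARD('k)) * (\<Sum>i\<in>UNIV. ennreal ((F i \<omega>)\<^sup>2))"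
      using AE0
    proof eventually_elim
      case (elim \<omega>)
      have "pinv_quad H (var_hat \<omega> t) (H *v scaled_mean \<omega> t) \<le> (\<Sum>i\<in>UNIV. (scaled_mean \<omega> t $ i)\<^sup>2 / var_hat \<omega> t i)"
        using elim n0 m1(2) by (intro pinv_quad_le var_hat_nonneg) (auto simp: var_hat_def scaled_mean_nth less_imp_neq[symmetric])
      also have "\<dots> = (\<Sum>i\<in>UNIV. F i \<omega>)"
        using n0 m1(2) by (intro sum.cong refl) (simp add: scaled_mean_nth var_hat_def F_def power_mult_distrib)
      finally have "(pinv_quad H (var_hat \<omega> t) (H *v scaled_mean \<omega> t))\<^sup>2 \<le> (\<Sum>i\<in>UNIV. F i \<omega>)\<^sup>2"
        by (intro power_mono pinv_quad_nonneg var_hat_nonneg)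
      also have "\<dots> \<le> real CARD('k) * (\<Sum>i\<in>UNIV. (F i \<omega>)\<^sup>2)"
        using sum_squared_le_sum_of_squares[of "\<lambda>i. F i \<omega>" UNIV] by (simp add: mult.commute)
      finally show ?case
        by (simp add: ennreal_mult[symmetric] sum_nonneg ennreal_leI)
    qed
  qed
  also have "\<dots> = ennreal (real CARD('k)) * (\<integral>\<^sup>+\<omega>. (\<Sum>i\<in>UNIV. ennreal ((F i \<omega>)\<^sup>2)) \<partial>N)"
    by (rule nn_integral_cmult) measurable
  also have "\<dots> = ennreal (real CARD('k)) * (\<Sum>i\<in>UNIV. \<integral>\<^sup>+\<omega>. ennreal ((F i \<omega>)\<^sup>2) \<partial>N)"
    by (subst nn_integral_sum) measurable
  also have "\<dots> \<le> ennreal (real CARD('k)) * (\<Sum>i\<in>(UNIV::'k set). ennreal tstat_const)"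
    unfolding F_def using tstat_moment[where X = "Y i" and t = t for i, OF m T] by (intro mult_left_mono sum_mono) auto
  also have "\<dots> = ennreal ((real CARD('k))\<^sup>2 * tstat_const)"
  proof -
    have "0 \<le> tstat_const" by (simp add: tstat_const_def)
    then show ?thesis
      by (simp add: ennreal_mult power2_eq_square mult.assoc ennreal_of_nat_eq_real_of_nat)
  qed
  finally show ?thesis .
qed

end

subsection \<open>Convergence given the data\<close>

lemma GP_vec_char:
  fixes H :: "real ^ 'k ^ 'r" and z :: "'c \<Rightarrow> real \<Rightarrow> real ^ 'r" and p :: nat
  assumes G: "GP_vec N T (\<lambda>t s. H ** Sigma_lim \<tau> \<gamma> t s ** transpose H) z"
    and ts: "\<And>j. j < p \<Longrightarrow> ts j \<in> T"
  shows "(\<integral>\<omega>. iexp (\<Sum>j<p. u j \<bullet> z \<omega> (ts j)) \<partial>N) =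
    complex_of_real (exp (- cov_form H p (\<lambda>i j j'. 1 / \<tau> i * \<gamma> i (ts j) (ts j')) u / 2))"
proof -
  have "(\<integral>\<omega>. iexp (\<Sum>j\<in>{..<p}. u j \<bullet> z \<omega> (ts j)) \<partial>N) =
    complex_of_real (exp (- (\<Sum>j\<in>{..<p}. \<Sum>j'\<in>{..<p}. u j \<bullet> ((H ** Sigma_lim \<tau> \<gamma> (ts j) (ts j') ** transpose H) *v u j')) / 2))"
    using ts by (intro gaussian_process_char(4)[OF G[unfolded GP_vec_def]]) auto
  also have "(\<Sum>j\<in>{..<p}. \<Sum>j'\<in>{..<p}. u j \<bullet> ((H ** Sigma_lim \<tau> \<gamma> (ts j) (ts j') ** transpose H) *v u j')) =
     (\<Sum>j<p. \<Sum>j'<p. \<Sum>i\<in>UNIV. (transpose H *v u j) $ i * (transpose H *v u j') $ i * (1 / \<tau> i * \<gamma> i (ts j) (ts j')))"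
    unfolding Sigma_lim_def inner_sandwich by (simp add: mult_ac del: transpose_matrix_vector)
  also have "\<dots> = (\<Sum>j<p. \<Sum>i\<in>UNIV. \<Sum>j'<p. (transpose H *v u j) $ i * (transpose H *v u j') $ i * (1 / \<tau> i * \<gamma> i (ts j) (ts j')))"
    by (rule sum.cong[OF refl]) (rule sum.swap)
  also have "\<dots> = cov_form H p (\<lambda>i j j'. 1 / \<tau> i * \<gamma> i (ts j) (ts j')) u"
    unfolding cov_form_def by (rule sum.swap)
  finally show ?thesis .
qed

text \<open>By \<open>pinv_root_variance\<close> the form is a sum of squares of centred normal
  variables of variance at most 1, so the fourth moments are at most 3. As
  \<open>tstat_const\<close> exceeds 3, one constant serves both the bootstrap and the
  limit.\<close>

lemma GP_vec_quad_second_moment: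
  fixes H :: "real ^ 'k ^ 'r" and z :: "'c \<Rightarrow> real \<Rightarrow> real ^ 'r"
  assumes G: "GP_vec N T (\<lambda>t s. H ** Sigma_lim \<tau> \<gamma> t s ** transpose H) z" and t: "t \<in> T"
    and pos: "\<And>i. 0 < 1 / \<tau> i * \<gamma> i t t"
  shows "(\<integral>\<^sup>+\<omega>. ennreal ((pinv_quad H (\<lambda>i. 1 / \<tau> i * \<gamma> i t t) (z \<omega> t))\<^sup>2) \<partial>N) \<le> ennreal ((real CARD('k))\<^sup>2 * tstat_const)"
proof -
  define d where "d i = 1 / \<tau> i * \<gamma> i t t" for i
  define X where "X k \<omega> = pinv_root H d k \<bullet> z \<omega> t" for k \<omega>
  have d: "0 < d i" for i using pos by (simp add: d_def)
  have E4: "integrable N (\<lambda>\<omega>. X k \<omega> ^ 4)" "(\<integral>\<omega>. X k \<omega> ^ 4 \<partial>N) \<le> 3" "X k \<in> borel_measurable N" for k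
  proof -
    define v where "v = pinv_root H d k \<bullet> ((H ** diag_mat d ** transpose H) *v pinv_root H d k)"
    have lin: "linear ((*v) (H ** Sigma_lim \<tau> \<gamma> t s ** transpose H))" for t s by (rule matrix_vector_mul_linear)
    note * = gaussian_process_char[OF G[unfolded GP_vec_def] lin, where A = "{t}" and ts = "\<lambda>a. a" and d = "\<lambda>_. pinv_root H d k"]
    have v: "0 \<le> v" "X k \<in> borel_measurable N" "distr N borel (X k) = centered_normal v"
      using *(1-3) t by (simp_all add: v_def X_def[abs_def] Sigma_lim_def d_def[abs_def])
    show "integrable N (\<lambda>\<omega>. X k \<omega> ^ 4)" "X k \<in> borel_measurable N"
      using centered_normal_integrable_power[OF v] v by auto
    have "v \<le> 1" unfolding v_def by (rule pinv_root_variance[OF d])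
    then have "v\<^sup>2 \<le> 1" using v(1) by (simp add: power_le_one)
    then show "(\<integral>\<omega>. X k \<omega> ^ 4 \<partial>N) \<le> 3"
      using centered_normal_moments(2)[OF v] by simp
  qed
  note [measurable] = E4(3)
  have le: "(pinv_quad H d (z \<omega> t))\<^sup>2 \<le> real CARD('k) * (\<Sum>k\<in>UNIV. X k \<omega> ^ 4)" for \<omega>
  proof -
    have "pinv_quad H d (z \<omega> t) = (\<Sum>k\<in>UNIV. (X k \<omega>)\<^sup>2)"
      unfolding X_def using d by (intro pinv_quad_eq_sum_root) (simp add: less_imp_le)
    then have "(pinv_quad H d (z \<omega> t))\<^sup>2 \<le> real CARD('k) * (\<Sum>k\<in>UNIV. ((X k \<omega>)\<^sup>2)\<^sup>2)"
      using sum_squared_le_sum_of_squares[of "\<lambda>k. (X k \<omega>)\<^sup>2" UNIV] by (simp add: mult.commute)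
    then show ?thesis by (simp flip: power_mult)
  qed
  have "(\<integral>\<^sup>+\<omega>. ennreal ((pinv_quad H d (z \<omega> t))\<^sup>2) \<partial>N) \<le> (\<integral>\<^sup>+\<omega>. ennreal (real CARD('k) * (\<Sum>k\<in>UNIV. X k \<omega> ^ 4)) \<partial>N)"
    by (intro nn_integral_mono ennreal_leI le)
  also have "\<dots> = ennreal (\<integral>\<omega>. real CARD('k) * (\<Sum>k\<in>UNIV. X k \<omega> ^ 4) \<partial>N)"
    using E4 by (intro nn_integral_eq_integral) (auto intro!: AE_I2 mult_nonneg_nonneg sum_nonneg)
  also have "\<dots> = ennreal (real CARD('k) * (\<Sum>k\<in>UNIV. \<integral>\<omega>. X k \<omega> ^ 4 \<partial>N))"
    using E4 by simp
  also have "\<dots> \<le> ennreal ((real CARD('k))\<^sup>2 * tstat_const)"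
  proof (rule ennreal_leI)
    have "(\<Sum>k\<in>UNIV. \<integral>\<omega>. X k \<omega> ^ 4 \<partial>N) \<le> (\<Sum>k\<in>(UNIV :: 'k set). tstat_const)"
    proof (rule sum_mono)
      fix k
      have "3 \<le> (105 + 256 * e) / 2" if "0 \<le> e" for e :: real using that by simp
      from this[OF exp_ge_zero] have "3 \<le> tstat_const" by (simp only: tstat_const_def)
      then show "(\<integral>\<omega>. X k \<omega> ^ 4 \<partial>N) \<le> tstat_const" using E4(2)[of k] by simp
    qed
    then show "real CARD('k) * (\<Sum>k\<in>UNIV. \<integral>\<omega>. X k \<omega> ^ 4 \<partial>N) \<le> (real CARD('k))\<^sup>2 * tstat_const"
      by (simp add: power2_eq_square mult.assoc mult_left_mono)
  qed
  finally show ?thesis unfolding d_def .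
qed

section \<open>Null sets in powers of the time domain\<close>

lemma AE_PiM_single:
  fixes p :: nat
  assumes S: "sigma_finite_measure S" and P: "AE t in S. P t" and j: "j < p"
  shows "AE ts in PiM {..<p} (\<lambda>_. S). P (ts j)"
proof -
  interpret S: sigma_finite_measure S by fact
  interpret product_sigma_finite "\<lambda>_::nat. S" ..
  obtain Z where Z: "{t \<in> space S. \<not> P t} \<subseteq> Z" "emeasure S Z = 0" "Z \<in> sets S"
    using P by (rule AE_E)
  define I where "I = {..<p} - {j}"
  have I: "{..<p} = insert j I" "finite I" "j \<notin> I" using j by (auto simp: I_def)
  have comp: "(\<lambda>ts. ts j) \<in> PiM {..<p} (\<lambda>_. S) \<rightarrow>\<^sub>M S"
    using j by (intro measurable_component_singleton) auto
  have ind: "(\<lambda>ts. indicator Z (ts j) :: ennreal) \<in> borel_measurable (PiM {..<p} (\<lambda>_. S))"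
    by (rule measurable_compose[OF comp]) (use Z in simp)
  have "(\<integral>\<^sup>+ts. indicator Z (ts j) \<partial>PiM {..<p} (\<lambda>_. S)) = (\<integral>\<^sup>+ts. (\<integral>\<^sup>+y. indicator Z y \<partial>S) \<partial>PiM I (\<lambda>_. S))"
    unfolding I(1) by (subst product_nn_integral_insert[OF I(2,3)]) (use ind I in auto)
  also have "\<dots> = 0" using Z by simp
  finally have "AE ts in PiM {..<p} (\<lambda>_. S). (indicator Z (ts j) :: ennreal) = 0"
    using ind by (subst (asm) nn_integral_0_iff_AE) auto
  then show ?thesis
  proof (rule AE_mp, intro AE_I2 impI)
    fix ts assume "ts \<in> space (PiM {..<p} (\<lambda>_. S))" "(indicator Z (ts j) :: ennreal) = 0"
    then have "ts j \<in> space S" "ts j \<notin> Z" using j by (auto simp: space_PiM indicator_def split: if_splits)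
    then show "P (ts j)" using Z by auto
  qed
qed

text \<open>Integrating the indicator of the exceptional set first over two different coordinates
  gives 0. Equal indices would stay on the diagonal, which may itself be a null set of the square;
  they are left to \<open>AE_PiM_single\<close>.\<close>

lemma AE_PiM_pair:
  fixes p :: nat
  assumes S: "sigma_finite_measure S" and P: "AE x in S \<Otimes>\<^sub>M S. P (fst x) (snd x)"
    and j: "j < p" "j' < p" "j \<noteq> j'"
  shows "AE ts in PiM {..<p} (\<lambda>_. S). P (ts j) (ts j')"
proof -
  interpret S: sigma_finite_measure S by fact
  interpret product_sigma_finite "\<lambda>_::nat. S" ..
  interpret SS: pair_sigma_finite S S ..
  obtain Z where Z: "{x \<in> space (S \<Otimes>\<^sub>M S). \<not> P (fst x) (snd x)} \<subseteq> Z" "emeasure (S \<Otimes>\<^sub>M S) Z = 0" "Z \<in> sets (S \<Otimes>\<^sub>M S)"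
    using P by (rule AE_E)
  note [measurable] = Z(3)
  define I where "I = {..<p} - {j, j'}"
  have I: "{..<p} = insert j (insert j' I)" "finite I" "finite (insert j' I)" "j \<notin> insert j' I" "j' \<notin> I"
    using j by (auto simp: I_def)
  have [measurable]: "(\<lambda>ts. ts j) \<in> PiM {..<p} (\<lambda>_. S) \<rightarrow>\<^sub>M S" "(\<lambda>ts. ts j') \<in> PiM {..<p} (\<lambda>_. S) \<rightarrow>\<^sub>M S"
    "(\<lambda>ts. ts j') \<in> PiM (insert j' I) (\<lambda>_. S) \<rightarrow>\<^sub>M S"
    using j by (auto intro!: measurable_component_singleton)
  have ind: "(\<lambda>ts. indicator Z (ts j, ts j') :: ennreal) \<in> borel_measurable (PiM {..<p} (\<lambda>_. S))"
    by measurable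
  define g where "g y' = (\<integral>\<^sup>+y. indicator Z (y, y') \<partial>S)" for y'
  have gm[measurable]: "g \<in> borel_measurable S"
    unfolding g_def[abs_def] by measurable
  have "(\<integral>\<^sup>+ts. indicator Z (ts j, ts j') \<partial>PiM {..<p} (\<lambda>_. S)) = (\<integral>\<^sup>+ts. g (ts j') \<partial>PiM (insert j' I) (\<lambda>_. S))"
    unfolding I(1) g_def by (subst product_nn_integral_insert[OF I(3,4)]) (use ind I j in auto)
  also have "\<dots> = (\<integral>\<^sup>+ts. (\<integral>\<^sup>+y'. g y' \<partial>S) \<partial>PiM I (\<lambda>_. S))"
    by (subst product_nn_integral_insert[OF I(2,5)]) auto
  also have "(\<integral>\<^sup>+y'. g y' \<partial>S) = 0"
    unfolding g_def using SS.nn_integral_snd[of "indicator Z"] Z by simp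
  finally have "(\<integral>\<^sup>+ts. indicator Z (ts j, ts j') \<partial>PiM {..<p} (\<lambda>_. S)) = 0" by simp
  then have "AE ts in PiM {..<p} (\<lambda>_. S). (indicator Z (ts j, ts j') :: ennreal) = 0"
    using ind by (subst (asm) nn_integral_0_iff_AE) auto
  then show ?thesis
  proof (rule AE_mp, intro AE_I2 impI)
    fix ts assume "ts \<in> space (PiM {..<p} (\<lambda>_. S))" "(indicator Z (ts j, ts j') :: ennreal) = 0"
    then have "(ts j, ts j') \<in> space (S \<Otimes>\<^sub>M S)" "(ts j, ts j') \<notin> Z"
      using j by (auto simp: space_PiM space_pair_measure indicator_def split: if_splits)
    then show "P (ts j) (ts j')" using Z by auto
  qed
qed

lemma bootstrap_sizes:
  fixes ns :: "nat \<Rightarrow> 'k::finite \<Rightarrow> nat"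
  assumes size: "filterlim (\<lambda>l. total_size (ns l)) at_top sequentially"
    and \<tau>: "\<And>i. 0 < \<tau> i" and ratio: "\<And>i. (\<lambda>l. real (ns l i) / real (total_size (ns l))) \<longlonglongrightarrow> \<tau> i"
  shows "filterlim (\<lambda>l. ns l i) at_top sequentially"
    and "\<forall>\<^sub>F l in sequentially. \<forall>i. K \<le> ns l i"
    and "(\<lambda>l. real (total_size (ns l)) / real (ns l i)) \<longlonglongrightarrow> 1 / \<tau> i"
proof -
  have n: "filterlim (\<lambda>l. real (total_size (ns l))) at_top sequentially"
    using filterlim_compose[OF filterlim_real_sequentially size] .
  have *: "filterlim (\<lambda>l. ns l i) at_top sequentially" for i
  proof -
    have "filterlim (\<lambda>l. real (ns l i) / real (total_size (ns l)) * real (total_size (ns l))) at_top sequentially"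
      by (rule filterlim_tendsto_pos_mult_at_top[OF ratio \<tau> n])
    moreover have "\<forall>\<^sub>F l in sequentially. 1 \<le> total_size (ns l)"
      using size unfolding filterlim_at_top by blast
    then have "\<forall>\<^sub>F l in sequentially. real (ns l i) / real (total_size (ns l)) * real (total_size (ns l)) = real (ns l i)"
      by eventually_elim simp
    ultimately have "filterlim (\<lambda>l. real (ns l i)) at_top sequentially"
      by (simp cong: filterlim_cong)
    then have "\<forall>\<^sub>F l in sequentially. real Z \<le> real (ns l i)" for Z
      unfolding filterlim_at_top by blast
    then show ?thesis by (simp add: filterlim_at_top)
  qed
  then show "filterlim (\<lambda>l. ns l i) at_top sequentially" .
  show "\<forall>\<^sub>F l in sequentially. \<forall>i. K \<le> ns l i"
    using * by (intro eventually_all_finite) (simp add: filterlim_at_top)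
  have "(\<lambda>l. inverse (real (ns l i) / real (total_size (ns l)))) \<longlonglongrightarrow> inverse (\<tau> i)"
    using \<tau>[of i] by (intro tendsto_inverse ratio) simp
  then show "(\<lambda>l. real (total_size (ns l)) / real (ns l i)) \<longlonglongrightarrow> 1 / \<tau> i"
    by (simp add: inverse_eq_divide)
qed

text \<open>The data enter as one fixed array \<open>x\<close>; all that is retained of their
  randomness is \<open>conv\<close> and \<open>conv_diag\<close>. The limit of the transforms is
  found for q', the form with the limiting weights, and the passage from q to q' is bounded by a sum
  of errors at single times.\<close>

theorem bootstrap_weak_conv:
  fixes N :: "nat \<Rightarrow> 'b measure" and H :: "real ^ 'k ^ 'r" and ns :: "nat \<Rightarrow> 'k \<Rightarrow> nat"
    and Y :: "nat \<Rightarrow> 'k \<Rightarrow> nat \<Rightarrow> 'b \<Rightarrow> real \<Rightarrow> real" and z :: "'c \<Rightarrow> real \<Rightarrow> real ^ 'r" and a b :: real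
  defines "T \<equiv> {a..b}" and "S \<equiv> restrict_space lborel {a..b}"
  assumes boot: "\<And>l. parametric_bootstrap (N l) T (ns l) x (Y l)"
    and size: "filterlim (\<lambda>l. total_size (ns l)) at_top sequentially"
    and \<tau>: "\<And>i. 0 < \<tau> i" and ratio: "\<And>i. (\<lambda>l. real (ns l i) / real (total_size (ns l))) \<longlonglongrightarrow> \<tau> i"
    and \<gamma>c: "\<And>i. continuous_on T (\<lambda>t. \<gamma> i t t)" and \<gamma>pos: "\<And>i t. t \<in> T \<Longrightarrow> 0 < \<gamma> i t t"
    and conv: "AE ts in S \<Otimes>\<^sub>M S. \<forall>i. (\<lambda>l. sample_cov (ns l i) (x i) (fst ts) (snd ts)) \<longlonglongrightarrow> \<gamma> i (fst ts) (snd ts)"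
    and conv_diag: "AE t in S. \<forall>i. (\<lambda>l. sample_cov (ns l i) (x i) t t) \<longlonglongrightarrow> \<gamma> i t t"
    and z: "GP_vec Nz T (\<lambda>t s. H ** Sigma_lim \<tau> \<gamma> t s ** transpose H) z"
  shows "weak_conv_m (\<lambda>l. distr (N l) borel (\<lambda>\<omega>. statistic T H (ns l) (\<lambda>i j. Y l i j \<omega>)))
     (distr Nz borel (\<lambda>\<omega>. LBINT t:T. z \<omega> t \<bullet> (pinv (H ** Sigma_lim \<tau> \<gamma> t t ** transpose H) *v z \<omega> t)))"
proof -
  interpret B: bootstrap_sample "N l" T "ns l" x "Y l" H for l
    by unfold_locales (rule boot)
  interpret Nz: prob_space Nz
    using z by (simp add: GP_vec_def centered_gaussian_process_def)
  have S: "finite_measure S"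
    unfolding S_def by (intro finite_measureI) (simp add: space_restrict_space emeasure_restrict_space emeasure_lborel_Icc_eq)
  interpret S: finite_measure S by fact
  have space_S: "space S = T" by (simp add: S_def T_def space_restrict_space)
  define d where "d t i = 1 / \<tau> i * \<gamma> i t t" for t i
  have dpos: "0 < d t i" if "t \<in> T" for t i using \<tau>[of i] \<gamma>pos[OF that] by (simp add: d_def)
  define y where "y l \<omega> t = H *v B.scaled_mean l \<omega> t" for l \<omega> t
  define q where "q l \<omega> t = pinv_quad H (B.var_hat l \<omega> t) (y l \<omega> t)" for l \<omega> t
  define q0 where "q0 \<omega> t = pinv_quad H (d t) (z \<omega> t)" for \<omega> t
  have set_int: "(LBINT t:T. f t) = (\<integral>t. f t \<partial>S)" for f :: "real \<Rightarrow> real"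
    unfolding S_def T_def set_lebesgue_integral_def by (subst integral_restrict_space) auto
  have stat: "statistic T H (ns l) (\<lambda>i j. Y l i j \<omega>) = (\<integral>t. q l \<omega> t \<partial>S)" for l \<omega>
    unfolding B.statistic_eq set_int q_def y_def ..
  have lim: "(LBINT t:T. z \<omega> t \<bullet> (pinv (H ** Sigma_lim \<tau> \<gamma> t t ** transpose H) *v z \<omega> t)) = (\<integral>t. q0 \<omega> t \<partial>S)" for \<omega>
    unfolding set_int q0_def pinv_quad_def Sigma_lim_def d_def[abs_def] ..
  note sizes = bootstrap_sizes[OF size \<tau> ratio]
  show ?thesis
    unfolding stat lim
  proof (rule time_integral_weak_conv[OF _ Nz.prob_space_axioms S])
    show "prob_space (N l)" for l by (rule B.prob_space_axioms)
    show "(\<lambda>(\<omega>, t). q l \<omega> t) \<in> borel_measurable (N l \<Otimes>\<^sub>M S)" for l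
    proof -
      have Ym: "(\<lambda>x. Y l i j (fst x) (snd x)) \<in> borel_measurable (N l \<Otimes>\<^sub>M S)" if "j \<in> {1..ns l i}" for i j
      proof -
        have "measurable_process (N l) T (Y l i j)"
          using B.GP_Y[OF that] by (simp add: GP_def centered_gaussian_process_def)
        from measurable_process_restrict_lborel[OF this]
        show ?thesis by (simp add: S_def T_def case_prod_beta')
      qed
      have mm: "(\<lambda>x. sample_mean (ns l i) (\<lambda>j. Y l i j (fst x)) (snd x)) \<in> borel_measurable (N l \<Otimes>\<^sub>M S)" for i
        unfolding sample_mean_def by (intro borel_measurable_times borel_measurable_sum Ym) auto
      have vm: "(\<lambda>x. B.var_hat l (fst x) (snd x) i) \<in> borel_measurable (N l \<Otimes>\<^sub>M S)" for i
        unfolding B.var_hat_def sample_cov_def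
        by (intro borel_measurable_times borel_measurable_sum borel_measurable_diff Ym mm) auto
      have "(\<lambda>x. y l (fst x) (snd x) $ i) \<in> borel_measurable (N l \<Otimes>\<^sub>M S)" for i
        using mm by (simp add: y_def matrix_vector_mult_def B.scaled_mean_nth)
      with vm show ?thesis
        unfolding q_def case_prod_beta' by (intro borel_measurable_pinv_quad)
    qed
    show "(\<lambda>(\<omega>, t). q0 \<omega> t) \<in> borel_measurable (Nz \<Otimes>\<^sub>M S)"
    proof -
      have "measurable_process Nz T z" using z by (simp add: GP_vec_def centered_gaussian_process_def)
      from measurable_process_restrict_lborel[OF this]
      have "(\<lambda>x. z (fst x) (snd x)) \<in> borel_measurable (Nz \<Otimes>\<^sub>M S)"
        by (simp add: S_def T_def case_prod_beta')
      then have zm: "(\<lambda>x. z (fst x) (snd x) $ i) \<in> borel_measurable (Nz \<Otimes>\<^sub>M S)" for i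
        by (rule measurable_compose[OF _ borel_measurable_vec_nth])
      have "(\<lambda>t. \<gamma> i t t) \<in> borel_measurable S" for i
      proof -
        have "(\<lambda>t. \<gamma> i t t) \<in> borel_measurable (restrict_space borel T)"
          by (rule borel_measurable_continuous_on_restrict[OF \<gamma>c])
        moreover have "sets (restrict_space borel T) = sets S"
          unfolding S_def T_def by (intro sets_restrict_space_cong) simp
        ultimately show ?thesis by (simp cong: measurable_cong_sets)
      qed
      then have "(\<lambda>x. d (snd x) i) \<in> borel_measurable (Nz \<Otimes>\<^sub>M S)" for i
        unfolding d_def by (intro borel_measurable_times borel_measurable_const measurable_compose[OF measurable_snd])
      with zm show ?thesis
        unfolding q0_def case_prod_beta' by (intro borel_measurable_pinv_quad)
    qed
    show "0 \<le> q l \<omega> t" for l \<omega> t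
      unfolding q_def by (intro pinv_quad_nonneg B.var_hat_nonneg)
    show "0 \<le> q0 \<omega> t" if "t \<in> space S" for \<omega> t
      unfolding q0_def using dpos that by (intro pinv_quad_nonneg) (auto simp: space_S less_imp_le)
    show "\<forall>\<^sub>F l in sequentially. \<forall>t\<in>space S. (\<integral>\<^sup>+\<omega>. ennreal ((q l \<omega> t)\<^sup>2) \<partial>N l) \<le> ennreal ((real CARD('k))\<^sup>2 * tstat_const)"
      using sizes(2)[of 33]
      by eventually_elim (auto simp: q_def y_def space_S intro!: B.quad_second_moment)
    show "(\<integral>\<^sup>+\<omega>. ennreal ((q0 \<omega> t)\<^sup>2) \<partial>Nz) \<le> ennreal ((real CARD('k))\<^sup>2 * tstat_const)" if "t \<in> space S" for t
      using that dpos[of t] unfolding q0_def d_def[abs_def] space_S by (intro GP_vec_quad_second_moment[OF z])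
    show "0 \<le> (real CARD('k))\<^sup>2 * tstat_const" by (simp add: tstat_const_def)
    fix lam :: real and p :: nat assume lam: "0 < lam"
    \<comment> \<open>Different coordinates are covered by \<open>conv\<close>, equal ones by
      \<open>conv_diag\<close>; only finitely many null sets are joined.\<close>
    have "AE ts in PiM {..<p} (\<lambda>_. S). \<forall>j\<in>{..<p}. \<forall>j'\<in>{..<p}. \<forall>i. (\<lambda>l. sample_cov (ns l i) (x i) (ts j) (ts j')) \<longlonglongrightarrow> \<gamma> i (ts j) (ts j')"
    proof (intro AE_finite_allI finite_lessThan)
      fix j j' assume "j \<in> {..<p}" "j' \<in> {..<p}"
      then show "AE ts in PiM {..<p} (\<lambda>_. S). \<forall>i. (\<lambda>l. sample_cov (ns l i) (x i) (ts j) (ts j')) \<longlonglongrightarrow> \<gamma> i (ts j) (ts j')"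
        using AE_PiM_single[OF S.sigma_finite_measure_axioms conv_diag, of j p]
          AE_PiM_pair[OF S.sigma_finite_measure_axioms conv, of j p j']
        by (cases "j = j'") auto
    qed
    then show "AE ts in PiM {..<p} (\<lambda>_. S). (\<lambda>l. \<integral>\<omega>. exp (- lam * (\<Sum>j<p. q l \<omega> (ts j))) \<partial>N l) \<longlonglongrightarrow>
        (\<integral>\<omega>. exp (- lam * (\<Sum>j<p. q0 \<omega> (ts j))) \<partial>Nz)"
    proof (rule AE_mp, intro AE_I2 impI)
      fix ts assume sp: "ts \<in> space (PiM {..<p} (\<lambda>_. S))"
        and good: "\<forall>j\<in>{..<p}. \<forall>j'\<in>{..<p}. \<forall>i. (\<lambda>l. sample_cov (ns l i) (x i) (ts j) (ts j')) \<longlonglongrightarrow> \<gamma> i (ts j) (ts j')"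
      have T: "ts j \<in> T" if "j < p" for j using sp that by (auto simp: space_PiM space_S)
      define q' where "q' l \<omega> t = pinv_quad H (d t) (y l \<omega> t)" for l \<omega> t
      define D where "D l j = B.expectation l (\<lambda>\<omega>. \<bar>exp (- lam * q l \<omega> (ts j)) - exp (- lam * q' l \<omega> (ts j))\<bar>)" for l j
      have D: "(\<lambda>l. D l j) \<longlonglongrightarrow> 0" if j: "j < p" for j
      proof (rule LIMSEQ_I)
        fix e :: real assume e: "0 < e"
        define t where "t = ts j"
        have t: "t \<in> T" using T[OF j] by (simp add: t_def)
        define r where "r l i = real (total_size (ns l)) / real (ns l i) * sample_cov (ns l i) (x i) t t" for l i
        have cov: "(\<lambda>l. sample_cov (ns l i) (x i) t t) \<longlonglongrightarrow> \<gamma> i t t" for i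
          using good j by (simp add: t_def)
        have r: "(\<lambda>l. r l i) \<longlonglongrightarrow> d t i" for i
          unfolding r_def d_def by (intro tendsto_mult sizes(3) cov)
        \<comment> \<open>The second entry makes 3 lam \<delta> \<open>CARD('k)\<close> at most e /
          2; the first meets the requirement of \<open>studentization_error\<close>.\<close>
        define \<delta> where "\<delta> = min (1/2) (e / (6 * lam * CARD('k)))"
        have \<delta>: "0 < \<delta>" "\<delta> \<le> 1/2" using e lam by (auto simp: \<delta>_def)
        have \<delta>e: "3 * lam * \<delta> * CARD('k) < e"
        proof -
          have "\<delta> \<le> e / (6 * lam * CARD('k))" by (simp add: \<delta>_def)
          then have "\<delta> * (6 * lam * CARD('k)) \<le> e"
            using lam by (subst (asm) pos_le_divide_eq) auto
          then show ?thesis using e by (simp add: mult_ac)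
        qed
        define bound where "bound l = (\<Sum>i\<in>UNIV. (r l i * var_rate (ns l i) + \<bar>r l i - d t i\<bar>) / (\<delta> * d t i)) +
          3 * lam * \<delta> * (\<Sum>i\<in>UNIV. r l i / d t i)" for l
        \<comment> \<open>The limit is not 0: the perturbation term keeps 3 lam \<delta>
          \<open>CARD('k)\<close>, as each ratio of r to its limit tends to 1, and the choice of
          \<delta> puts this below e.\<close>
        have "bound \<longlonglongrightarrow> (\<Sum>i\<in>(UNIV::'k set). (d t i * 0 + \<bar>d t i - d t i\<bar>) / (\<delta> * d t i)) + 3 * lam * \<delta> * (\<Sum>i\<in>(UNIV::'k set). d t i / d t i)"
          unfolding bound_def[abs_def] using dpos[OF t] \<delta>
          by (intro tendsto_intros r filterlim_compose[OF var_rate_tendsto] sizes(1)) (auto simp: less_imp_neq[symmetric])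
        also have "(\<Sum>i\<in>(UNIV::'k set). (d t i * 0 + \<bar>d t i - d t i\<bar>) / (\<delta> * d t i)) + 3 * lam * \<delta> * (\<Sum>i\<in>(UNIV::'k set). d t i / d t i) = 3 * lam * \<delta> * CARD('k)"
          using dpos[OF t] by (simp add: less_imp_neq[symmetric])
        finally have "\<forall>\<^sub>F l in sequentially. bound l < e"
          using \<delta>e by (rule order_tendstoD)
        moreover have "\<forall>\<^sub>F l in sequentially. \<forall>i. 0 < sample_cov (ns l i) (x i) t t"
          using order_tendstoD(1)[OF cov \<gamma>pos[OF t]] by (intro eventually_all_finite) auto
        ultimately have "\<forall>\<^sub>F l in sequentially. norm (D l j - 0) < e"
          using sizes(2)[of 2]
        proof eventually_elim
          case (elim l)
          have "D l j \<le> bound l"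
            unfolding D_def q_def q'_def y_def bound_def r_def t_def[symmetric]
            using elim dpos[OF t] \<delta> lam t by (intro B.studentization_error) auto
          moreover have "0 \<le> D l j" by (simp add: D_def integral_nonneg_AE)
          ultimately show ?case using elim by simp
        qed
        then show "\<exists>l0. \<forall>l\<ge>l0. norm (D l j - 0) < e" by (simp add: eventually_sequentially)
      qed
      have main: "(\<lambda>l. \<integral>\<omega>. exp (- lam * (\<Sum>j<p. q' l \<omega> (ts j))) \<partial>N l) \<longlonglongrightarrow> (\<integral>\<omega>. exp (- lam * (\<Sum>j<p. q0 \<omega> (ts j))) \<partial>Nz)"
        unfolding q'_def q0_def
      proof (rule laplace_transform_quadratic_tendsto[OF _ Nz.prob_space_axioms])
        show "prob_space (N l)" for l by (rule B.prob_space_axioms)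
        show "(\<lambda>\<omega>. y l \<omega> (ts j)) \<in> borel_measurable (N l)" if "j < p" for l j
          unfolding y_def by (rule B.scaled_mean_measurable[OF T[OF that]])
        show "(\<lambda>\<omega>. z \<omega> (ts j)) \<in> borel_measurable Nz" if "j < p" for j
          using z T[OF that] by (intro measurable_process_at[of _ T]) (auto simp: GP_vec_def centered_gaussian_process_def)
        show "(\<integral>\<omega>. iexp (\<Sum>j<p. u j \<bullet> y l \<omega> (ts j)) \<partial>N l) =
          complex_of_real (exp (- cov_form H p (\<lambda>i j j'. real (total_size (ns l)) / real (ns l i) * sample_cov (ns l i) (x i) (ts j) (ts j')) u / 2))" for l u
          unfolding y_def by (rule B.scaled_mean_char[OF T])
        show "(\<integral>\<omega>. iexp (\<Sum>j<p. u j \<bullet> z \<omega> (ts j)) \<partial>Nz) =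
          complex_of_real (exp (- cov_form H p (\<lambda>i j j'. 1 / \<tau> i * \<gamma> i (ts j) (ts j')) u / 2))" for u
          by (rule GP_vec_char[OF z T])
        show "(\<lambda>l. real (total_size (ns l)) / real (ns l i) * sample_cov (ns l i) (x i) (ts j) (ts j')) \<longlonglongrightarrow> 1 / \<tau> i * \<gamma> i (ts j) (ts j')"
          if "j < p" "j' < p" for i j j'
          using good that by (intro tendsto_mult sizes(3)) auto
        show "0 \<le> d (ts j) i" if "j < p" for j i using dpos[OF T[OF that]] by (simp add: less_imp_le)
        show "0 \<le> lam" using lam by simp
      qed
      have diff: "norm ((\<integral>\<omega>. exp (- lam * (\<Sum>j<p. q l \<omega> (ts j))) \<partial>N l) - (\<integral>\<omega>. exp (- lam * (\<Sum>j<p. q' l \<omega> (ts j))) \<partial>N l)) \<le> (\<Sum>j<p. D l j)" for l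
      proof -
        have qm[measurable]: "(\<lambda>\<omega>. q l \<omega> (ts j)) \<in> borel_measurable (N l)" "(\<lambda>\<omega>. q' l \<omega> (ts j)) \<in> borel_measurable (N l)" if "j < p" for j
          unfolding q_def q'_def y_def by (rule B.quad_measurable[OF T[OF that]])+
        have qn: "0 \<le> q l \<omega> (ts j)" "0 \<le> q' l \<omega> (ts j)" if "j < p" for \<omega> j
          unfolding q_def q'_def using dpos[OF T[OF that]] by (auto intro!: pinv_quad_nonneg B.var_hat_nonneg simp: less_imp_le)
        have e1: "\<bar>exp (- lam * u)\<bar> \<le> 1" if "0 \<le> u" for u using that lam by simp
        have ip: "integrable (N l) (\<lambda>\<omega>. exp (- lam * (\<Sum>j<p. q l \<omega> (ts j))))" "integrable (N l) (\<lambda>\<omega>. exp (- lam * (\<Sum>j<p. q' l \<omega> (ts j))))"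
          using qn by (auto intro!: B.integrable_const_bound[of _ 1] AE_I2 mult_nonneg_nonneg sum_nonneg borel_measurable_exp borel_measurable_times borel_measurable_sum borel_measurable_uminus less_imp_le[OF lam] qm)
        have id: "integrable (N l) (\<lambda>\<omega>. \<bar>exp (- lam * q l \<omega> (ts j)) - exp (- lam * q' l \<omega> (ts j))\<bar>)" if "j < p" for j
        proof (intro integrable_abs Bochner_Integration.integrable_diff)
          show "integrable (N l) (\<lambda>\<omega>. exp (- lam * q l \<omega> (ts j)))"
            using qm(1)[OF that] e1[OF qn(1)[OF that]] by (intro B.integrable_const_bound[of _ 1]) auto
          show "integrable (N l) (\<lambda>\<omega>. exp (- lam * q' l \<omega> (ts j)))"
            using qm(2)[OF that] e1[OF qn(2)[OF that]] by (intro B.integrable_const_bound[of _ 1]) auto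
        qed
        \<comment> \<open>Both exponentials are products over j of factors in [0, 1], and two such
          products differ by at most the sum of the differences of their factors.\<close>
        have pw: "\<bar>exp (- lam * (\<Sum>j<p. q l \<omega> (ts j))) - exp (- lam * (\<Sum>j<p. q' l \<omega> (ts j)))\<bar> \<le>
          (\<Sum>j<p. \<bar>exp (- lam * q l \<omega> (ts j)) - exp (- lam * q' l \<omega> (ts j))\<bar>)" for \<omega>
        proof -
          have "norm ((\<Prod>j\<in>{..<p}. exp (- lam * q l \<omega> (ts j))) - (\<Prod>j\<in>{..<p}. exp (- lam * q' l \<omega> (ts j)))) \<le>
            (\<Sum>j\<in>{..<p}. norm (exp (- lam * q l \<omega> (ts j)) - exp (- lam * q' l \<omega> (ts j))))"
            using qn e1 by (intro norm_prod_diff) auto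
          then show ?thesis
            unfolding sum_distrib_left exp_sum[OF finite_lessThan] real_norm_def .
        qed
        have "norm ((\<integral>\<omega>. exp (- lam * (\<Sum>j<p. q l \<omega> (ts j))) \<partial>N l) - (\<integral>\<omega>. exp (- lam * (\<Sum>j<p. q' l \<omega> (ts j))) \<partial>N l)) =
          norm (\<integral>\<omega>. exp (- lam * (\<Sum>j<p. q l \<omega> (ts j))) - exp (- lam * (\<Sum>j<p. q' l \<omega> (ts j))) \<partial>N l)"
          using ip by simp
        also have "\<dots> \<le> (\<integral>\<omega>. norm (exp (- lam * (\<Sum>j<p. q l \<omega> (ts j))) - exp (- lam * (\<Sum>j<p. q' l \<omega> (ts j)))) \<partial>N l)"
          by (rule integral_norm_bound)
        also have "\<dots> \<le> (\<integral>\<omega>. (\<Sum>j<p. \<bar>exp (- lam * q l \<omega> (ts j)) - exp (- lam * q' l \<omega> (ts j))\<bar>) \<partial>N l)"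
        proof (rule integral_mono)
          show "integrable (N l) (\<lambda>\<omega>. norm (exp (- lam * (\<Sum>j<p. q l \<omega> (ts j))) - exp (- lam * (\<Sum>j<p. q' l \<omega> (ts j)))))"
            by (intro integrable_norm Bochner_Integration.integrable_diff ip)
          show "integrable (N l) (\<lambda>\<omega>. \<Sum>j<p. \<bar>exp (- lam * q l \<omega> (ts j)) - exp (- lam * q' l \<omega> (ts j))\<bar>)"
            by (intro Bochner_Integration.integrable_sum id) auto
        qed (use pw in simp)
        also have "\<dots> = (\<Sum>j<p. D l j)"
          unfolding D_def by (rule Bochner_Integration.integral_sum) (use id in auto)
        finally show ?thesis .
      qed
      have "(\<lambda>l. \<Sum>j<p. D l j) \<longlonglongrightarrow> (\<Sum>j<p. 0)" by (intro tendsto_sum D) auto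
      then have "(\<lambda>l. \<Sum>j<p. D l j) \<longlonglongrightarrow> 0" by simp
      then have "(\<lambda>l. (\<integral>\<omega>. exp (- lam * (\<Sum>j<p. q l \<omega> (ts j))) \<partial>N l) - (\<integral>\<omega>. exp (- lam * (\<Sum>j<p. q' l \<omega> (ts j))) \<partial>N l)) \<longlonglongrightarrow> 0"
        by (rule Lim_null_comparison[rotated]) (use diff in simp)
      from tendsto_add[OF this main]
      show "(\<lambda>l. \<integral>\<omega>. exp (- lam * (\<Sum>j<p. q l \<omega> (ts j))) \<partial>N l) \<longlonglongrightarrow> (\<integral>\<omega>. exp (- lam * (\<Sum>j<p. q0 \<omega> (ts j))) \<partial>Nz)"
        by simp
    qed
  qed
qed

subsection \<open>Consistency of the sample covariances\<close>

text \<open>Extracting a subsequence at each time separately would make it depend on the time, and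
  the times may be uncountable. On the product of \<open>M\<close> and \<open>Q\<close>, dominated
  convergence with the constant \<open>B\<close> gives convergence in mean; a single almost
  everywhere convergent subsequence there serves almost all times by Fubini.\<close>

lemma AE_subsequence_of_L1:
  fixes h :: "nat \<Rightarrow> 'a \<Rightarrow> 's \<Rightarrow> real"
  assumes M: "prob_space M" and Q: "finite_measure Q"
    and h[measurable]: "\<And>l. (\<lambda>(\<omega>, t). h l \<omega> t) \<in> borel_measurable (M \<Otimes>\<^sub>M Q)"
    and nonneg: "\<And>l \<omega> t. 0 \<le> h l \<omega> t"
    and int: "\<And>l t. t \<in> space Q \<Longrightarrow> integrable M (\<lambda>\<omega>. h l \<omega> t)"
    and bound: "\<And>l t. t \<in> space Q \<Longrightarrow> (\<integral>\<omega>. h l \<omega> t \<partial>M) \<le> B"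
    and lim: "\<And>t. t \<in> space Q \<Longrightarrow> (\<lambda>l. \<integral>\<omega>. h l \<omega> t \<partial>M) \<longlonglongrightarrow> 0"
  obtains g :: "nat \<Rightarrow> nat" where "strict_mono g" "AE \<omega> in M. AE t in Q. (\<lambda>l. h (g l) \<omega> t) \<longlonglongrightarrow> 0"
proof -
  interpret M: prob_space M by fact
  interpret Q: finite_measure Q by fact
  interpret MQ: pair_sigma_finite M Q ..
  have hf[measurable]: "(\<lambda>x. h l (fst x) (snd x)) \<in> borel_measurable (M \<Otimes>\<^sub>M Q)" for l
    using h[of l] by (simp add: case_prod_beta')
  define e where "e l t = (\<integral>\<omega>. h l \<omega> t \<partial>M)" for l t
  have e0: "0 \<le> e l t" for l t unfolding e_def using nonneg by (simp add: integral_nonneg_AE)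
  have em[measurable]: "e l \<in> borel_measurable Q" for l
  proof -
    have "(\<lambda>(t, \<omega>). h l \<omega> t) \<in> borel_measurable (Q \<Otimes>\<^sub>M M)"
      using measurable_compose[OF measurable_pair_swap' hf] by (simp add: case_prod_beta')
    then show ?thesis unfolding e_def[abs_def] by (rule M.borel_measurable_lebesgue_integral)
  qed
  have eb: "AE t in Q. norm (e l t) \<le> B" for l
    using bound e0 by (intro AE_I2) (simp add: e_def[symmetric])
  have ei: "integrable Q (e l)" for l
    by (rule Q.integrable_const_bound[OF eb em])
  have nn: "(\<integral>\<^sup>+x. ennreal (h l (fst x) (snd x)) \<partial>(M \<Otimes>\<^sub>M Q)) = ennreal (\<integral>t. e l t \<partial>Q)" for l
  proof -
    have "(\<integral>\<^sup>+x. ennreal (h l (fst x) (snd x)) \<partial>(M \<Otimes>\<^sub>M Q)) = (\<integral>\<^sup>+t. (\<integral>\<^sup>+\<omega>. ennreal (h l \<omega> t) \<partial>M) \<partial>Q)"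
      using MQ.nn_integral_snd[of "\<lambda>x. ennreal (h l (fst x) (snd x))"] by simp
    also have "\<dots> = (\<integral>\<^sup>+t. ennreal (e l t) \<partial>Q)"
      unfolding e_def by (intro nn_integral_cong nn_integral_eq_integral int) (auto simp: nonneg)
    also have "\<dots> = ennreal (\<integral>t. e l t \<partial>Q)"
      by (intro nn_integral_eq_integral ei) (simp add: e0)
    finally show ?thesis .
  qed
  have hi: "integrable (M \<Otimes>\<^sub>M Q) (\<lambda>x. h l (fst x) (snd x))" for l
    by (rule integrableI_nonneg) (auto simp: nn nonneg)
  have "(\<integral>x. norm (h l (fst x) (snd x)) \<partial>(M \<Otimes>\<^sub>M Q)) = (\<integral>t. e l t \<partial>Q)" for l
    using nn[of l] nn_integral_eq_integral[OF hi[of l]] nonneg e0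
    by (simp add: integral_nonneg_AE)
  moreover have "(\<lambda>l. \<integral>t. e l t \<partial>Q) \<longlonglongrightarrow> (\<integral>t. 0 \<partial>Q)"
  proof (rule integral_dominated_convergence[where w = "\<lambda>_. B"])
    show "AE t in Q. (\<lambda>l. e l t) \<longlonglongrightarrow> 0" using lim by (intro AE_I2) (simp add: e_def)
  qed (use eb in auto)
  ultimately have "(\<lambda>l. \<integral>x. norm (h l (fst x) (snd x)) \<partial>(M \<Otimes>\<^sub>M Q)) \<longlonglongrightarrow> 0" by simp
  from tendsto_L1_AE_subseq[OF hi this]
  obtain g where g: "strict_mono g" "AE x in M \<Otimes>\<^sub>M Q. (\<lambda>l. h (g l) (fst x) (snd x)) \<longlonglongrightarrow> 0" by auto
  from MQ.AE_pair[OF g(2)] have "AE \<omega> in M. AE t in Q. (\<lambda>l. h (g l) \<omega> t) \<longlonglongrightarrow> 0" by simp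
  with g(1) show ?thesis by (rule that)
qed

section \<open>The weak law for sample covariances at a pair of times\<close>

locale functional_samples = prob_space M
  for M :: "'a measure" +
  fixes T :: "real set" and x :: "'k::finite \<Rightarrow> nat \<Rightarrow> 'a \<Rightarrow> real \<Rightarrow> real"
    and \<eta> :: "'k \<Rightarrow> real \<Rightarrow> real" and \<gamma> :: "'k \<Rightarrow> real \<Rightarrow> real \<Rightarrow> real"
  assumes indep: "indep_vars (\<lambda>_. path_space T) (\<lambda>(i, j). path_on T (x i j)) (UNIV \<times> {1..})"
    and meas: "\<And>i j. j \<ge> 1 \<Longrightarrow> measurable_process M T (x i j)"
    and ident: "\<And>i j. j \<ge> 1 \<Longrightarrow>
           distr M (path_space T) (path_on T (x i j)) = distr M (path_space T) (path_on T (x i 1))"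
    and square_int: "\<And>i j t. j \<ge> 1 \<Longrightarrow> t \<in> T \<Longrightarrow> integrable M (\<lambda>\<omega>. (x i j \<omega> t)\<^sup>2)"
    and mean: "\<And>i j t. j \<ge> 1 \<Longrightarrow> t \<in> T \<Longrightarrow> (\<integral>\<omega>. x i j \<omega> t \<partial>M) = \<eta> i t"
    and cov: "\<And>i j t s. j \<ge> 1 \<Longrightarrow> t \<in> T \<Longrightarrow> s \<in> T \<Longrightarrow>
           (\<integral>\<omega>. (x i j \<omega> t - \<eta> i t) * (x i j \<omega> s - \<eta> i s) \<partial>M) = \<gamma> i t s"
begin

lemma path_measurable: "1 \<le> j \<Longrightarrow> path_on T (x i j) \<in> M \<rightarrow>\<^sub>M path_space T"
  unfolding path_on_def using measurable_process_at[OF meas]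
  by (intro measurable_restrict) auto

lemma indep_functional:
  assumes f: "f \<in> borel_measurable (path_space T)"
  shows "indep_vars (\<lambda>_. borel) (\<lambda>j \<omega>. f (path_on T (x i j) \<omega>)) {1..m}"
proof -
  let ?g = "\<lambda>ij \<omega>. f ((case ij of (i, j) \<Rightarrow> path_on T (x i j)) \<omega>)"
  have "indep_vars (\<lambda>_. borel) ?g (UNIV \<times> {1..})"
    by (rule indep_vars_compose2[OF indep]) (rule f)
  then have "indep_vars (\<lambda>j. PiM {(i, j)} (\<lambda>_. borel)) (\<lambda>j \<omega>. restrict (\<lambda>ij. ?g ij \<omega>) {(i, j)}) {1..m}"
    by (rule indep_vars_restrict) (auto simp: disjoint_family_on_def)
  then have "indep_vars (\<lambda>_. borel) (\<lambda>j \<omega>. (\<lambda>h. h (i, j)) (restrict (\<lambda>ij. ?g ij \<omega>) {(i, j)})) {1..m}"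
    by (rule indep_vars_compose2) (rule measurable_component_singleton, simp)
  then show ?thesis by simp
qed

lemma distr_functional:
  assumes f: "f \<in> borel_measurable (path_space T)" and j: "1 \<le> j"
  shows "distr M borel (\<lambda>\<omega>. f (path_on T (x i j) \<omega>)) = distr M borel (\<lambda>\<omega>. f (path_on T (x i 1) \<omega>))"
proof -
  have *: "distr M borel (\<lambda>\<omega>. f (path_on T (x i j) \<omega>)) = distr (distr M (path_space T) (path_on T (x i j))) borel f"
    if "1 \<le> j" for j
    using distr_distr[OF f path_measurable[OF that]] by (simp add: comp_def)
  show ?thesis
    using *[OF j] *[of 1] ident[OF j] by simp
qed

definition centered :: "'k \<Rightarrow> nat \<Rightarrow> 'a \<Rightarrow> real \<Rightarrow> real" where
  "centered i j \<omega> t = x i j \<omega> t - \<eta> i t"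

lemma eval_measurable: "t \<in> T \<Longrightarrow> (\<lambda>y. y t) \<in> borel_measurable (path_space T)"
  by (rule measurable_component_singleton)

lemma centered_measurable: "t \<in> T \<Longrightarrow> 1 \<le> j \<Longrightarrow> (\<lambda>\<omega>. centered i j \<omega> t) \<in> borel_measurable M"
  unfolding centered_def using measurable_process_at[OF meas] by simp

lemma centered_square_integrable:
  assumes t: "t \<in> T" and j: "1 \<le> j"
  shows "integrable M (\<lambda>\<omega>. (centered i j \<omega> t)\<^sup>2)" and "integrable M (\<lambda>\<omega>. centered i j \<omega> t)"
    and "expectation (\<lambda>\<omega>. centered i j \<omega> t) = 0"
    and "expectation (\<lambda>\<omega>. (centered i j \<omega> t)\<^sup>2) = \<gamma> i t t"
proof -
  have xi: "integrable M (\<lambda>\<omega>. x i j \<omega> t)"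
    using measurable_process_at[OF meas[OF j] t] square_int[OF j t] by (rule expectation_abs_le_sqrt(1))
  then show "integrable M (\<lambda>\<omega>. centered i j \<omega> t)" by (simp add: centered_def)
  show "integrable M (\<lambda>\<omega>. (centered i j \<omega> t)\<^sup>2)"
    unfolding centered_def power2_diff using xi square_int[OF j t] by simp
  show "expectation (\<lambda>\<omega>. centered i j \<omega> t) = 0"
    using xi mean[OF j t] by (simp add: centered_def prob_space)
  show "expectation (\<lambda>\<omega>. (centered i j \<omega> t)\<^sup>2) = \<gamma> i t t"
    using cov[OF j t t] by (simp add: centered_def power2_eq_square)
qed

text \<open>2 |v w| \<le> v^2 + w^2 under the expectation. Bounds on the variances thereby become
  bounds on all covariances.\<close>

lemma abs_cov_le:
  assumes t: "t \<in> T" and s: "s \<in> T"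
  shows "integrable M (\<lambda>\<omega>. centered i 1 \<omega> t * centered i 1 \<omega> s)" and "\<bar>\<gamma> i t s\<bar> \<le> (\<gamma> i t t + \<gamma> i s s) / 2"
proof -
  note ct = centered_square_integrable[OF t order_refl] and cs = centered_square_integrable[OF s order_refl]
  have hi: "integrable M (\<lambda>\<omega>. ((centered i 1 \<omega> t)\<^sup>2 + (centered i 1 \<omega> s)\<^sup>2) / 2)"
    using ct(1) cs(1) by simp
  show i: "integrable M (\<lambda>\<omega>. centered i 1 \<omega> t * centered i 1 \<omega> s)"
    by (intro integrable_mult_of_squares centered_measurable ct(1) cs(1) t s order_refl)
  have "\<bar>\<gamma> i t s\<bar> = \<bar>expectation (\<lambda>\<omega>. centered i 1 \<omega> t * centered i 1 \<omega> s)\<bar>"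
    using cov[OF order_refl t s] by (simp add: centered_def)
  also have "\<dots> \<le> expectation (\<lambda>\<omega>. \<bar>centered i 1 \<omega> t * centered i 1 \<omega> s\<bar>)" by (rule integral_abs_bound)
  also have "\<dots> \<le> expectation (\<lambda>\<omega>. ((centered i 1 \<omega> t)\<^sup>2 + (centered i 1 \<omega> s)\<^sup>2) / 2)"
    by (rule integral_mono[OF _ hi abs_mult_le_half]) (use i in auto)
  also have "\<dots> = (\<gamma> i t t + \<gamma> i s s) / 2" using ct cs by simp
  finally show "\<bar>\<gamma> i t s\<bar> \<le> (\<gamma> i t t + \<gamma> i s s) / 2" .
qed

abbreviation "cov_hat i m \<omega> \<equiv> sample_cov m (\<lambda>j. x i j \<omega>)"

lemma cov_hat_measurable:
  assumes t: "t \<in> T" and s: "s \<in> T"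
  shows "(\<lambda>\<omega>. cov_hat i m \<omega> t s) \<in> borel_measurable M"
  unfolding sample_cov_def sample_mean_def
  using measurable_process_at[OF meas] t s
  by (intro borel_measurable_times borel_measurable_sum borel_measurable_diff borel_measurable_const) auto

text \<open>Two averages of squares about the true means dominate the sample covariance for every m,
  and their expectations are at most the two variances. A bound on the variances thus supplies the
  constant \<open>B\<close> of \<open>AE_subsequence_of_L1\<close>.\<close>

lemma cov_hat_error_bounded:
  assumes t: "t \<in> T" and s: "s \<in> T"
  shows "integrable M (\<lambda>\<omega>. \<bar>cov_hat i m \<omega> t s - \<gamma> i t s\<bar>)"
    and "expectation (\<lambda>\<omega>. \<bar>cov_hat i m \<omega> t s - \<gamma> i t s\<bar>) \<le> 2 * (\<gamma> i t t + \<gamma> i s s)"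
proof -
  define R where "R \<omega> = 1 / m * (\<Sum>j=1..m. (centered i j \<omega> t)\<^sup>2) + 1 / m * (\<Sum>j=1..m. (centered i j \<omega> s)\<^sup>2)" for \<omega>
  have le: "\<bar>cov_hat i m \<omega> t s\<bar> \<le> R \<omega>" for \<omega>
    using abs_sample_cov_le[of m "\<lambda>j. x i j \<omega>" t s] sample_cov_diag_le[of m "\<lambda>j. x i j \<omega>" t "\<eta> i t"]
      sample_cov_diag_le[of m "\<lambda>j. x i j \<omega>" s "\<eta> i s"]
    by (simp add: R_def centered_def add_divide_distrib)
  have \<gamma>0: "0 \<le> \<gamma> i t t" "0 \<le> \<gamma> i s s"
    using abs_cov_le(2)[OF t t, of i] abs_cov_le(2)[OF s s, of i] by auto
  have isum: "integrable M (\<lambda>\<omega>. \<Sum>j=1..m. (centered i j \<omega> u)\<^sup>2)" if "u \<in> T" for u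
    by (rule Bochner_Integration.integrable_sum) (use centered_square_integrable(1)[OF that] in auto)
  have Esum: "expectation (\<lambda>\<omega>. \<Sum>j=1..m. (centered i j \<omega> u)\<^sup>2) = (\<Sum>j=1..m. \<gamma> i u u)" if "u \<in> T" for u
    using centered_square_integrable(1,4)[OF that]
    by (subst Bochner_Integration.integral_sum) (auto intro: sum.cong)
  have iR: "integrable M R"
    unfolding R_def[abs_def] by (intro Bochner_Integration.integrable_add integrable_mult_right isum t s)
  have ER: "expectation R \<le> \<gamma> i t t + \<gamma> i s s"
  proof -
    have "expectation R = 1 / m * (\<Sum>j=1..m. \<gamma> i t t) + 1 / m * (\<Sum>j=1..m. \<gamma> i s s)"
      unfolding R_def[abs_def] Esum[OF t, symmetric] Esum[OF s, symmetric]
        integral_mult_right_zero[symmetric]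
      by (intro Bochner_Integration.integral_add integrable_mult_right isum t s)
    also have "\<dots> \<le> \<gamma> i t t + \<gamma> i s s" using \<gamma>0 by simp
    finally show ?thesis .
  qed
  have isc: "integrable M (\<lambda>\<omega>. cov_hat i m \<omega> t s)"
    by (rule Bochner_Integration.integrable_bound[OF iR cov_hat_measurable[OF t s]])
       (intro AE_I2, use le in \<open>simp add: order_trans[OF _ abs_ge_self]\<close>)
  then show i: "integrable M (\<lambda>\<omega>. \<bar>cov_hat i m \<omega> t s - \<gamma> i t s\<bar>)" by simp
  have "expectation (\<lambda>\<omega>. \<bar>cov_hat i m \<omega> t s - \<gamma> i t s\<bar>) \<le> expectation (\<lambda>\<omega>. R \<omega> + \<bar>\<gamma> i t s\<bar>)"
  proof (rule integral_mono[OF i])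
    show "integrable M (\<lambda>\<omega>. R \<omega> + \<bar>\<gamma> i t s\<bar>)" using iR by simp
    show "\<bar>cov_hat i m \<omega> t s - \<gamma> i t s\<bar> \<le> R \<omega> + \<bar>\<gamma> i t s\<bar>" for \<omega>
      using le[of \<omega>] by linarith
  qed
  also have "\<dots> = expectation R + \<bar>\<gamma> i t s\<bar>" using iR by (simp add: prob_space)
  also have "\<dots> \<le> 2 * (\<gamma> i t t + \<gamma> i s s)" 
  proof -
    have "(\<gamma> i t t + \<gamma> i s s) / 2 \<le> \<gamma> i t t + \<gamma> i s s" using \<gamma>0 by simp
    then have "\<bar>\<gamma> i t s\<bar> \<le> \<gamma> i t t + \<gamma> i s s" using abs_cov_le(2)[OF t s, of i] by (rule order_trans[rotated])
    from add_mono[OF ER this] show ?thesis by simp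
  qed
  finally show "expectation (\<lambda>\<omega>. \<bar>cov_hat i m \<omega> t s - \<gamma> i t s\<bar>) \<le> 2 * (\<gamma> i t t + \<gamma> i s s)" .
qed

text \<open>The weak law is applied to the products of centred values, whose common law
  \<open>D\<close> has mean \<open>\<gamma> i t s\<close>. The rate for \<open>D\<close> depends on
  the pair of times, so uniformity in time is replaced by domination afterwards.\<close>

lemma cov_hat_L1_tendsto:
  assumes t: "t \<in> T" and s: "s \<in> T" and m: "filterlim m at_top sequentially"
  shows "(\<lambda>l. expectation (\<lambda>\<omega>. \<bar>cov_hat i (m l) \<omega> t s - \<gamma> i t s\<bar>)) \<longlonglongrightarrow> 0"
proof -
  define D where "D = distr M borel (\<lambda>\<omega>. centered i 1 \<omega> t * centered i 1 \<omega> s)"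
  note [measurable] = eval_measurable[OF t] eval_measurable[OF s]
  have path: "path_on T (x i j) \<omega> t = x i j \<omega> t" "path_on T (x i j) \<omega> s = x i j \<omega> s" for j \<omega>
    using t s by (simp_all add: path_on_def)
  have fA: "(\<lambda>y. y t - \<eta> i t) \<in> borel_measurable (path_space T)"
    and fB: "(\<lambda>y. y s - \<eta> i s) \<in> borel_measurable (path_space T)"
    and fAB: "(\<lambda>y. (y t - \<eta> i t) * (y s - \<eta> i s)) \<in> borel_measurable (path_space T)"
    by measurable
  have c1: "(\<lambda>\<omega>. centered i 1 \<omega> t * centered i 1 \<omega> s) \<in> borel_measurable M"
    using centered_measurable t s by simp
  have ED: "(\<integral>u. u \<partial>D) = \<gamma> i t s"
    unfolding D_def using c1 cov[OF order_refl t s] by (simp add: integral_distr centered_def)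
  have iD: "integrable D (\<lambda>u. u)"
    unfolding D_def using c1 abs_cov_le(1)[OF t s] by (simp add: integrable_distr_eq)
  have D: "distr M borel (\<lambda>\<omega>. (x i j \<omega> t - \<eta> i t) * (x i j \<omega> s - \<eta> i s)) = D" if "j \<in> {1..k}" for j k
    using distr_functional[OF fAB, of j i] that by (simp add: D_def centered_def path)
  note ct = centered_square_integrable[OF t, unfolded centered_def] and cs = centered_square_integrable[OF s, unfolded centered_def]
  have bound: "expectation (\<lambda>\<omega>. \<bar>cov_hat i k \<omega> t s - \<gamma> i t s\<bar>) \<le>
      2 * wlln_rate D k + (\<bar>\<gamma> i t s\<bar> + (\<gamma> i t t + \<gamma> i s s) / 2) / (real k - 1)" if "2 \<le> k" for k
    using sample_cov_L1[where X = "x i" and \<eta> = "\<eta> i" and t = t and s = s and m = k and D = D and \<alpha> = "\<gamma> i t t" and \<beta> = "\<gamma> i s s", OF that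
        indep_functional[OF fA, where i = i, unfolded path] indep_functional[OF fB, where i = i, unfolded path]
        indep_functional[OF fAB, where i = i, unfolded path] _ _ _ _ _ _ D[of _ k]]
      ct cs by (simp add: ED)
  have "(\<lambda>k. 2 * wlln_rate D k + (\<bar>\<gamma> i t s\<bar> + (\<gamma> i t t + \<gamma> i s s) / 2) / (real k - 1)) \<longlonglongrightarrow> 2 * 0 + 0"
  proof (intro tendsto_intros)
    show "wlln_rate D \<longlonglongrightarrow> 0" by (rule wlln_rate_tendsto[OF _ iD]) (simp add: D_def)
    show "(\<lambda>k. (\<bar>\<gamma> i t s\<bar> + (\<gamma> i t t + \<gamma> i s s) / 2) / (real k - 1)) \<longlonglongrightarrow> 0"
    proof (rule LIMSEQ_imp_Suc)
      show "(\<lambda>n. (\<bar>\<gamma> i t s\<bar> + (\<gamma> i t t + \<gamma> i s s) / 2) / (real (Suc n) - 1)) \<longlonglongrightarrow> 0"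
        using lim_const_over_n[of "\<bar>\<gamma> i t s\<bar> + (\<gamma> i t t + \<gamma> i s s) / 2"] by simp
    qed
  qed
  then have lim: "(\<lambda>k. 2 * wlln_rate D k + (\<bar>\<gamma> i t s\<bar> + (\<gamma> i t t + \<gamma> i s s) / 2) / (real k - 1)) \<longlonglongrightarrow> 0" by simp
  have "(\<lambda>k. expectation (\<lambda>\<omega>. \<bar>cov_hat i k \<omega> t s - \<gamma> i t s\<bar>)) \<longlonglongrightarrow> 0"
  proof (rule Lim_null_comparison[OF _ lim])
    show "\<forall>\<^sub>F k in sequentially. norm (expectation (\<lambda>\<omega>. \<bar>cov_hat i k \<omega> t s - \<gamma> i t s\<bar>)) \<le>
       2 * wlln_rate D k + (\<bar>\<gamma> i t s\<bar> + (\<gamma> i t t + \<gamma> i s s) / 2) / (real k - 1)"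
      using eventually_ge_at_top[of 2]
      by eventually_elim (use bound in \<open>simp add: integral_nonneg_AE\<close>)
  qed
  from filterlim_compose[OF this m] show ?thesis .
qed

lemma cov_hat_AE_subsequence:
  fixes a b :: real and m :: "nat \<Rightarrow> 'k \<Rightarrow> nat"
  defines "S \<equiv> restrict_space lborel {a..b}"
  assumes T: "T = {a..b}" and G: "\<And>i t. t \<in> T \<Longrightarrow> \<gamma> i t t \<le> G"
    and m: "\<And>i. filterlim (\<lambda>l. m l i) at_top sequentially"
  obtains g :: "nat \<Rightarrow> nat" where "strict_mono g"
    "AE \<omega> in M. (AE ts in S \<Otimes>\<^sub>M S. \<forall>i. (\<lambda>l. cov_hat i (m (g l) i) \<omega> (fst ts) (snd ts)) \<longlonglongrightarrow> \<gamma> i (fst ts) (snd ts)) \<and>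
       (AE t in S. \<forall>i. (\<lambda>l. cov_hat i (m (g l) i) \<omega> t t) \<longlonglongrightarrow> \<gamma> i t t)"
proof -
  have S: "finite_measure S"
    unfolding S_def by (intro finite_measureI) (simp add: space_restrict_space emeasure_restrict_space emeasure_lborel_Icc_eq)
  interpret S: finite_measure S by fact
  have SS: "finite_measure (S \<Otimes>\<^sub>M S)" by (rule finite_measure_pair_measure[OF S S])
  interpret SS: finite_measure "S \<Otimes>\<^sub>M S" by fact
  have space_S: "space S = T" by (simp add: S_def T space_restrict_space)
  have xm: "(\<lambda>p. x i j (fst p) (snd p)) \<in> borel_measurable (M \<Otimes>\<^sub>M S)" if "1 \<le> j" for i j
    using measurable_process_restrict_lborel[OF meas[where i = i, OF that]] by (simp add: S_def T case_prod_beta')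
  have xm1: "(\<lambda>p. x i 1 (fst p) (snd p)) \<in> borel_measurable (M \<Otimes>\<^sub>M S)" for i by (rule xm) simp
  \<comment> \<open>As expectations with time as a parameter, \<eta> and, below, \<gamma> inherit
    measurability on the time domain from the joint measurability of the first observation.\<close>
  have \<eta>m: "\<eta> i \<in> borel_measurable S" for i
  proof -
    have "(\<lambda>(t, \<omega>). x i 1 \<omega> t) \<in> borel_measurable (S \<Otimes>\<^sub>M M)"
      using measurable_compose[OF measurable_pair_swap' xm1] by (simp add: case_prod_beta')
    then have "(\<lambda>t. \<integral>\<omega>. x i 1 \<omega> t \<partial>M) \<in> borel_measurable S"
      by (rule borel_measurable_lebesgue_integral)
    then show ?thesis
      by (rule measurable_cong[THEN iffD1, rotated]) (use mean in \<open>simp add: space_S\<close>)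
  qed
  have \<gamma>m: "(\<lambda>ts. \<gamma> i (fst ts) (snd ts)) \<in> borel_measurable (S \<Otimes>\<^sub>M S)" for i
  proof -
    have x1: "(\<lambda>p. x i 1 (snd p) (fst (fst p))) \<in> borel_measurable ((S \<Otimes>\<^sub>M S) \<Otimes>\<^sub>M M)"
    proof -
      have "(\<lambda>p. (snd p, fst (fst p))) \<in> (S \<Otimes>\<^sub>M S) \<Otimes>\<^sub>M M \<rightarrow>\<^sub>M M \<Otimes>\<^sub>M S" by measurable
      from measurable_compose[OF this xm1] show ?thesis by simp
    qed
    have x2: "(\<lambda>p. x i 1 (snd p) (snd (fst p))) \<in> borel_measurable ((S \<Otimes>\<^sub>M S) \<Otimes>\<^sub>M M)"
    proof -
      have "(\<lambda>p. (snd p, snd (fst p))) \<in> (S \<Otimes>\<^sub>M S) \<Otimes>\<^sub>M M \<rightarrow>\<^sub>M M \<Otimes>\<^sub>M S" by measurable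
      from measurable_compose[OF this xm1] show ?thesis by simp
    qed
    have e1: "(\<lambda>p. \<eta> i (fst (fst p))) \<in> borel_measurable ((S \<Otimes>\<^sub>M S) \<Otimes>\<^sub>M M)"
      and e2: "(\<lambda>p. \<eta> i (snd (fst p))) \<in> borel_measurable ((S \<Otimes>\<^sub>M S) \<Otimes>\<^sub>M M)"
      by (rule measurable_compose[OF _ \<eta>m], measurable)+
    have "(\<lambda>(ts, \<omega>). (x i 1 \<omega> (fst ts) - \<eta> i (fst ts)) * (x i 1 \<omega> (snd ts) - \<eta> i (snd ts))) \<in> borel_measurable ((S \<Otimes>\<^sub>M S) \<Otimes>\<^sub>M M)"
      unfolding case_prod_beta' by (intro borel_measurable_times borel_measurable_diff x1 x2 e1 e2)
    then have "(\<lambda>ts. \<integral>\<omega>. (x i 1 \<omega> (fst ts) - \<eta> i (fst ts)) * (x i 1 \<omega> (snd ts) - \<eta> i (snd ts)) \<partial>M) \<in> borel_measurable (S \<Otimes>\<^sub>M S)"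
      by (rule borel_measurable_lebesgue_integral)
    then show ?thesis
      by (rule measurable_cong[THEN iffD1, rotated])
         (use cov in \<open>auto simp: space_S space_pair_measure\<close>)
  qed
  \<comment> \<open>Summing over the groups makes one subsequence serve all of them.\<close>
  define err where "err l \<omega> t s = (\<Sum>i\<in>UNIV. \<bar>cov_hat i (m l i) \<omega> t s - \<gamma> i t s\<bar>)" for l \<omega> t s
  have err0: "0 \<le> err l \<omega> t s" for l \<omega> t s by (simp add: err_def sum_nonneg)
  have errm: "(\<lambda>p. err l (fst p) (fst (snd p)) (snd (snd p))) \<in> borel_measurable (M \<Otimes>\<^sub>M (S \<Otimes>\<^sub>M S))" for l
  proof -
    have x1: "(\<lambda>p. x i j (fst p) (fst (snd p))) \<in> borel_measurable (M \<Otimes>\<^sub>M (S \<Otimes>\<^sub>M S))"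
      and x2: "(\<lambda>p. x i j (fst p) (snd (snd p))) \<in> borel_measurable (M \<Otimes>\<^sub>M (S \<Otimes>\<^sub>M S))" if "1 \<le> j" for i j
    proof -
      have "(\<lambda>p. (fst p, fst (snd p))) \<in> M \<Otimes>\<^sub>M (S \<Otimes>\<^sub>M S) \<rightarrow>\<^sub>M M \<Otimes>\<^sub>M S"
        and "(\<lambda>p. (fst p, snd (snd p))) \<in> M \<Otimes>\<^sub>M (S \<Otimes>\<^sub>M S) \<rightarrow>\<^sub>M M \<Otimes>\<^sub>M S" by measurable
      from this[THEN measurable_compose, OF xm[OF that]]
      show "(\<lambda>p. x i j (fst p) (fst (snd p))) \<in> borel_measurable (M \<Otimes>\<^sub>M (S \<Otimes>\<^sub>M S))"
        and "(\<lambda>p. x i j (fst p) (snd (snd p))) \<in> borel_measurable (M \<Otimes>\<^sub>M (S \<Otimes>\<^sub>M S))" by simp_all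
    qed
    have g: "(\<lambda>p. \<gamma> i (fst (snd p)) (snd (snd p))) \<in> borel_measurable (M \<Otimes>\<^sub>M (S \<Otimes>\<^sub>M S))" for i
      by (rule measurable_compose[OF measurable_snd \<gamma>m])
    show ?thesis
      unfolding err_def sample_cov_def sample_mean_def
      by (intro borel_measurable_sum borel_measurable_abs borel_measurable_diff borel_measurable_times borel_measurable_const x1 x2 g) auto
  qed
  have erri: "integrable M (\<lambda>\<omega>. err l \<omega> t s)" if "t \<in> T" "s \<in> T" for l t s
    unfolding err_def using cov_hat_error_bounded(1)[OF that] by (intro Bochner_Integration.integrable_sum)
  have Eerr: "expectation (\<lambda>\<omega>. err l \<omega> t s) = (\<Sum>i\<in>UNIV. expectation (\<lambda>\<omega>. \<bar>cov_hat i (m l i) \<omega> t s - \<gamma> i t s\<bar>))"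
    if "t \<in> T" "s \<in> T" for l t s
    unfolding err_def using cov_hat_error_bounded(1)[OF that] by (intro Bochner_Integration.integral_sum)
  have errb: "expectation (\<lambda>\<omega>. err l \<omega> t s) \<le> (\<Sum>i\<in>(UNIV :: 'k set). 4 * G)" if "t \<in> T" "s \<in> T" for l t s
    unfolding Eerr[OF that]
  proof (rule sum_mono)
    fix i
    show "expectation (\<lambda>\<omega>. \<bar>cov_hat i (m l i) \<omega> t s - \<gamma> i t s\<bar>) \<le> 4 * G"
    proof (rule order_trans[OF cov_hat_error_bounded(2)[OF that]])
      have "2 * (\<gamma> i t t + \<gamma> i s s) \<le> 2 * (G + G)" by (intro mult_left_mono add_mono G that) simp
      then show "2 * (\<gamma> i t t + \<gamma> i s s) \<le> 4 * G" by simp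
    qed
  qed
  have errl: "(\<lambda>l. expectation (\<lambda>\<omega>. err l \<omega> t s)) \<longlonglongrightarrow> 0" if "t \<in> T" "s \<in> T" for t s
  proof -
    have "(\<lambda>l. \<Sum>i\<in>UNIV. expectation (\<lambda>\<omega>. \<bar>cov_hat i (m l i) \<omega> t s - \<gamma> i t s\<bar>)) \<longlonglongrightarrow> (\<Sum>i\<in>(UNIV :: 'k set). 0)"
      by (intro tendsto_sum cov_hat_L1_tendsto that m)
    then show ?thesis unfolding Eerr[OF that] by simp
  qed
  have err_lim: "\<forall>i. (\<lambda>l. cov_hat i (m (g l) i) \<omega> t s) \<longlonglongrightarrow> \<gamma> i t s" if "(\<lambda>l. err (g l) \<omega> t s) \<longlonglongrightarrow> 0" for g :: "nat \<Rightarrow> nat" and \<omega> t s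
  proof
    fix i
    show "(\<lambda>l. cov_hat i (m (g l) i) \<omega> t s) \<longlonglongrightarrow> \<gamma> i t s"
    proof (rule Lim_null[THEN iffD2], rule Lim_null_comparison[OF _ that])
      show "\<forall>\<^sub>F l in sequentially. norm (cov_hat i (m (g l) i) \<omega> t s - \<gamma> i t s) \<le> err (g l) \<omega> t s"
        unfolding err_def real_norm_def by (intro always_eventually allI member_le_sum) auto
    qed
  qed
  obtain g1 where g1: "strict_mono g1"
    "AE \<omega> in M. AE ts in S \<Otimes>\<^sub>M S. (\<lambda>l. err (g1 l) \<omega> (fst ts) (snd ts)) \<longlonglongrightarrow> 0"
  proof (rule AE_subsequence_of_L1[OF prob_space_axioms SS, where h = "\<lambda>l \<omega> ts. err l \<omega> (fst ts) (snd ts)"])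
    show "(\<lambda>(\<omega>, ts). err l \<omega> (fst ts) (snd ts)) \<in> borel_measurable (M \<Otimes>\<^sub>M (S \<Otimes>\<^sub>M S))" for l
      using errm by (simp add: case_prod_beta')
    show "(\<integral>\<omega>. err l \<omega> (fst ts) (snd ts) \<partial>M) \<le> (\<Sum>i\<in>(UNIV :: 'k set). 4 * G)" if "ts \<in> space (S \<Otimes>\<^sub>M S)" for l ts
      using that by (intro errb) (auto simp: space_pair_measure space_S)
  qed (auto simp: space_pair_measure space_S err0 intro: erri errl)
  \<comment> \<open>The diagonal has measure 0 in the square, so it needs its own extraction; along
    a further subsequence of g1 the convergence at almost all pairs is kept.\<close>
  obtain g2 where g2: "strict_mono g2" "AE \<omega> in M. AE t in S. (\<lambda>l. err (g1 (g2 l)) \<omega> t t) \<longlonglongrightarrow> 0"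
  proof (rule AE_subsequence_of_L1[OF prob_space_axioms S, where h = "\<lambda>l \<omega> t. err (g1 l) \<omega> t t"])
    show "(\<lambda>(\<omega>, t). err (g1 l) \<omega> t t) \<in> borel_measurable (M \<Otimes>\<^sub>M S)" for l
    proof -
      have "(\<lambda>p. (fst p, (snd p, snd p))) \<in> M \<Otimes>\<^sub>M S \<rightarrow>\<^sub>M M \<Otimes>\<^sub>M (S \<Otimes>\<^sub>M S)" by measurable
      from measurable_compose[OF this errm[of "g1 l"]] show ?thesis by (simp add: case_prod_beta')
    qed
    show "(\<integral>\<omega>. err (g1 l) \<omega> t t \<partial>M) \<le> (\<Sum>i\<in>(UNIV :: 'k set). 4 * G)" if "t \<in> space S" for l t
      using that by (intro errb) (auto simp: space_S)
    show "(\<lambda>l. \<integral>\<omega>. err (g1 l) \<omega> t t \<partial>M) \<longlonglongrightarrow> 0" if "t \<in> space S" for t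
      using LIMSEQ_subseq_LIMSEQ[OF errl g1(1), of t t] that by (simp add: comp_def space_S)
  qed (auto simp: space_S err0 intro: erri)
  show ?thesis
  proof (rule that)
    show "strict_mono (g1 \<circ> g2)" using g1(1) g2(1) by (rule strict_mono_o)
    show "AE \<omega> in M. (AE ts in S \<Otimes>\<^sub>M S. \<forall>i. (\<lambda>l. cov_hat i (m ((g1 \<circ> g2) l) i) \<omega> (fst ts) (snd ts)) \<longlonglongrightarrow> \<gamma> i (fst ts) (snd ts)) \<and>
       (AE t in S. \<forall>i. (\<lambda>l. cov_hat i (m ((g1 \<circ> g2) l) i) \<omega> t t) \<longlonglongrightarrow> \<gamma> i t t)"
      using g1(2) g2(2)
    proof eventually_elim
      case (elim \<omega>)
      have "AE ts in S \<Otimes>\<^sub>M S. \<forall>i. (\<lambda>l. cov_hat i (m ((g1 \<circ> g2) l) i) \<omega> (fst ts) (snd ts)) \<longlonglongrightarrow> \<gamma> i (fst ts) (snd ts)"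
        using elim(1)
      proof eventually_elim
        case (elim ts)
        from LIMSEQ_subseq_LIMSEQ[OF elim g2(1)]
        show ?case by (intro err_lim) (simp add: comp_def)
      qed
      moreover have "AE t in S. \<forall>i. (\<lambda>l. cov_hat i (m ((g1 \<circ> g2) l) i) \<omega> t t) \<longlonglongrightarrow> \<gamma> i t t"
        using elim(2) by eventually_elim (intro err_lim, simp)
      ultimately show ?case ..
    qed
  qed
qed

end
theorem theorem2:
  fixes M :: "'a measure"
    and a b :: real and T :: "real set"
    and H :: "real ^ 'k ^ 'r"
    and x :: "'k \<Rightarrow> nat \<Rightarrow> 'a \<Rightarrow> real \<Rightarrow> real"
    and \<eta> :: "'k \<Rightarrow> real \<Rightarrow> real"
    and \<gamma> :: "'k \<Rightarrow> real \<Rightarrow> real \<Rightarrow> real"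
    and ns :: "nat \<Rightarrow> 'k \<Rightarrow> nat"
    and \<tau> :: "'k \<Rightarrow> real"
    and N :: "nat \<Rightarrow> 'a \<Rightarrow> 'b measure"
    and xP :: "nat \<Rightarrow> 'a \<Rightarrow> 'k \<Rightarrow> nat \<Rightarrow> 'b \<Rightarrow> real \<Rightarrow> real"
    and Nz :: "'c measure"
    and z :: "'c \<Rightarrow> real \<Rightarrow> real ^ 'r"
  defines "v \<equiv> \<lambda>i j \<omega> t. x i j \<omega> t - \<eta> i t"
  assumes "prob_space M"
    and "a \<le> b" and "T = {a..b}"
    \<comment> \<open>independence within and across the samples\<close>
    and "prob_space.indep_vars M (\<lambda>_. path_space T) (\<lambda>(i, j). path_on T (x i j)) (UNIV \<times> {1..})"
    \<comment> \<open>(i)\<close>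
    and "\<And>i j. j \<ge> 1 \<Longrightarrow> measurable_process M T (x i j)"
    and "\<And>i j \<omega>. j \<ge> 1 \<Longrightarrow> \<omega> \<in> space M \<Longrightarrow> x i j \<omega> square_integrable_on T"
    and "\<And>i j. j \<ge> 1 \<Longrightarrow>
           distr M (path_space T) (path_on T (x i j)) = distr M (path_space T) (path_on T (x i 1))"
    and "\<And>i j t. j \<ge> 1 \<Longrightarrow> t \<in> T \<Longrightarrow> integrable M (\<lambda>\<omega>. (x i j \<omega> t)\<^sup>2)"
    and "\<And>i j t. j \<ge> 1 \<Longrightarrow> t \<in> T \<Longrightarrow> (\<integral>\<omega>. x i j \<omega> t \<partial>M) = \<eta> i t"
    and "\<And>i j t s. j \<ge> 1 \<Longrightarrow> t \<in> T \<Longrightarrow> s \<in> T \<Longrightarrow> (\<integral>\<omega>. v i j \<omega> t * v i j \<omega> s \<partial>M) = \<gamma> i t s"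
    \<comment> \<open>(ii)\<close>
    and "\<And>i. \<eta> i square_integrable_on T"
    \<comment> \<open>(iii)\<close>
    and "\<And>i. continuous_on T (\<lambda>t. \<gamma> i t t)"
    and "\<And>i t. t \<in> T \<Longrightarrow> \<gamma> i t t > 0"
    \<comment> \<open>(iv)\<close>
    and "filterlim (\<lambda>l. total_size (ns l)) at_top sequentially"
    and "\<And>i. \<tau> i > 0"
    and "\<And>i. (\<lambda>l. real (ns l i) / real (total_size (ns l))) \<longlonglongrightarrow> \<tau> i"
    \<comment> \<open>(v)\<close>
    and "\<And>i. integrable M (\<lambda>\<omega>. (LBINT t:T. (v i 1 \<omega> t)\<^sup>2)\<^sup>2)"
    \<comment> \<open>(vi)\<close>
    and "\<And>i j. j \<in> {1, 2} \<Longrightarrow>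
           ((\<lambda>\<delta>. outer_expectation M (\<lambda>\<omega>.
               SUP (t, s) \<in> {(t, s). t \<in> T \<and> s \<in> T \<and> \<bar>t - s\<bar> < \<delta>}.
                 ennreal \<bar>v i 1 \<omega> t * v i j \<omega> t - v i 1 \<omega> s * v i j \<omega> s\<bar>))
             \<longlongrightarrow> 0) (at_right (0::real))"
    \<comment> \<open>conditionally on the data, \<open>xP l \<omega>\<close> is a parametric bootstrap sample on \<open>N l \<omega>\<close>\<close>
    and "AE \<omega> in M. \<forall>l. parametric_bootstrap (N l \<omega>) T (ns l) (\<lambda>i j. x i j \<omega>) (xP l \<omega>)"
    \<comment> \<open>the limit process\<close>
    and "GP_vec Nz T (\<lambda>t s. H ** Sigma_lim \<tau> \<gamma> t s ** transpose H) z"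
  shows "cond_conv_in_distr M
           (\<lambda>l \<omega>. distr (N l \<omega>) borel (\<lambda>\<omega>'. statistic T H (ns l) (\<lambda>i j. xP l \<omega> i j \<omega>')))
           (distr Nz borel (\<lambda>\<omega>'. LBINT t:T.
              z \<omega>' t \<bullet> (pinv (H ** Sigma_lim \<tau> \<gamma> t t ** transpose H) *v z \<omega>' t)))"
proof -
  note v_def = \<open>v \<equiv> \<lambda>i j \<omega> t. x i j \<omega> t - \<eta> i t\<close>
  note prob = \<open>prob_space M\<close> and T = \<open>T = {a..b}\<close>
  interpret functional_samples M T x \<eta> \<gamma>
    unfolding functional_samples_def functional_samples_axioms_def
    using assms(2,5,6,8-11) unfolding v_def by blast
  show ?thesis
    unfolding cond_conv_in_distr_def
  proof (intro allI impI)
    fix f :: "nat \<Rightarrow> nat" assume f: "strict_mono f"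
    note size = \<open>filterlim (\<lambda>l. total_size (ns l)) at_top sequentially\<close>
    note \<tau> = \<open>\<And>i. \<tau> i > 0\<close> and ratio = \<open>\<And>i. (\<lambda>l. real (ns l i) / real (total_size (ns l))) \<longlonglongrightarrow> \<tau> i\<close>
    note \<gamma>c = \<open>\<And>i. continuous_on T (\<lambda>t. \<gamma> i t t)\<close> and \<gamma>pos = \<open>\<And>i t. t \<in> T \<Longrightarrow> \<gamma> i t t > 0\<close>
    \<comment> \<open>A common bound G for the variances, from continuity on the compact domain and
      finiteness of the set of groups; it provides the domination in the extraction below.\<close>
    have "\<exists>B. \<forall>t\<in>T. \<gamma> i t t \<le> B" for i
      using compact_imp_bounded[OF compact_continuous_image[OF \<gamma>c[of i]]] T
      by (auto simp: bounded_real intro: order_trans[OF abs_ge_self])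
    then obtain B where B: "\<And>i t. t \<in> T \<Longrightarrow> \<gamma> i t t \<le> B i" by metis
    define G where "G = Max (range B)"
    have G: "\<gamma> i t t \<le> G" if "t \<in> T" for i t
    proof -
      have "B i \<le> G" unfolding G_def by (intro Max_ge) auto
      with B[OF that, of i] show ?thesis by (rule order_trans)
    qed
    have sub: "filterlim g sequentially sequentially" if "strict_mono g" for g :: "nat \<Rightarrow> nat"
      using that by (rule filterlim_subseq)
    have m: "filterlim (\<lambda>l. ns (f l) i) at_top sequentially" for i
      using filterlim_compose[OF bootstrap_sizes(1)[OF size \<tau> ratio] sub[OF f]] .
    \<comment> \<open>The subsequence is chosen from the sample covariances of the data and does not
      depend on \<omega>; the bootstrap processes enter only afterwards, one realisation at a
      time.\<close>
    obtain g where g: "strict_mono g" and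
      AEg: "AE \<omega> in M. (AE ts in restrict_space lborel {a..b} \<Otimes>\<^sub>M restrict_space lborel {a..b}.
          \<forall>i. (\<lambda>l. cov_hat i (ns (f (g l)) i) \<omega> (fst ts) (snd ts)) \<longlonglongrightarrow> \<gamma> i (fst ts) (snd ts)) \<and>
        (AE t in restrict_space lborel {a..b}. \<forall>i. (\<lambda>l. cov_hat i (ns (f (g l)) i) \<omega> t t) \<longlonglongrightarrow> \<gamma> i t t)"
      by (rule cov_hat_AE_subsequence[where m = "\<lambda>l. ns (f l)", OF T G m])
    have fg: "filterlim (\<lambda>l. f (g l)) sequentially sequentially"
      using sub[OF strict_mono_o[OF f g]] by (simp add: comp_def)
    show "\<exists>g. strict_mono g \<and> (AE \<omega> in M. weak_conv_m
        (\<lambda>l. distr (N (f (g l)) \<omega>) borel (\<lambda>\<omega>'. statistic T H (ns (f (g l))) (\<lambda>i j. xP (f (g l)) \<omega> i j \<omega>')))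
        (distr Nz borel (\<lambda>\<omega>'. LBINT t:T. z \<omega>' t \<bullet> (pinv (H ** Sigma_lim \<tau> \<gamma> t t ** transpose H) *v z \<omega>' t))))"
    proof (intro exI conjI)
      show "strict_mono g" by fact
      show "AE \<omega> in M. weak_conv_m
        (\<lambda>l. distr (N (f (g l)) \<omega>) borel (\<lambda>\<omega>'. statistic T H (ns (f (g l))) (\<lambda>i j. xP (f (g l)) \<omega> i j \<omega>')))
        (distr Nz borel (\<lambda>\<omega>'. LBINT t:T. z \<omega>' t \<bullet> (pinv (H ** Sigma_lim \<tau> \<gamma> t t ** transpose H) *v z \<omega>' t)))"
        using AEg \<open>AE \<omega> in M. \<forall>l. parametric_bootstrap (N l \<omega>) T (ns l) (\<lambda>i j. x i j \<omega>) (xP l \<omega>)\<close>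
      proof eventually_elim
        case (elim \<omega>)
        show ?case
          unfolding T
        proof (rule bootstrap_weak_conv[where x = "\<lambda>i j. x i j \<omega>" and Y = "\<lambda>l. xP (f (g l)) \<omega>"])
          show "parametric_bootstrap (N (f (g l)) \<omega>) {a..b} (ns (f (g l))) (\<lambda>i j. x i j \<omega>) (xP (f (g l)) \<omega>)" for l
            using elim(2) T by simp
          show "filterlim (\<lambda>l. total_size (ns (f (g l)))) at_top sequentially"
            by (rule filterlim_compose[OF size fg])
          show "(\<lambda>l. real (ns (f (g l)) i) / real (total_size (ns (f (g l))))) \<longlonglongrightarrow> \<tau> i" for i
            by (rule filterlim_compose[OF ratio fg])
          show "GP_vec Nz {a..b} (\<lambda>t s. H ** Sigma_lim \<tau> \<gamma> t s ** transpose H) z"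
            using \<open>GP_vec Nz T (\<lambda>t s. H ** Sigma_lim \<tau> \<gamma> t s ** transpose H) z\<close> T by simp
        qed (use elim(1) \<tau> \<gamma>c \<gamma>pos T in auto)
      qed
    qed
  qed
qed

end
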